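(* Let $n\ge1$, $p_1,\dots,p_n\in(0,1)$, $\alpha\ge0$ with $\alpha p_j<1$ for $1\le j\le n$, and let $L_{\alpha,0}(2n,2n)$ be the last passage time from $(1,1)$ to $(2n,2n)$ on the doubly symmetric random weight array with these parameters (case $\beta=0$) described in the context. Let $$c_{\alpha,0}=\prod_{1\le i<j\le n}\frac{1}{(1-p_ip_j)^2}\prod_{1\le j\le n}\frac{1}{1-p_j^2}\cdot\frac{1}{1-\alpha p_j}.$$ For all $u\in\mathbb{Z}_{\ge0}$, the following four quantities are equal: $$A=c_{\alpha,0}\cdot\mathbb{P}\big(L_{\alpha,0}(2n,2n)\le 2u\big),$$ $$B=\Big[\prod_{i=1}^np_i\Big]^u\sum_{\lambda\subseteq u^n}\alpha^{\mathrm{oddrows}(u^n-\lambda)'}\cdot\mathrm{sp}^{(2n)}_\lambda(p_1,\dots,p_n),$$ $$C=\Big[\prod_{i=1}^np_i\Big]^u\,\mathrm{s}^{(2n+1)}_{(u^n,0^{n+1})}(p_1^{-1},\dots,p_n^{-1},p_1,\dots,p_n,\alpha),$$ $$D=\sum_{\mu\subseteq u^n}\mathrm{s}^{(n)}_\mu(p_1,\dots,p_n)\cdot\mathrm{s}^{(n+1)}_{(\mu,0)}(p_1,\dots,p_n,\alpha).$$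
   Context: Last passage percolation: set $p_{2n-i+1}=p_i$ for $1\le i\le n$. $\{W_{i,j}:1\le i,j\le 2n\}$ is an array of random variables with $W_{i,j}=W_{2n-j+1,2n-i+1}=W_{j,i}$ for all $(i,j)$, such that the weights with $i\le j\le 2n-i+1$ are independent and: $\mathbb{P}(W_{i,j}=k)=(1-p_ip_j)(p_ip_j)^k$ for $k\in\mathbb{Z}_{\ge0}$ if $i<j<2n-i+1$; $W_{i,j}$ takes only even values with $\mathbb{P}(W_{i,j}=k)=(1-p_j^2)p_j^k$ for $k\in2\mathbb{Z}_{\ge0}$ if $i<j=2n-i+1$; $\mathbb{P}(W_{j,j}=k)=(1-\alpha p_j)(\alpha p_j)^k$ for $k\in\mathbb{Z}_{\ge0}$ if $1\le j\le n$ (with $0^0=1$). $L_{\alpha,0}(2n,2n)=\max_\pi\sum_{(i,j)\in\pi}W_{i,j}$, the maximum being over directed paths $\pi$ from $(1,1)$ to $(2n,2n)$, i.e. paths with steps $(1,0)$ or $(0,1)$. Partitions: an $n$-partition is an $n$-tuple of integers $\lambda_1\ge\dots\ge\lambda_n\ge0$; $u^n=(u,\dots,u)$; $(a,b)$ denotes concatenation. A sum over $\lambda\subseteq u^n$ is over all $n$-partitions with $\lambda_1\le u$. $u^n-\lambda=(u-\lambda_n,\dots,u-\lambda_1)$; $\mu'$ is the conjugate of $\mu$ and $\mathrm{oddrows}\,\mu$ the number of odd parts of $\mu$, so $\mathrm{oddrows}(u^n-\lambda)'=\sum_{i=1}^n(-1)^{n-i}(u-\lambda_i)$. $\mathrm{s}^{(m)}_\mu(x_1,\dots,x_m)$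 is the usual Schur polynomial in $m$ variables indexed by the partition $\mu$. Symplectic Schur polynomials: a symplectic pattern of height $2n$ is an array $z=(z_{i,j})_{1\le i\le 2n,\,1\le j\le\lceil i/2\rceil}$ of non-negative integers with $z_{i+1,j+1}\le z_{i,j}\le z_{i+1,j}$ (each inequality whenever both entries exist). Its shape is its last row, and $\mathrm{type}(z)_i=\sum_{j=1}^{\lceil i/2\rceil}z_{i,j}-\sum_{j=1}^{\lceil(i-1)/2\rceil}z_{i-1,j}$. For an $n$-partition $\lambda$, $\mathrm{sp}^{(2n)}_\lambda(x_1,\dots,x_n)=\sum_z\prod_{i=1}^nx_i^{\mathrm{type}(z)_{2i}-\mathrm{type}(z)_{2i-1}}$ over symplectic patterns of height $2n$ and shape $\lambda$. *)

theory Defs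
  imports "HOL-Probability.Probability"
begin

section \<open>Last passage percolation\<close>

definition directed_step :: "nat \<times> nat \<Rightarrow> nat \<times> nat \<Rightarrow> bool" where
  "directed_step a b \<longleftrightarrow> b = (fst a + 1, snd a) \<or> b = (fst a, snd a + 1)"

definition directed_paths :: "nat \<times> nat \<Rightarrow> nat \<times> nat \<Rightarrow> (nat \<times> nat) list set" where
  "directed_paths a b =
     {\<pi>. \<pi> \<noteq> [] \<and> hd \<pi> = a \<and> last \<pi> = b \<and> successively directed_step \<pi>}"

definition last_passage_time :: "(nat \<Rightarrow> nat \<Rightarrow> nat) \<Rightarrow> nat \<Rightarrow> nat \<Rightarrow> nat" where
  "last_passage_time w M N =
     Max ((\<lambda>\<pi>. \<Sum>(i, j) \<leftarrow> \<pi>. w i j) ` directed_paths (1, 1) (M, N))"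

text \<open>The parameters \<open>p i\<close>, \<open>1 \<le> i \<le> n\<close>, extended to \<open>1 \<le> i \<le> 2 n\<close> by
  \<open>p (2 n - i + 1) = p i\<close>.\<close>

definition reflect_params :: "nat \<Rightarrow> (nat \<Rightarrow> real) \<Rightarrow> nat \<Rightarrow> real" where
  "reflect_params n p i = (if i \<le> n then p i else p (2 * n + 1 - i))"

text \<open>Doubly symmetric geometric weights on \<open>{1..2 n} \<times> {1..2 n}\<close>, in the case
  \<open>\<beta> = 0\<close>.  Truncated subtraction is avoided by writing \<open>j \<le> 2 n - i + 1\<close> as
  \<open>i + j \<le> 2 n + 1\<close>.\<close>

definition doubly_symmetric_weights ::
  "'a measure \<Rightarrow> nat \<Rightarrow> (nat \<Rightarrow> real) \<Rightarrow> real \<Rightarrow> (nat \<Rightarrow> nat \<Rightarrow> 'a \<Rightarrow> nat) \<Rightarrow> bool" where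
  "doubly_symmetric_weights M n p \<alpha> W \<longleftrightarrow>
     (let q = reflect_params n p in
        prob_space M \<and>
        (\<forall>i\<in>{1..2*n}. \<forall>j\<in>{1..2*n}. \<forall>\<omega>\<in>space M.
            W i j \<omega> = W (2*n + 1 - j) (2*n + 1 - i) \<omega> \<and> W i j \<omega> = W j i \<omega>) \<and>
        prob_space.indep_vars M (\<lambda>_. count_space UNIV) (\<lambda>(i, j). W i j)
            {(i, j). 1 \<le> i \<and> i \<le> j \<and> i + j \<le> 2*n + 1} \<and>
        (\<forall>i j k. 1 \<le> i \<and> i < j \<and> i + j < 2*n + 1 \<longrightarrow>
            \<P>(\<omega> in M. W i j \<omega> = k) = (1 - q i * q j) * (q i * q j) ^ k) \<and>
        (\<forall>i j k. 1 \<le> i \<and> i < j \<and> i + j = 2*n + 1 \<longrightarrow>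
            \<P>(\<omega> in M. W i j \<omega> = k) = (if even k then (1 - (q j)\<^sup>2) * q j ^ k else 0)) \<and>
        (\<forall>j k. 1 \<le> j \<and> j \<le> n \<longrightarrow>
            \<P>(\<omega> in M. W j j \<omega> = k) = (1 - \<alpha> * q j) * (\<alpha> * q j) ^ k))"

definition normalization_const :: "nat \<Rightarrow> (nat \<Rightarrow> real) \<Rightarrow> real \<Rightarrow> real" where
  "normalization_const n p \<alpha> =
     (\<Prod>(i, j) \<in> {(i, j). 1 \<le> i \<and> i < j \<and> j \<le> n}. 1 / (1 - p i * p j)\<^sup>2) *
     (\<Prod>j = 1..n. 1 / (1 - (p j)\<^sup>2) * (1 / (1 - \<alpha> * p j)))"

section \<open>Partitions\<close>

text \<open>An \<open>n\<close>-partition is a weakly decreasing list of length \<open>n\<close>; trailing zeros are kept.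
  The \<open>i\<close>-th part is the list entry with index \<open>i - 1\<close>, and \<open>u\<^sup>n\<close> is \<open>replicate n u\<close>.\<close>

definition partitions_in_box :: "nat \<Rightarrow> nat \<Rightarrow> nat list set" where
  "partitions_in_box n u =
     {\<nu>. length \<nu> = n \<and> sorted_wrt (\<ge>) \<nu> \<and> (\<forall>x\<in>set \<nu>. x \<le> u)}"

definition box_complement :: "nat \<Rightarrow> nat list \<Rightarrow> nat list" where
  "box_complement u \<nu> = map (\<lambda>x. u - x) (rev \<nu>)"

definition conjugate :: "nat list \<Rightarrow> nat list" where
  "conjugate \<mu> = map (\<lambda>j. length (filter (\<lambda>x. j \<le> x) \<mu>)) [1..<Suc (Max (insert 0 (set \<mu>)))]"

definition oddrows :: "nat list \<Rightarrow> nat" where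
  "oddrows \<mu> = length (filter odd \<mu>)"

section \<open>Schur polynomials\<close>

text \<open>Semistandard Young tableaux of shape \<open>\<mu>\<close>, as lists of rows.  The entries are taken from
  \<open>{0..<m}\<close> rather than \<open>{1..m}\<close>, so that they index a list of \<open>m\<close> variables.\<close>

definition ssyt :: "nat \<Rightarrow> nat list \<Rightarrow> nat list list set" where
  "ssyt m \<mu> =
     {T. map length T = \<mu> \<and>
         (\<forall>r\<in>set T. sorted r \<and> set r \<subseteq> {..<m}) \<and>
         (\<forall>i j. Suc i < length T \<and> j < length (T ! Suc i) \<longrightarrow> T ! i ! j < T ! Suc i ! j)}"

text \<open>The number of variables is the length of \<open>xs\<close>.\<close>

definition schur :: "nat list \<Rightarrow> 'a::comm_ring_1 list \<Rightarrow> 'a" where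
  "schur \<mu> xs = (\<Sum>T\<in>ssyt (length xs) \<mu>. \<Prod>k\<leftarrow>concat T. xs ! k)"

section \<open>Symplectic Schur polynomials\<close>

definition pattern_index :: "nat \<Rightarrow> (nat \<times> nat) set" where
  "pattern_index h = {(i, j). 1 \<le> i \<and> i \<le> h \<and> 1 \<le> j \<and> j \<le> (i + 1) div 2}"

text \<open>Patterns are indexed from 1.  Outside the index set the function is required to vanish, so
  that each pattern is represented by exactly one function.\<close>

definition symplectic_patterns :: "nat \<Rightarrow> (nat \<Rightarrow> nat \<Rightarrow> nat) set" where
  "symplectic_patterns h =
     {z. (\<forall>i j. (i, j) \<notin> pattern_index h \<longrightarrow> z i j = 0) \<and>
         (\<forall>i j. (i, j) \<in> pattern_index h \<and> (i + 1, j) \<in> pattern_index h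
                  \<longrightarrow> z i j \<le> z (i + 1) j) \<and>
         (\<forall>i j. (i, j) \<in> pattern_index h \<and> (i + 1, j + 1) \<in> pattern_index h
                  \<longrightarrow> z (i + 1) (j + 1) \<le> z i j)}"

definition pattern_shape :: "nat \<Rightarrow> (nat \<Rightarrow> nat \<Rightarrow> nat) \<Rightarrow> nat list" where
  "pattern_shape h z = map (z h) [1..<Suc ((h + 1) div 2)]"

text \<open>The second sum has \<open>\<lceil>(i - 1) / 2\<rceil> = i div 2\<close> terms.\<close>

definition pattern_type :: "(nat \<Rightarrow> nat \<Rightarrow> nat) \<Rightarrow> nat \<Rightarrow> int" where
  "pattern_type z i =
     (\<Sum>j = 1..(i + 1) div 2. int (z i j)) - (\<Sum>j = 1..i div 2. int (z (i - 1) j))"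

text \<open>The \<open>i\<close>-th variable is \<open>xs ! (i - 1)\<close>, and the height is twice the number of variables.\<close>

definition symplectic_schur :: "nat list \<Rightarrow> 'a::field list \<Rightarrow> 'a" where
  "symplectic_schur \<nu> xs =
     (\<Sum>z \<in> {z \<in> symplectic_patterns (2 * length xs). pattern_shape (2 * length xs) z = \<nu>}.
        \<Prod>i = 1..length xs.
          (xs ! (i - 1)) powi (pattern_type z (2 * i) - pattern_type z (2 * i - 1)))"

end

theory Submission
  imports Defs "HOL-Library.Poly_Mapping" "HOL-Library.Function_Algebras"
begin

text \<open>All four quantities are one coefficient of a Laurent polynomial in \<open>u\<close> variables \<open>y\<^sub>i\<close>, one for each
  column of the box.  A partition in the box is encoded by the strictly increasing positions of its
  columns; multiplying an alternating Laurent polynomial by \<open>\<Prod>\<^sub>i (1 + x y\<^sub>i)\<close> or by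
  \<open>\<Prod>\<^sub>i (1 + x / y\<^sub>i)\<close> adds or removes a horizontal strip.  So a Schur polynomial is a coefficient of
  \<open>\<Prod>\<^sub>x \<Prod>\<^sub>i (1 + x y\<^sub>i)\<close> times the Vandermonde product, and a symplectic one is a coefficient of
  \<open>\<Prod>\<^sub>x \<Prod>\<^sub>i (1 + x y\<^sub>i) (1 + x / y\<^sub>i)\<close> times the Weyl denominator of type C, which vanishes at the wall
  \<open>-1\<close> and thereby keeps the columns nonnegative.  This gives \<open>C\<close> and \<open>D\<close> directly.  In \<open>B\<close>, the
  factor \<open>\<alpha>\<close> for every odd column is produced by \<open>\<Prod>\<^sub>i (1 + \<alpha> y\<^sub>i)\<close> from the partitions with
  even columns only, and over the latter the factor \<open>\<Prod>\<^sub>i\<^sub>\<le>\<^sub>j (1 - 1 / (y\<^sub>i y\<^sub>j))\<close> of the Weyl denominator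
  telescopes, leaving the coefficient of the empty partition.

  For \<open>A\<close>, both symmetries fold a path onto the cells \<open>i \<le> j\<close>, \<open>i + j \<le> 2 n + 1\<close>, with halved
  weights on the antidiagonal; \<open>L \<le> 2 u\<close> says that all passage times in this triangle are at most
  \<open>u\<close>.  The local form of the Robinson--Schensted--Knuth correspondence maps the arrays with this
  property bijectively onto symplectic patterns (complemented in \<open>u\<close>).  Row sums become
  differences of diagonal sums, that is the type, and the sum of the diagonal weights becomes an
  alternating sum of the shape, that is the number of odd columns.\<close>

section \<open>A Littlewood identity for alternating Laurent polynomials\<close>

text \<open>Both coefficient descriptions are dual Cauchy identities multiplied by a Weyl
  denominator in the \<open>y\<close> variables. One is the expansion of the product of all
  \<open>1 + x y\<close> into Schur functions of a shape and of its conjugate. The other rests on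
  \<open>(1 + x y) (1 + x / y) = x (x + 1 / x + y + 1 / y)\<close>: this product over
  \<open>n\<close> variables \<open>x\<close> and \<open>u\<close> variables \<open>y\<close> pairs
  a symplectic character in \<open>x\<close> with one in \<open>y\<close> whose shape is the
  conjugate of the complement in the box. Hence the complements in \<open>u\<close> and the power
  \<open>u\<close> of the product of the parameters.

  Littlewood's identity equates the sum of the Schur functions of all shapes with even parts, here
  the column lengths, with the product of \<open>1 / (1 - y_i y_j)\<close> over
  \<open>i \<le> j\<close>, an infinite series. It is used in inverted form, as a finite statement
  on coefficients of an arbitrary alternating Laurent polynomial. This generality carries the
  induction on the number of variables: after one variable is frozen, what remains is alternating in
  the others but is no longer a Vandermonde product.\<close>

type_synonym laurent = "(nat \<Rightarrow> int) \<Rightarrow>\<^sub>0 real"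

abbreviation coef :: "laurent \<Rightarrow> (nat \<Rightarrow> int) \<Rightarrow> real" where
  "coef \<equiv> Poly_Mapping.lookup"

definition ymon :: "(nat \<Rightarrow> int) \<Rightarrow> laurent" where
  "ymon v = Poly_Mapping.single v 1"

definition unitv :: "nat \<Rightarrow> nat \<Rightarrow> int" where
  "unitv i = (\<lambda>k. if k = i then 1 else 0)"

lemma ymon_mult: "ymon v * ymon w = ymon (v + w)"
  by (simp add: ymon_def mult_single)

lemma ymon_zero: "ymon 0 = 1"
  by (simp add: ymon_def)

lemma coef_single_times:
  "coef (Poly_Mapping.single v c * A) l = c * coef A (l - v)" for A :: laurent
proof -
  have *: "(l = v + q) = (q = l - v)" for q by (auto simp: algebra_simps)
  show ?thesis
    by (simp add: lookup_mult lookup_single when_mult *)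
qed

lemma coef_ymon_times: "coef (ymon v * A) l = coef A (l - v)"
  by (simp add: ymon_def coef_single_times)

lemma poly_mapping_sum_singles: "A = (\<Sum>k\<in>Poly_Mapping.keys A. Poly_Mapping.single k (coef A k))"
  by (rule poly_mapping_eqI) (simp add: lookup_sum lookup_single when_def in_keys_iff)

section \<open>Substitutions given by additive involutions of the exponents\<close>

definition subst :: "((nat \<Rightarrow> int) \<Rightarrow> (nat \<Rightarrow> int)) \<Rightarrow> laurent \<Rightarrow> laurent" where
  "subst f A = (\<Sum>k\<in>Poly_Mapping.keys A. Poly_Mapping.single (f k) (coef A k))"

text \<open>The instances are the swap of two coordinates and the negation of one. For an
  involution, the coefficient of the image at \<open>l\<close> is simply the coefficient at
  \<open>f l\<close>.\<close>

locale additive_involution =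
  fixes f :: "(nat \<Rightarrow> int) \<Rightarrow> (nat \<Rightarrow> int)"
  assumes invol: "f (f v) = v" and additive: "f (v + w) = f v + f w"
begin

lemma coef_subst: "coef (subst f A) l = coef A (f l)"
proof -
  have "(f k = l) = (k = f l)" for k using invol by metis
  then show ?thesis
    by (simp add: subst_def lookup_sum lookup_single when_def in_keys_iff)
qed

lemma subst_single: "subst f (Poly_Mapping.single v c) = Poly_Mapping.single (f v) c"
proof (rule poly_mapping_eqI)
  fix k
  have "(v = f k) = (f v = k)" using invol by metis
  then show "coef (subst f (Poly_Mapping.single v c)) k = coef (Poly_Mapping.single (f v) c) k"
    by (simp add: coef_subst lookup_single)
qed

lemma subst_add: "subst f (A + B) = subst f A + subst f B"
  by (rule poly_mapping_eqI) (simp add: coef_subst lookup_add)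

lemma subst_sum: "subst f (sum A I) = (\<Sum>i\<in>I. subst f (A i))"
  by (rule poly_mapping_eqI) (simp add: coef_subst lookup_sum)

lemma subst_diff: "subst f (A - B) = subst f A - subst f B"
  by (rule poly_mapping_eqI) (simp add: coef_subst lookup_minus)

lemma subst_uminus: "subst f (- A) = - subst f A"
  by (rule poly_mapping_eqI) (simp add: coef_subst)

lemma subst_mult: "subst f (A * B) = subst f A * subst f B"
proof -
  have 1: "subst f (Poly_Mapping.single v c * B) = subst f (Poly_Mapping.single v c) * subst f B"
    for v c
  proof (rule poly_mapping_eqI)
    fix l
    have "f (f l - v + v) = f (f l - v) + f v" by (rule additive)
    then have "f l - v = f (l - f v)" using invol by (metis add_diff_cancel diff_add_cancel)
    then show "coef (subst f (Poly_Mapping.single v c * B)) l =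
        coef (subst f (Poly_Mapping.single v c) * subst f B) l"
      by (simp add: subst_single coef_subst coef_single_times)
  qed
  have "subst f (A * B) = subst f ((\<Sum>k\<in>Poly_Mapping.keys A. Poly_Mapping.single k (coef A k)) * B)"
    using poly_mapping_sum_singles[of A] by simp
  also have "\<dots> = (\<Sum>k\<in>Poly_Mapping.keys A. subst f (Poly_Mapping.single k (coef A k))) * subst f B"
    by (simp add: sum_distrib_right subst_sum 1)
  also have "\<dots> = subst f A * subst f B"
    using poly_mapping_sum_singles[of A] by (simp flip: subst_sum)
  finally show ?thesis .
qed

lemma f_zero: "f 0 = 0"
  using additive[of 0 0] by simp

lemma subst_one: "subst f 1 = 1"
  using subst_single[of 0 1] by (simp add: f_zero)

lemma subst_prod: "subst f (prod A I) = (\<Prod>i\<in>I. subst f (A i))"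
  by (induction I rule: infinite_finite_induct) (simp_all add: subst_one subst_mult)

lemma subst_ymon: "subst f (ymon v) = ymon (f v)"
  by (simp add: ymon_def subst_single)

end

section \<open>Alternating and symmetric Laurent polynomials\<close>

definition swap_coords :: "nat \<Rightarrow> nat \<Rightarrow> (nat \<Rightarrow> int) \<Rightarrow> nat \<Rightarrow> int" where
  "swap_coords i j l = l(i := l j, j := l i)"

lemma swap_coords_involution: "additive_involution (swap_coords i j)"
  by unfold_locales (auto simp: swap_coords_def fun_eq_iff)

text \<open>Stated for coefficient functions, since the nested sums below take an arbitrary function
  \<open>g\<close>. Only coordinates below \<open>m\<close> are permuted, so the property passes to
  fewer coordinates.\<close>

definition alternating :: "nat \<Rightarrow> ((nat \<Rightarrow> int) \<Rightarrow> real) \<Rightarrow> bool" where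
  "alternating m g \<longleftrightarrow> (\<forall>i<m. \<forall>j<m. i \<noteq> j \<longrightarrow> (\<forall>l. g (swap_coords i j l) = - g l))"

lemma alternatingD: "alternating m g \<Longrightarrow> i < m \<Longrightarrow> j < m \<Longrightarrow> i \<noteq> j \<Longrightarrow> g (swap_coords i j l) = - g l"
  by (auto simp: alternating_def)

lemma alternating_mono: "alternating m g \<Longrightarrow> k \<le> m \<Longrightarrow> alternating k g"
  by (auto simp: alternating_def)

lemma alternating_eq_0:
  assumes "alternating m g" "i < m" "j < m" "i \<noteq> j" "l i = l j"
  shows "g l = 0"
proof -
  have "swap_coords i j l = l" using assms by (auto simp: swap_coords_def)
  with alternatingD[OF assms(1-4), of l] show ?thesis by simp
qed

lemma alternating_lookup_iff:
  "alternating m (coef A) \<longleftrightarrow> (\<forall>i<m. \<forall>j<m. i \<noteq> j \<longrightarrow> subst (swap_coords i j) A = - A)"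
proof -
  have "(subst (swap_coords i j) A = - A) = (\<forall>l. coef A (swap_coords i j l) = - coef A l)" for i j
    by (auto simp: poly_mapping_eq_iff fun_eq_iff
        additive_involution.coef_subst[OF swap_coords_involution])
  then show ?thesis by (auto simp: alternating_def)
qed

definition symmetric :: "nat \<Rightarrow> laurent \<Rightarrow> bool" where
  "symmetric m P \<longleftrightarrow> (\<forall>i<m. \<forall>j<m. i \<noteq> j \<longrightarrow> subst (swap_coords i j) P = P)"

lemma alternating_times:
  assumes "symmetric m P" "alternating m (coef A)"
  shows "alternating m (coef (P * A))"
  using assms unfolding alternating_lookup_iff symmetric_def
  by (simp add: additive_involution.subst_mult[OF swap_coords_involution])

lemma symmetric_times: "symmetric m P \<Longrightarrow> symmetric m R \<Longrightarrow> symmetric m (P * R)"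
  by (simp add: symmetric_def additive_involution.subst_mult[OF swap_coords_involution])

lemma symmetric_one: "symmetric m 1"
  by (simp add: symmetric_def additive_involution.subst_one[OF swap_coords_involution])

lemma swap_coords_unitv:
  "swap_coords i j (unitv k) = unitv (if k = i then j else if k = j then i else k)"
  by (auto simp: swap_coords_def unitv_def fun_eq_iff)

text \<open>\<open>parity_sum c m a g r\<close> is the sum of \<open>g l\<close> over all \<open>0 \<le> l 0 < \<dots> < l (m - 1) < a\<close> with
  \<open>l i \<equiv> i + c\<close> modulo 2, where the coordinates from \<open>m\<close> on are those of \<open>r\<close>.\<close>

primrec parity_sum :: "nat \<Rightarrow> nat \<Rightarrow> nat \<Rightarrow> ((nat \<Rightarrow> int) \<Rightarrow> real) \<Rightarrow> (nat \<Rightarrow> int) \<Rightarrow> real" where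
  "parity_sum c 0 a g r = g r"
| "parity_sum c (Suc m) a g r = (\<Sum>b<a. of_bool (even (b + m + c)) * parity_sum c m b g (r(m := int b)))"

lemma parity_sum_swap:
  assumes "alternating k g" "i < k" "j < k" "i \<noteq> j" "m \<le> i" "m \<le> j"
  shows "parity_sum c m a g (swap_coords i j r) = - parity_sum c m a g r"
  using assms(5,6)
proof (induction m arbitrary: a r)
  case 0
  then show ?case using alternatingD[OF assms(1-4)] by simp
next
  case (Suc m)
  have "(swap_coords i j r)(m := x) = swap_coords i j (r(m := x))" for x
    using Suc.prems by (auto simp: swap_coords_def fun_eq_iff)
  then show ?case using Suc by (simp add: sum_negf)
qed

section \<open>Inserting a coordinate into a parity-restricted sum\<close>

lemma sum_antisymmetric:
  fixes h :: "'b \<Rightarrow> 'b \<Rightarrow> real"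
  assumes "\<And>x y. x \<in> S \<Longrightarrow> y \<in> S \<Longrightarrow> h y x = - h x y"
  shows "(\<Sum>x\<in>S. \<Sum>y\<in>S. h x y) = 0"
proof -
  have "(\<Sum>x\<in>S. \<Sum>y\<in>S. h x y) = (\<Sum>y\<in>S. \<Sum>x\<in>S. h x y)" by (rule sum.swap)
  also have "\<dots> = - (\<Sum>y\<in>S. \<Sum>x\<in>S. h y x)"
    unfolding sum_negf[symmetric] by (intro sum.cong refl assms)
  finally show ?thesis by simp
qed

lemma sum_rotate: "(\<Sum>x\<in>A. \<Sum>y\<in>B. \<Sum>z\<in>C. h x y z) = (\<Sum>y\<in>B. \<Sum>z\<in>C. \<Sum>x\<in>A. h x y z)"
proof -
  have "(\<Sum>x\<in>A. \<Sum>y\<in>B. \<Sum>z\<in>C. h x y z) = (\<Sum>y\<in>B. \<Sum>x\<in>A. \<Sum>z\<in>C. h x y z)"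
    by (rule sum.swap)
  also have "\<dots> = (\<Sum>y\<in>B. \<Sum>z\<in>C. \<Sum>x\<in>A. h x y z)"
    by (intro sum.cong refl sum.swap)
  finally show ?thesis .
qed

lemma sum_less_eq_of_bool:
  fixes f :: "nat \<Rightarrow> real"
  assumes "b \<le> a"
  shows "(\<Sum>c<b. f c) = (\<Sum>c<a. of_bool (c < b) * f c)"
  by (rule sum.mono_neutral_cong_left) (use assms in auto)

text \<open>The last coordinate \<open>w\<close> is inserted out of order.  Terms in which \<open>w\<close> and its neighbour can be
  exchanged cancel in pairs, which moves \<open>w\<close> down two places.\<close>

lemma parity_sum_insert_odd:
  assumes "alternating (Suc m) g"
  shows "(\<Sum>w<a. of_bool (odd (w + m)) * parity_sum 0 m a g (r(m := int w))) =
    (if even m then parity_sum 1 (Suc m) a g r else 0)"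
  using assms
proof (induction m arbitrary: a r rule: induct_nat_012)
  case 0
  then show ?case by (simp del: fun_upd_apply)
next
  case 1
  let ?h = "\<lambda>w b. (of_bool (even w) * (of_bool (even b) * g (r(1 := int w, 0 := int b))))"
  have *: "?h y x = - ?h x y" for x y
  proof -
    have "swap_coords 0 1 (r(1 := int x, 0 := int y)) = r(1 := int y, 0 := int x)"
      by (auto simp: swap_coords_def)
    then show ?thesis
      using alternatingD[OF 1, of 0 1 "r(1 := int x, 0 := int y)"]
      by (simp del: One_nat_def fun_upd_apply)
  qed
  have "(\<Sum>w<a. \<Sum>b<a. ?h w b) = 0"
    by (rule sum_antisymmetric) (rule *)
  then show ?case by (simp add: sum_distrib_left del: fun_upd_apply sum_mult_of_bool_eq sum_of_bool_mult_eq)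
next
  case (ge2 m)
  \<comment> \<open>\<open>w\<close> is the inserted coordinate, \<open>b\<close> and
    \<open>c\<close> with \<open>c < b\<close> are the two largest ordered ones; \<open>m\<close>
    ordered coordinates remain below \<open>c\<close>.\<close>
  let ?P = "\<lambda>w b c. parity_sum 0 m c g (r(Suc (Suc m) := int w, Suc m := int b, m := int c))"
  define F where "F w b c = of_bool (odd (w + m)) * of_bool (odd (b + m)) * of_bool (even (c + m)) * ?P w b c"
    for w b c :: nat
  have "(\<Sum>w<a. of_bool (odd (w + Suc (Suc m))) * parity_sum 0 (Suc (Suc m)) a g (r(Suc (Suc m) := int w)))
      = (\<Sum>w<a. \<Sum>b<a. \<Sum>c<b. F w b c)"
    by (simp add: F_def sum_distrib_left mult_ac del: sum_mult_of_bool_eq sum_of_bool_mult_eq fun_upd_apply)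
  also have "\<dots> = (\<Sum>w<a. \<Sum>b<a. \<Sum>c<a. of_bool (c < b) * F w b c)"
    by (intro sum.cong refl sum_less_eq_of_bool) simp
  \<comment> \<open>\<open>w\<close> and \<open>c\<close> have opposite parities, so the case
    \<open>w = c\<close> contributes nothing.\<close>
  also have "\<dots> = (\<Sum>w<a. \<Sum>b<a. \<Sum>c<a. of_bool (c < b \<and> c < w) * F w b c + of_bool (c < b \<and> w < c) * F w b c)"
  proof (intro sum.cong refl)
    fix w b c
    show "of_bool (c < b) * F w b c = of_bool (c < b \<and> c < w) * F w b c + of_bool (c < b \<and> w < c) * F w b c"
      by (cases w c rule: linorder_cases) (auto simp: F_def)
  qed
  also have "\<dots> = (\<Sum>w<a. \<Sum>b<a. \<Sum>c<a. of_bool (c < b \<and> c < w) * F w b c)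
       + (\<Sum>w<a. \<Sum>b<a. \<Sum>c<a. of_bool (c < b \<and> w < c) * F w b c)"
    by (simp add: sum.distrib)
  \<comment> \<open>\<open>w\<close> and \<open>b\<close> have the same parity and both lie above
    \<open>c\<close>: an antisymmetric summand over a symmetric range.\<close>
  also have "(\<Sum>w<a. \<Sum>b<a. \<Sum>c<a. of_bool (c < b \<and> c < w) * F w b c) = 0"
  proof (rule sum_antisymmetric)
    fix w b
    have "?P b w c = - ?P w b c" for c
      using parity_sum_swap[OF ge2(3), of "Suc m" "Suc (Suc m)" m 0 c "r(Suc (Suc m) := int w, Suc m := int b, m := int c)"]
      by (simp add: swap_coords_def fun_upd_twist)
    then have "F b w c = - F w b c" for c
      by (simp add: F_def)
    then show "(\<Sum>c<a. of_bool (c < w \<and> c < b) * F b w c) = - (\<Sum>c<a. of_bool (c < b \<and> c < w) * F w b c)"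
      by (simp add: conj_commute sum_negf)
  qed
  also have "(\<Sum>w<a. \<Sum>b<a. \<Sum>c<a. of_bool (c < b \<and> w < c) * F w b c) =
     (\<Sum>b<a. \<Sum>c<a. \<Sum>w<a. of_bool (c < b \<and> w < c) * F w b c)"
    by (rule sum_rotate)
  also have "\<dots> = (\<Sum>b<a. \<Sum>c<a. of_bool (c < b) * (\<Sum>w<c. F w b c))"
    by (intro sum.cong refl) (auto simp: sum_distrib_left sum_less_eq_of_bool[where a=a])
  also have "\<dots> = (\<Sum>b<a. \<Sum>c<b. \<Sum>w<c. F w b c)"
    by (intro sum.cong refl sum_less_eq_of_bool[symmetric]) simp
  also have "\<dots> = (\<Sum>b<a. \<Sum>c<b. of_bool (odd (b + m)) * of_bool (even (c + m)) *
      (if even m then parity_sum 1 (Suc m) c g (r(Suc (Suc m) := int b, Suc m := int c)) else 0))"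
  proof (intro sum.cong refl)
    fix b c assume bc: "b \<in> {..<a}" "c \<in> {..<b}"
    \<comment> \<open>Carrying \<open>w\<close> below \<open>b\<close> and \<open>c\<close> is a
      3-cycle, that is two swaps, so no sign appears. What is left is an insertion among
      \<open>m\<close> coordinates.\<close>
    have cyc: "?P w b c = parity_sum 0 m c g (r(Suc (Suc m) := int b, Suc m := int c, m := int w))" for w
    proof -
      have "parity_sum 0 m c g (swap_coords (Suc m) (Suc (Suc m)) (swap_coords m (Suc (Suc m))
         (r(Suc (Suc m) := int w, Suc m := int b, m := int c)))) = ?P w b c"
        using ge2(3) by (simp add: parity_sum_swap)
      then show ?thesis by (simp add: swap_coords_def fun_upd_twist)
    qed
    have alt: "alternating (Suc m) g" using ge2(3) by (rule alternating_mono) simp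
    have "(\<Sum>w<c. F w b c) = of_bool (odd (b + m)) * of_bool (even (c + m)) *
      (\<Sum>w<c. of_bool (odd (w + m)) * parity_sum 0 m c g (r(Suc (Suc m) := int b, Suc m := int c, m := int w)))"
      unfolding F_def cyc sum_distrib_left by (intro sum.cong refl) (simp add: mult_ac)
    also have "\<dots> = of_bool (odd (b + m)) * of_bool (even (c + m)) *
      (if even m then parity_sum 1 (Suc m) c g (r(Suc (Suc m) := int b, Suc m := int c)) else 0)"
      using ge2(1)[OF alt, of c "r(Suc (Suc m) := int b, Suc m := int c)"]
      by (simp only: )
    finally show "(\<Sum>w<c. F w b c) = of_bool (odd (b + m)) * of_bool (even (c + m)) *
      (if even m then parity_sum 1 (Suc m) c g (r(Suc (Suc m) := int b, Suc m := int c)) else 0)" .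
  qed
  also have "\<dots> = (if even m then parity_sum 1 (Suc (Suc (Suc m))) a g r else 0)"
    by (simp add: sum_distrib_left mult_ac del: fun_upd_apply sum_mult_of_bool_eq sum_of_bool_mult_eq)
  finally show ?case by (simp only: add_0_left even_Suc not_not)
qed

text \<open>The inserted \<open>w\<close> and the largest ordered coordinate differ in parity, hence
  in value. If \<open>w\<close> is larger, the configuration is ordered. If it is smaller, one swap
  makes it the insertion of a wrong-parity coordinate among one coordinate fewer; this is the
  correction, with a minus sign.\<close>

lemma parity_sum_insert_even:
  assumes "alternating (Suc m) g"
  shows "(\<Sum>w<a. of_bool (even (w + m)) * parity_sum 0 m a g (r(m := int w))) =
    parity_sum 0 (Suc m) a g r - (if odd m then parity_sum 1 (Suc m) a g r else 0)"
proof (cases m)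
  case 0
  then show ?thesis by (simp del: fun_upd_apply)
next
  case (Suc k)
  let ?P = "\<lambda>w b. parity_sum 0 k b g (r(Suc k := int w, k := int b))"
  define F where "F w b = of_bool (odd (w + k)) * of_bool (even (b + k)) * ?P w b"
    for w b :: nat
  have "(\<Sum>w<a. of_bool (even (w + m)) * parity_sum 0 m a g (r(m := int w))) = (\<Sum>w<a. \<Sum>b<a. F w b)"
    by (simp add: F_def sum_distrib_left mult_ac Suc)
  also have "\<dots> = (\<Sum>w<a. \<Sum>b<a. of_bool (b < w) * F w b + of_bool (w < b) * F w b)"
  proof (intro sum.cong refl)
    fix w b
    show "F w b = of_bool (b < w) * F w b + of_bool (w < b) * F w b"
      by (cases w b rule: linorder_cases) (auto simp: F_def)
  qed
  also have "\<dots> = (\<Sum>w<a. \<Sum>b<a. of_bool (b < w) * F w b) + (\<Sum>w<a. \<Sum>b<a. of_bool (w < b) * F w b)"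
    by (simp add: sum.distrib)
  also have "(\<Sum>w<a. \<Sum>b<a. of_bool (b < w) * F w b) = (\<Sum>w<a. \<Sum>b<w. F w b)"
    by (intro sum.cong refl sum_less_eq_of_bool[symmetric]) simp
  also have "\<dots> = parity_sum 0 (Suc m) a g r"
    by (simp add: F_def Suc sum_distrib_left mult_ac)
  also have "(\<Sum>w<a. \<Sum>b<a. of_bool (w < b) * F w b) = (\<Sum>b<a. \<Sum>w<a. of_bool (w < b) * F w b)"
    by (rule sum.swap)
  also have "\<dots> = (\<Sum>b<a. \<Sum>w<b. F w b)"
    by (intro sum.cong refl sum_less_eq_of_bool[symmetric]) simp
  also have "\<dots> = (\<Sum>b<a. - of_bool (even (b + k)) * (if even k then parity_sum 1 (Suc k) b g (r(Suc k := int b)) else 0))"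
  proof (intro sum.cong refl)
    fix b
    have sw: "?P w b = - parity_sum 0 k b g (r(Suc k := int b, k := int w))" for w
      using parity_sum_swap[OF assms, of k "Suc k" k 0 b "r(Suc k := int w, k := int b)"] Suc
      by (simp add: swap_coords_def fun_upd_twist)
    have alt: "alternating (Suc k) g" using assms by (rule alternating_mono) (simp add: Suc)
    have "(\<Sum>w<b. F w b) = - of_bool (even (b + k)) *
      (\<Sum>w<b. of_bool (odd (w + k)) * parity_sum 0 k b g (r(Suc k := int b, k := int w)))"
      unfolding F_def sw sum_distrib_left by (intro sum.cong refl) (simp add: mult_ac)
    also have "\<dots> = - of_bool (even (b + k)) * (if even k then parity_sum 1 (Suc k) b g (r(Suc k := int b)) else 0)"
      using parity_sum_insert_odd[OF alt, of b "r(Suc k := int b)"] by simp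
    finally show "(\<Sum>w<b. F w b) = - of_bool (even (b + k)) * (if even k then parity_sum 1 (Suc k) b g (r(Suc k := int b)) else 0)" .
  qed
  also have "\<dots> = - (if odd m then parity_sum 1 (Suc m) a g r else 0)"
    by (simp add: Suc sum_negf del: fun_upd_apply)
  finally show ?thesis by (simp del: fun_upd_apply parity_sum.simps)
qed

definition raise :: "nat \<Rightarrow> nat \<Rightarrow> int" where
  "raise m = (\<lambda>i. if i < m then 1 else 0)"

text \<open>For \<open>c = 1\<close> the lowest coordinate is odd, so no summed coordinate is 0 and
  all of them can be lowered by one, which exchanges the parities and lowers the bound.
  \<open>M\<close> stays fixed while the induction reduces \<open>m\<close>, because frozen
  coordinates remain raised.\<close>

lemma parity_sum_shift:
  assumes "m \<le> M"
  shows "parity_sum 1 m (Suc a) g (r + raise M) = parity_sum 0 m a (\<lambda>l. g (l + raise M)) r"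
  using assms
proof (induction m arbitrary: a r)
  case (Suc m)
  \<comment> \<open>The term with top coordinate 0 has the admissible parity only if
    \<open>m\<close> is odd, and then there is no room for the \<open>m\<close> coordinates below
    it.\<close>
  have 0: "parity_sum 1 m 0 g s = 0" if "odd m" for s using that by (cases m) auto
  have "parity_sum 1 (Suc m) (Suc a) g (r + raise M) =
     (\<Sum>b<a. of_bool (even (b + m)) * parity_sum 1 m (Suc b) g ((r + raise M)(m := 1 + int b)))"
    using 0 by (cases "odd m") (simp_all add: sum.lessThan_Suc_shift del: sum.lessThan_Suc fun_upd_apply)
  also have "\<dots> = (\<Sum>b<a. of_bool (even (b + m)) * parity_sum 1 m (Suc b) g (r(m := int b) + raise M))"
  proof -
    have "(r + raise M)(m := 1 + int b) = r(m := int b) + raise M" for b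
      using Suc.prems by (auto simp: raise_def fun_eq_iff)
    then show ?thesis by simp
  qed
  also have "\<dots> = (\<Sum>b<a. of_bool (even (b + m)) * parity_sum 0 m b (\<lambda>l. g (l + raise M)) (r(m := int b)))"
    using Suc by (intro sum.cong refl) (simp del: plus_fun_apply)
  finally show ?case by (simp del: plus_fun_apply fun_upd_apply)
qed simp

text \<open>The bound survives multiplication by factors that only add terms with lower exponents,
  and it kills the upper end of the telescoping sum in \<open>parity_sum_littlewood\<close>.\<close>

definition bounded_above :: "nat \<Rightarrow> int \<Rightarrow> laurent \<Rightarrow> bool" where
  "bounded_above m a A \<longleftrightarrow> (\<forall>l. (\<exists>i<m. a \<le> l i) \<longrightarrow> coef A l = 0)"

lemma bounded_above_mono: "bounded_above m a A \<Longrightarrow> k \<le> m \<Longrightarrow> bounded_above k a A"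
  by (force simp: bounded_above_def)

lemma coef_one_minus_ymon_times: "coef ((1 - ymon (- v)) * A) l = coef A l - coef A (l + v)"
  by (simp add: left_diff_distrib lookup_minus coef_ymon_times)

lemma bounded_above_times:
  assumes "bounded_above m a A" "\<And>i. 0 \<le> v i"
  shows "bounded_above m a ((1 - ymon (- v)) * A)"
  unfolding bounded_above_def coef_one_minus_ymon_times
proof (intro allI impI)
  fix l assume "\<exists>i<m. a \<le> l i"
  then obtain i where i: "i < m" "a \<le> l i" by blast
  then have "a \<le> (l + v) i" using assms(2)[of i] by simp
  with i assms(1) have "coef A l = 0" "coef A (l + v) = 0" unfolding bounded_above_def by blast+
  then show "coef A l - coef A (l + v) = 0" by simp
qed

lemma bounded_above_prod:
  assumes "bounded_above m a A" "finite I" "\<And>x i. x \<in> I \<Longrightarrow> 0 \<le> v x i"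
  shows "bounded_above m a ((\<Prod>x\<in>I. 1 - ymon (- v x)) * A)"
  using assms(2,3)
proof (induction I rule: finite_induct)
  case empty
  then show ?case using assms(1) by simp
next
  case (insert x I)
  then show ?case using bounded_above_times[of m a "(\<Prod>x\<in>I. 1 - ymon (- v x)) * A" "v x"]
    by (simp add: mult.assoc del: uminus_apply)
qed

lemma symmetric_prod_lessThan:
  assumes "\<And>i j k. i < m \<Longrightarrow> j < m \<Longrightarrow> i \<noteq> j \<Longrightarrow> k < m \<Longrightarrow>
    subst (swap_coords i j) (P k) = P (if k = i then j else if k = j then i else k)"
  shows "symmetric m (\<Prod>k<m. P k)"
  unfolding symmetric_def
proof (intro allI impI)
  fix i j assume ij: "i < m" "j < m" "i \<noteq> j"
  have "subst (swap_coords i j) (\<Prod>k<m. P k) = (\<Prod>k<m. P (if k = i then j else if k = j then i else k))"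
    using assms ij by (simp add: additive_involution.subst_prod[OF swap_coords_involution])
  also have "\<dots> = (\<Prod>k<m. P k)"
    by (rule prod.reindex_bij_witness[where i = "\<lambda>k. if k = i then j else if k = j then i else k"
          and j = "\<lambda>k. if k = i then j else if k = j then i else k"]) (use ij in auto)
  finally show "subst (swap_coords i j) (\<Prod>k<m. P k) = (\<Prod>k<m. P k)" .
qed

lemmas subst_swap_simps =
  additive_involution.subst_mult[OF swap_coords_involution]
  additive_involution.subst_prod[OF swap_coords_involution]
  additive_involution.subst_add[OF swap_coords_involution]
  additive_involution.subst_diff[OF swap_coords_involution]
  additive_involution.subst_uminus[OF swap_coords_involution]
  additive_involution.subst_one[OF swap_coords_involution]
  additive_involution.subst_ymon[OF swap_coords_involution]
  additive_involution.subst_single[OF swap_coords_involution]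
  additive_involution.additive[OF swap_coords_involution]

lemma swap_coords_uminus: "swap_coords i j (- v) = - swap_coords i j v"
  by (auto simp: swap_coords_def fun_eq_iff)

text \<open>The factor which turns the type A Weyl denominator into that of type C.\<close>

definition littlewood :: "nat \<Rightarrow> laurent" where
  "littlewood m = (\<Prod>j<m. \<Prod>i\<le>j. 1 - ymon (- (unitv i + unitv j)))"

lemma littlewood_Suc:
  "littlewood (Suc m) = littlewood m * (\<Prod>i\<le>m. 1 - ymon (- (unitv i + unitv m)))"
  by (simp add: littlewood_def)

lemma littlewood_pairs:
  "littlewood m = (\<Prod>(i, j)\<in>{(i, j). i \<le> j \<and> j < m}. 1 - ymon (- (unitv i + unitv j)))"
proof -
  have "littlewood m = (\<Prod>(j, i)\<in>Sigma {..<m} (\<lambda>j. {..j}). 1 - ymon (- (unitv i + unitv j)))"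
    unfolding littlewood_def by (rule prod.Sigma) auto
  also have "\<dots> = (\<Prod>(i, j)\<in>{(i, j). i \<le> j \<and> j < m}. 1 - ymon (- (unitv i + unitv j)))"
    by (rule prod.reindex_bij_witness[where i = "\<lambda>(i, j). (j, i)" and j = "\<lambda>(i, j). (j, i)"]) auto
  finally show ?thesis .
qed

lemma symmetric_littlewood: "symmetric m (littlewood m)"
  unfolding symmetric_def
proof (intro allI impI)
  fix a b assume ab: "a < m" "b < m" "a \<noteq> b"
  let ?t = "\<lambda>k. if k = a then b else if k = b then a else k"
  let ?F = "\<lambda>i j. 1 - ymon (- (unitv i + unitv j))"
  \<comment> \<open>The factor depends only on the unordered pair, so pairs can be sorted again
    after the swap.\<close>
  have F: "?F (min i j) (max i j) = ?F i j" for i j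
    by (simp add: min_def max_def add.commute[of "unitv j"] del: minus_add_distrib)
  have "subst (swap_coords a b) (littlewood m) = (\<Prod>(i, j)\<in>{(i, j). i \<le> j \<and> j < m}. ?F (?t i) (?t j))"
    unfolding littlewood_pairs
    by (simp add: subst_swap_simps case_prod_unfold swap_coords_uminus swap_coords_unitv
        del: minus_add_distrib)
  also have "\<dots> = (\<Prod>(i, j)\<in>{(i, j). i \<le> j \<and> j < m}. ?F i j)"
    by (rule prod.reindex_bij_witness[where i = "\<lambda>(i, j). (min (?t i) (?t j), max (?t i) (?t j))"
          and j = "\<lambda>(i, j). (min (?t i) (?t j), max (?t i) (?t j))"])
       (use ab F in \<open>auto simp: min_def max_def add.commute\<close>)
  finally show "subst (swap_coords a b) (littlewood m) = littlewood m"
    unfolding littlewood_pairs .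
qed

lemma symmetric_unitv_pair:
  assumes "m \<le> i" "m \<le> j"
  shows "symmetric m (1 - ymon (- (unitv i + unitv j)))"
  unfolding symmetric_def
proof (intro allI impI)
  fix a b assume "a < m" "b < m"
  then have "swap_coords a b (unitv i + unitv j) = unitv i + unitv j"
    using assms by (auto simp: swap_coords_def unitv_def fun_eq_iff)
  then show "subst (swap_coords a b) (1 - ymon (- (unitv i + unitv j))) = 1 - ymon (- (unitv i + unitv j))"
    by (simp only: subst_swap_simps(4,6,7) swap_coords_uminus)
qed

text \<open>Only the sets of raised coordinates that are upper segments contribute, because all others
  produce a repeated coordinate.\<close>

lemma coef_prod_raise:
  assumes "alternating m (coef A)" "j \<le> m" "\<And>i. i < j \<Longrightarrow> l i = int i"
  shows "coef ((\<Prod>i<j. 1 - ymon (- (unitv i + unitv m))) * A) l =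
    (\<Sum>k\<le>j. (-1) ^ k * coef A (\<lambda>i. if j - k \<le> i \<and> i < j then l i + 1 else if i = m then l m + int k else l i))"
  using assms(2,3)
proof (induction j arbitrary: l)
  case 0
  have "(\<lambda>i. if 0 - 0 \<le> i \<and> i < 0 then l i + 1 else if i = m then l m + int 0 else l i) = l" by auto
  then show ?case unfolding atMost_0 by simp
next
  case (Suc j)
  let ?E = "(\<Prod>i<j. 1 - ymon (- (unitv i + unitv m))) * A"
  let ?pos = "\<lambda>l j k. (\<lambda>i. if j - k \<le> i \<and> i < j then l i + 1 else if i = m then l m + int k else l i)"
  define l' where "l' = l + (unitv j + unitv m)"
  have "(\<Prod>i<Suc j. 1 - ymon (- (unitv i + unitv m))) * A = (1 - ymon (- (unitv j + unitv m))) * ?E"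
    by (simp add: mult_ac)
  then have "coef ((\<Prod>i<Suc j. 1 - ymon (- (unitv i + unitv m))) * A) l = coef ?E l - coef ?E l'"
    by (simp only: coef_one_minus_ymon_times l'_def)
  moreover have "coef ?E l = coef A l"
  proof -
    have "coef ?E l = (\<Sum>k\<le>j. (-1) ^ k * coef A (?pos l j k))"
      using Suc.prems by (intro Suc.IH) auto
    also have "\<dots> = (\<Sum>k\<in>{0}. (-1) ^ k * coef A (?pos l j k))"
    proof (rule sum.mono_neutral_right)
      show "\<forall>k\<in>{..j} - {0}. (-1) ^ k * coef A (?pos l j k) = 0"
      proof
        fix k assume k: "k \<in> {..j} - {0}"
        have "coef A (?pos l j k) = 0"
          by (rule alternating_eq_0[OF assms(1), of "j - 1" j]) (use k Suc.prems in auto)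
        then show "(-1) ^ k * coef A (?pos l j k) = 0" by simp
      qed
    qed auto
    also have "?pos l j 0 = l" by auto
    then have "(\<Sum>k\<in>{0}. (-1) ^ k * coef A (?pos l j k)) = coef A l" by simp
    finally show ?thesis .
  qed
  moreover have "coef ?E l' = (\<Sum>k\<le>j. (-1) ^ k * coef A (?pos l (Suc j) (Suc k)))"
  proof -
    have "coef ?E l' = (\<Sum>k\<le>j. (-1) ^ k * coef A (?pos l' j k))"
      using Suc.prems by (intro Suc.IH) (auto simp: l'_def unitv_def)
    also have "\<dots> = (\<Sum>k\<le>j. (-1) ^ k * coef A (?pos l (Suc j) (Suc k)))"
    proof (intro sum.cong refl)
      fix k assume "k \<in> {..j}"
      then have "?pos l' j k = ?pos l (Suc j) (Suc k)"
        using Suc.prems by (auto simp: l'_def unitv_def fun_eq_iff)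
      then show "(-1) ^ k * coef A (?pos l' j k) = (-1) ^ k * coef A (?pos l (Suc j) (Suc k))" by simp
    qed
    finally show ?thesis .
  qed
  moreover have "?pos l (Suc j) 0 = l" by auto
  ultimately show ?case
    by (simp add: sum.atMost_Suc_shift sum_negf del: sum.atMost_Suc uminus_apply minus_apply plus_fun_apply minus_add_distrib)
qed

section \<open>Evaluation at the staircase and the Littlewood identity\<close>

definition staircase :: "nat \<Rightarrow> (nat \<Rightarrow> int) \<Rightarrow> nat \<Rightarrow> int" where
  "staircase m r = (\<lambda>i. if i < m then int i else r i)"

text \<open>The top \<open>k\<close> coordinates of the staircase are raised by one, and coordinate
  \<open>m\<close> fills the gap at \<open>m - k\<close>; \<open>k\<close> swaps sort this
  arrangement.\<close>

lemma coef_cycle: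
  assumes "alternating (Suc m) (coef A)" "k \<le> m"
  shows "coef A (\<lambda>i. if i < m - k then int i else if i < m then int i + 1 else if i = m then int (m - k) else r i)
     = (-1) ^ k * coef A (staircase (Suc m) r)"
  using assms(2)
proof (induction k)
  case 0
  have "(\<lambda>i. if i < m then int i else if i = m then int m else r i) = staircase (Suc m) r"
    by (auto simp: staircase_def)
  then show ?case by (simp cong: if_cong)
next
  case (Suc k)
  let ?p = "\<lambda>k i. if i < m - k then int i else if i < m then int i + 1 else if i = m then int (m - k) else r i"
  have "?p (Suc k) = swap_coords m (m - Suc k) (?p k)"
    using Suc.prems by (auto simp: swap_coords_def fun_eq_iff)
  then have "coef A (?p (Suc k)) = coef A (swap_coords m (m - Suc k) (?p k))" by simp
  also have "\<dots> = - coef A (?p k)"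
    by (rule alternatingD[OF assms(1)]) (use Suc.prems in auto)
  finally show ?case using Suc by simp
qed

text \<open>Coordinate \<open>m\<close> starts at \<open>m mod 2\<close>, the smallest value of its
  parity. After raising the top \<open>k\<close> coordinates the staircase occupies all of
  \<open>0, ..., m\<close> except \<open>m - k\<close>, and coordinate \<open>m\<close> stands at
  \<open>m mod 2 + k\<close>. There is no collision only if it fills the gap,
  \<open>k = m div 2\<close>, or passes the top, which needs \<open>m\<close> odd and
  \<open>k = m\<close>. In the first case the signs of raising and of sorting cancel; in the second
  the whole staircase is raised and the sign is -1.\<close>

lemma coef_prod_raise_staircase:
  assumes "alternating (Suc m) (coef A)"
  shows "coef ((\<Prod>i<m. 1 - ymon (- (unitv i + unitv m))) * A) (staircase m (r(m := int (m mod 2)))) =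
    coef A (staircase (Suc m) r) - (if odd m then coef A (staircase (Suc m) r + raise (Suc m)) else 0)"
proof -
  let ?l = "staircase m (r(m := int (m mod 2)))"
  let ?pos = "\<lambda>k. (\<lambda>i. if m - k \<le> i \<and> i < m then ?l i + 1 else if i = m then ?l m + int k else ?l i)"
  let ?S = "if odd m then {m div 2, m} else {m div 2}"
  have "coef ((\<Prod>i<m. 1 - ymon (- (unitv i + unitv m))) * A) ?l = (\<Sum>k\<le>m. (-1) ^ k * coef A (?pos k))"
    by (rule coef_prod_raise) (use assms in \<open>auto simp: staircase_def intro: alternating_mono\<close>)
  also have "\<dots> = (\<Sum>k\<in>?S. (-1) ^ k * coef A (?pos k))"
  proof (rule sum.mono_neutral_right)
    show "\<forall>k\<in>{..m} - ?S. (-1) ^ k * coef A (?pos k) = 0"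
    proof
      fix k assume k: "k \<in> {..m} - ?S"
      define x where "x = m mod 2 + k"
      have xm: "x \<le> m" using k unfolding x_def by (cases "even m") auto
      have "x \<noteq> m - k" 
      proof -
        have "k \<le> m" "odd m \<Longrightarrow> k \<noteq> m div 2 \<and> k \<noteq> m" "even m \<Longrightarrow> k \<noteq> m div 2"
          using k by (auto split: if_splits)
        then show ?thesis unfolding x_def by presburger
      qed
      have "coef A (?pos k) = 0"
      proof (cases "x < m - k")
        case True
        then show ?thesis
          by (intro alternating_eq_0[OF assms, of x m]) (auto simp: x_def staircase_def)
      next
        case False
        with \<open>x \<noteq> m - k\<close> have "m - k \<le> x - 1" "x - 1 < m" "0 < x" using xm by auto
        then show ?thesis
          by (intro alternating_eq_0[OF assms, of "x - 1" m]) (auto simp: x_def staircase_def)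
      qed
      then show "(-1) ^ k * coef A (?pos k) = 0" by simp
    qed
  qed auto
  also have "\<dots> = (-1) ^ (m div 2) * coef A (?pos (m div 2)) + (if odd m then (-1) ^ m * coef A (?pos m) else 0)"
  proof (cases "odd m")
    case True
    then have "m div 2 \<noteq> m" by (auto elim: oddE)
    with True show ?thesis by (simp cong: if_cong)
  qed simp
  also have "?pos (m div 2) = (\<lambda>i. if i < m - m div 2 then int i else if i < m then int i + 1
      else if i = m then int (m - m div 2) else r i)"
  proof -
    have "int (m mod 2) + int (m div 2) = int (m - m div 2)" by presburger
    then show ?thesis by (auto simp: staircase_def fun_eq_iff)
  qed
  also have "coef A \<dots> = (-1) ^ (m div 2) * coef A (staircase (Suc m) r)"
    by (rule coef_cycle[OF assms]) simp
  also have "(-1) ^ (m div 2) * ((-1) ^ (m div 2) * coef A (staircase (Suc m) r)) = coef A (staircase (Suc m) r)"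
    by (simp flip: power_mult_distrib mult.assoc)
  also have "(if odd m then (-1) ^ m * coef A (?pos m) else 0) =
      - (if odd m then coef A (staircase (Suc m) r + raise (Suc m)) else 0)"
  proof (cases "odd m")
    case True
    then have "?pos m = staircase (Suc m) r + raise (Suc m)"
      by (auto simp: staircase_def raise_def fun_eq_iff odd_iff_mod_2_eq_one)
    with True show ?thesis by (simp del: plus_fun_apply)
  qed simp
  finally show ?thesis by (simp only: diff_conv_add_uminus)
qed

lemma sum_parity_telescope:
  fixes X :: "nat \<Rightarrow> real"
  shows "(\<Sum>w<a. of_bool (even (w + m)) * (X w - X (w + 2))) =
    X (m mod 2) - X (if even (a + m) then a else a + 1)"
proof (induction a)
  case 0
  then show ?case by (simp add: mod2_eq_if)
qed auto

text \<open>The factors containing the last variable are absorbed into \<open>A\<close>, so the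
  outer induction disposes of the other coordinates. The factor
  \<open>1 - 1 / y\<^sub>m\<^sup>2\<close> then makes the sum over the last coordinate telescope
  down to \<open>m mod 2\<close>. For odd \<open>m\<close> a raised staircase and a parity sum with
  \<open>c = 1\<close> are left over; they agree by the same identity for \<open>A\<close> divided
  by all variables. That quotient has a smaller bound, whence the inner induction on
  \<open>a\<close>.\<close>

theorem parity_sum_littlewood:
  assumes "alternating m (coef A)" "bounded_above m (int a) A"
  shows "parity_sum 0 m a (coef (littlewood m * A)) r = coef A (staircase m r)"
  using assms
proof (induction m arbitrary: a A r)
  case 0
  then show ?case by (simp add: littlewood_def staircase_def)
next
  case (Suc m)
  note IHm = Suc.IH
  show ?case using Suc.prems
  proof (induction a arbitrary: A r)
    case 0
    then have "coef A (staircase (Suc m) r) = 0"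
      unfolding bounded_above_def by (elim allE impE) (auto simp: staircase_def intro!: exI[of _ 0])
    then show ?case by simp
  next
    case (Suc a)
    let ?R = "(\<Prod>i<m. 1 - ymon (- (unitv i + unitv m))) * A"
    let ?RR = "(\<Prod>i\<le>m. 1 - ymon (- (unitv i + unitv m))) * A"
    let ?b = "Suc a"
    let ?QA = "coef (littlewood (Suc m) * A)"
    define X where "X w = coef ?R (staircase m (r(m := int w)))" for w
    have unitv_nonneg: "0 \<le> (unitv i + unitv j) k" for i j k by (simp add: unitv_def)
    have bR: "bounded_above (Suc m) (int ?b) ?R"
      by (rule bounded_above_prod[OF Suc.prems(2)]) (use unitv_nonneg in auto)
    have bRR: "bounded_above (Suc m) (int ?b) ?RR"
      by (rule bounded_above_prod[OF Suc.prems(2)]) (use unitv_nonneg in auto)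
    have RR: "?RR = (1 - ymon (- (unitv m + unitv m))) * ?R"
      by (simp add: mult_ac flip: lessThan_Suc_atMost del: minus_add_distrib)
    have sym: "symmetric m (\<Prod>i\<le>m. 1 - ymon (- (unitv i + unitv m)))"
    proof -
      have "symmetric m ((\<Prod>i<m. 1 - ymon (- (unitv i + unitv m))) * (1 - ymon (- (unitv m + unitv m))))"
        by (intro symmetric_times symmetric_prod_lessThan symmetric_unitv_pair)
           (auto simp: subst_swap_simps swap_coords_uminus swap_coords_unitv
              simp del: minus_add_distrib)
      then show ?thesis by (simp flip: lessThan_Suc_atMost del: minus_add_distrib)
    qed
    \<comment> \<open>With the factors in \<open>y\<^sub>m\<close> included, alternation survives
      only in the first \<open>m\<close> coordinates, and this is what the outer induction
      hypothesis asks for.\<close>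
    have altRR: "alternating m (coef ?RR)"
      by (rule alternating_times[OF sym]) (use Suc.prems(1) in \<open>auto intro: alternating_mono\<close>)
    have altQA: "alternating (Suc m) ?QA"
      by (rule alternating_times[OF symmetric_littlewood Suc.prems(1)])
    have QA: "littlewood (Suc m) * A = littlewood m * ?RR"
      by (simp only: littlewood_Suc mult.assoc)
    have "(\<Sum>w<?b. of_bool (even (w + m)) * parity_sum 0 m ?b ?QA (r(m := int w)))
        = (\<Sum>w<?b. of_bool (even (w + m)) * (X w - X (w + 2)))"
    proof (intro sum.cong refl)
      fix w
      have "parity_sum 0 m ?b ?QA (r(m := int w)) = coef ?RR (staircase m (r(m := int w)))"
        unfolding QA by (rule IHm[OF altRR]) (use bRR in \<open>auto intro: bounded_above_mono\<close>)
      also have "\<dots> = coef ?R (staircase m (r(m := int w))) - coef ?R (staircase m (r(m := int w)) + (unitv m + unitv m))"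
        unfolding RR coef_one_minus_ymon_times ..
      also have "staircase m (r(m := int w)) + (unitv m + unitv m) = staircase m (r(m := int (w + 2)))"
        by (auto simp: staircase_def unitv_def fun_eq_iff)
      finally show "of_bool (even (w + m)) * parity_sum 0 m ?b ?QA (r(m := int w)) =
          of_bool (even (w + m)) * (X w - X (w + 2))"
        by (simp add: X_def del: fun_upd_apply uminus_apply minus_apply plus_fun_apply minus_add_distrib of_nat_add)
    qed
    also have "\<dots> = X (m mod 2) - X (if even (?b + m) then ?b else ?b + 1)"
      by (rule sum_parity_telescope)
    also have "X (if even (?b + m) then ?b else ?b + 1) = 0"
    proof -
      have "X w = 0" if "?b \<le> w" for w
      proof -
        have "int ?b \<le> staircase m (r(m := int w)) m" using that by (simp add: staircase_def)
        then show ?thesis using bR unfolding X_def bounded_above_def by blast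
      qed
      then show ?thesis by simp
    qed
    also have "X (m mod 2) - 0 = coef A (staircase (Suc m) r) -
       (if odd m then coef A (staircase (Suc m) r + raise (Suc m)) else 0)"
      unfolding X_def diff_0_right by (rule coef_prod_raise_staircase[OF Suc.prems(1)])
    finally have 1: "parity_sum 0 (Suc m) ?b ?QA r - (if odd m then parity_sum 1 (Suc m) ?b ?QA r else 0) =
       coef A (staircase (Suc m) r) -
       (if odd m then coef A (staircase (Suc m) r + raise (Suc m)) else 0)"
      using parity_sum_insert_even[OF altQA, of ?b r] by (simp only: diff_conv_add_uminus diff_0_right)
    \<comment> \<open>\<open>A\<close> divided by the product of the variables
      \<open>0, ..., m\<close>: all exponents drop by one, so the bound becomes
      \<open>a\<close>.\<close>
    define A' where "A' = ymon (- raise (Suc m)) * A"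
    have A': "coef A' l = coef A (l + raise (Suc m))" for l
      by (simp add: A'_def coef_ymon_times)
    have "parity_sum 1 (Suc m) ?b ?QA r = parity_sum 1 (Suc m) (Suc a) ?QA ((r - raise (Suc m)) + raise (Suc m))"
      by simp
    also have "\<dots> = parity_sum 0 (Suc m) a (\<lambda>l. ?QA (l + raise (Suc m))) (r - raise (Suc m))"
      by (rule parity_sum_shift) simp
    also have "(\<lambda>l. ?QA (l + raise (Suc m))) = coef (littlewood (Suc m) * A')"
    proof -
      have "littlewood (Suc m) * A' = ymon (- raise (Suc m)) * (littlewood (Suc m) * A)"
        by (simp add: A'_def mult_ac)
      then show ?thesis by (simp add: coef_ymon_times fun_eq_iff[of _ "coef _"] del: plus_fun_apply)
    qed
    also have "parity_sum 0 (Suc m) a (coef (littlewood (Suc m) * A')) (r - raise (Suc m)) =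
       coef A' (staircase (Suc m) (r - raise (Suc m)))"
    proof (rule Suc.IH)
      show "alternating (Suc m) (coef A')"
        unfolding A'_def
        by (rule alternating_times[OF _ Suc.prems(1)])
           (auto simp: symmetric_def subst_swap_simps swap_coords_uminus, auto simp: swap_coords_def raise_def fun_eq_iff intro!: arg_cong[of _ _ ymon])
      show "bounded_above (Suc m) (int a) A'"
        unfolding bounded_above_def A'
      proof (intro allI impI)
        fix l assume "\<exists>i<Suc m. int a \<le> l i"
        then obtain i where "i < Suc m" "int ?b \<le> (l + raise (Suc m)) i" by (auto simp: raise_def)
        then show "coef A (l + raise (Suc m)) = 0" using Suc.prems(2) unfolding bounded_above_def by blast
      qed
    qed
    also have "\<dots> = coef A (staircase (Suc m) r + raise (Suc m))"
    proof -
      have "staircase (Suc m) (r - raise (Suc m)) = staircase (Suc m) r"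
        by (auto simp: staircase_def raise_def fun_eq_iff)
      then show ?thesis by (simp only: A')
    qed
    finally show ?case using 1 by (simp del: parity_sum.simps plus_fun_apply split: if_splits)
  qed
qed

section \<open>Partitions as positions of their columns\<close>

definition up :: "nat \<Rightarrow> real \<Rightarrow> laurent" where
  "up u x = (\<Prod>i<u. 1 + Poly_Mapping.single (unitv i) x)"

definition dn :: "nat \<Rightarrow> real \<Rightarrow> laurent" where
  "dn u x = (\<Prod>i<u. 1 + Poly_Mapping.single (- unitv i) x)"

definition ind :: "nat set \<Rightarrow> nat \<Rightarrow> int" where
  "ind T = (\<lambda>i. if i \<in> T then 1 else 0)"

lemma coef_one_plus_single_times:
  "coef ((1 + Poly_Mapping.single v x) * A) l = coef A l + x * coef A (l - v)"
  by (simp add: distrib_right lookup_add coef_single_times)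

lemma sum_Pow_lessThan_Suc:
  "(\<Sum>T\<in>Pow {..<Suc j}. h T) = (\<Sum>T\<in>Pow {..<j}. h T + h (insert j T))" for h :: "nat set \<Rightarrow> real"
proof -
  have *: "Pow {..<Suc j} = Pow {..<j} \<union> insert j ` Pow {..<j}"
    by (simp add: lessThan_Suc Pow_insert)
  have "inj_on (insert j) (Pow {..<j})"
    by (auto simp: inj_on_def)
  then show ?thesis
    unfolding * by (subst sum.union_disjoint) (auto simp: sum.reindex sum.distrib)
qed

lemma coef_up_times:
  "coef (up u x * G) l = (\<Sum>T\<in>Pow {..<u}. x ^ card T * coef G (l - ind T))"
proof (induction u arbitrary: l)
  case 0
  have "ind {} = 0" by (auto simp: ind_def)
  then show ?case by (simp add: up_def)
next
  case (Suc u)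
  have "up (Suc u) x * G = (1 + Poly_Mapping.single (unitv u) x) * (up u x * G)"
    by (simp add: up_def mult_ac)
  then have "coef (up (Suc u) x * G) l = coef (up u x * G) l + x * coef (up u x * G) (l - unitv u)"
    by (simp only: coef_one_plus_single_times)
  also have "\<dots> = (\<Sum>T\<in>Pow {..<u}. x ^ card T * coef G (l - ind T) + x ^ card (insert u T) * coef G (l - ind (insert u T)))"
    unfolding Suc sum_distrib_left sum.distrib[symmetric]
  proof (intro sum.cong refl)
    fix T assume T: "T \<in> Pow {..<u}"
    then have "finite T" "u \<notin> T" by (auto intro: finite_subset)
    moreover have "l - unitv u - ind T = l - ind (insert u T)"
      using \<open>u \<notin> T\<close> by (auto simp: ind_def unitv_def fun_eq_iff)
    ultimately show "x ^ card T * coef G (l - ind T) + x * (x ^ card T * coef G (l - unitv u - ind T)) =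
      x ^ card T * coef G (l - ind T) + x ^ card (insert u T) * coef G (l - ind (insert u T))"
      by (simp only: card_insert_disjoint power_Suc mult.assoc not_False_eq_True)
  qed
  finally show ?case by (simp only: sum_Pow_lessThan_Suc)
qed

lemma coef_dn_times:
  "coef (dn u x * G) l = (\<Sum>T\<in>Pow {..<u}. x ^ card T * coef G (l + ind T))"
proof (induction u arbitrary: l)
  case 0
  have "ind {} = 0" by (auto simp: ind_def)
  then show ?case by (simp add: dn_def)
next
  case (Suc u)
  have "dn (Suc u) x * G = (1 + Poly_Mapping.single (- unitv u) x) * (dn u x * G)"
    by (simp add: dn_def mult_ac)
  then have "coef (dn (Suc u) x * G) l = coef (dn u x * G) l + x * coef (dn u x * G) (l - - unitv u)"
    by (simp only: coef_one_plus_single_times)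
  also have "\<dots> = (\<Sum>T\<in>Pow {..<u}. x ^ card T * coef G (l + ind T) + x ^ card (insert u T) * coef G (l + ind (insert u T)))"
    unfolding Suc sum_distrib_left sum.distrib[symmetric]
  proof (intro sum.cong refl)
    fix T assume T: "T \<in> Pow {..<u}"
    then have "finite T" "u \<notin> T" by (auto intro: finite_subset)
    moreover have "l - - unitv u + ind T = l + ind (insert u T)"
      using \<open>u \<notin> T\<close> by (auto simp: ind_def unitv_def fun_eq_iff)
    ultimately show "x ^ card T * coef G (l + ind T) + x * (x ^ card T * coef G (l - - unitv u + ind T)) =
      x ^ card T * coef G (l + ind T) + x ^ card (insert u T) * coef G (l + ind (insert u T))"
      by (simp only: card_insert_disjoint power_Suc mult.assoc not_False_eq_True)
  qed
  finally show ?case by (simp only: sum_Pow_lessThan_Suc)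
qed

lemma symmetric_up: "symmetric u (up u x)"
  unfolding up_def
  by (rule symmetric_prod_lessThan) (simp add: subst_swap_simps swap_coords_unitv)

lemma symmetric_dn: "symmetric u (dn u x)"
  unfolding dn_def
  by (rule symmetric_prod_lessThan) (simp add: subst_swap_simps swap_coords_unitv swap_coords_uminus)

text \<open>A partition is a weakly decreasing function whose \<open>k\<close>-th value is the part with index \<open>k + 1\<close>, and
  \<open>cnt f j\<close> is the length of its \<open>j\<close>-th column.  The columns of a partition in a box of width \<open>u\<close>,
  from right to left, are the particles at the positions \<open>pos u f\<close>.\<close>

definition Par :: "nat \<Rightarrow> nat \<Rightarrow> (nat \<Rightarrow> nat) set" where
  "Par n u = {f. antimono f \<and> f 0 \<le> u \<and> (\<forall>k\<ge>n. f k = 0)}"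

definition cnt :: "(nat \<Rightarrow> nat) \<Rightarrow> nat \<Rightarrow> nat" where
  "cnt f j = card {k. j \<le> f k}"

text \<open>The skew shape between \<open>f\<close> and \<open>g\<close> is a horizontal
  strip.\<close>

definition interlaced :: "(nat \<Rightarrow> nat) \<Rightarrow> (nat \<Rightarrow> nat) \<Rightarrow> bool" where
  "interlaced f g \<longleftrightarrow> (\<forall>k. f k \<le> g k \<and> g (Suc k) \<le> f k)"

definition psize :: "nat \<Rightarrow> (nat \<Rightarrow> nat) \<Rightarrow> nat" where
  "psize u f = (\<Sum>i<u. cnt f (u - i))"

definition pos :: "nat \<Rightarrow> (nat \<Rightarrow> nat) \<Rightarrow> nat \<Rightarrow> int" where
  "pos u f = (\<lambda>i. if i < u then int (i + cnt f (u - i)) else 0)"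

lemma Par_mono: "f \<in> Par n u \<Longrightarrow> n \<le> m \<Longrightarrow> f \<in> Par m u"
  by (auto simp: Par_def)

lemma Par_le: "f \<in> Par n u \<Longrightarrow> f k \<le> u"
  unfolding Par_def using antimonoD[of f 0 k] by auto

lemma finite_Par: "finite (Par n u)"
proof (rule finite_subset)
  show "Par n u \<subseteq> {f. \<forall>k. (k \<in> {..<n} \<longrightarrow> f k \<in> {..u}) \<and> (k \<notin> {..<n} \<longrightarrow> f k = 0)}"
    using Par_le by (auto simp: Par_def)
  show "finite {f. \<forall>k. (k \<in> {..<n} \<longrightarrow> f k \<in> {..u}) \<and> (k \<notin> {..<n} \<longrightarrow> f k = 0)}"
    by (rule finite_set_of_finite_funs) auto
qed

text \<open>The set counted by \<open>cnt\<close> is an initial segment, because \<open>f\<close> is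
  antitone, and it is finite as soon as \<open>0 < j\<close>. This is the reflection of the diagram,
  and all passages between rows and columns go through it.\<close>

lemma cnt_gt_iff:
  assumes "f \<in> Par n u" "0 < j"
  shows "k < cnt f j \<longleftrightarrow> j \<le> f k"
proof -
  have anti: "antimono f" using assms by (simp add: Par_def)
  have sub: "{k. j \<le> f k} \<subseteq> {..<n}"
  proof
    fix k assume "k \<in> {k. j \<le> f k}"
    then have "f k \<noteq> 0" using assms(2) by auto
    then show "k \<in> {..<n}" using assms(1) by (auto simp: Par_def not_less[symmetric])
  qed
  then have fin: "finite {k. j \<le> f k}" by (rule finite_subset) simp
  show ?thesis
  proof
    assume "j \<le> f k"
    then have "{..k} \<subseteq> {k. j \<le> f k}" using antimonoD[OF anti] le_trans by blast
    from card_mono[OF fin this] show "k < cnt f j" by (simp add: cnt_def)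
  next
    assume k: "k < cnt f j"
    show "j \<le> f k"
    proof (rule ccontr)
      assume "\<not> j \<le> f k"
      then have "{k. j \<le> f k} \<subseteq> {..<k}" 
        using antimonoD[OF anti] le_trans not_le_imp_less by blast
      from card_mono[OF _ this] k show False by (simp add: cnt_def)
    qed
  qed
qed

lemma cnt_le: "f \<in> Par n u \<Longrightarrow> 0 < j \<Longrightarrow> cnt f j \<le> n"
  using cnt_gt_iff[of f n u j n] by (cases "n < cnt f j") (auto simp: Par_def)

lemma cnt_antimono:
  assumes "f \<in> Par n u" "0 < i" "i \<le> j"
  shows "cnt f j \<le> cnt f i"
proof -
  have "k < cnt f j \<Longrightarrow> k < cnt f i" for k
    using assms(2,3) cnt_gt_iff[OF assms(1), of i k] cnt_gt_iff[OF assms(1), of j k] by simp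
  then show ?thesis by (meson less_irrefl not_le)
qed

lemma Par_eqI:
  assumes "f \<in> Par n u" "g \<in> Par m u" "\<And>j. 0 < j \<Longrightarrow> j \<le> u \<Longrightarrow> cnt f j = cnt g j"
  shows "f = g"
proof
  fix k
  have "j \<le> f k \<longleftrightarrow> j \<le> g k" for j
  proof (cases "j = 0 \<or> u < j")
    case True
    then show ?thesis using Par_le[OF assms(1), of k] Par_le[OF assms(2), of k] by auto
  next
    case False
    then show ?thesis 
      using cnt_gt_iff[OF assms(1), of j k] cnt_gt_iff[OF assms(2), of j k] assms(3)[of j] by auto
  qed
  then show "f k = g k" by (metis order_antisym order_refl)
qed

text \<open>A horizontal strip has at most one cell in each column.\<close>

lemma interlaced_iff_cnt:
  assumes "f \<in> Par n u" "g \<in> Par m u"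
  shows "interlaced f g \<longleftrightarrow> (\<forall>j. 0 < j \<and> j \<le> u \<longrightarrow> cnt f j \<le> cnt g j \<and> cnt g j \<le> Suc (cnt f j))"
proof
  assume int: "interlaced f g"
  show "\<forall>j. 0 < j \<and> j \<le> u \<longrightarrow> cnt f j \<le> cnt g j \<and> cnt g j \<le> Suc (cnt f j)"
  proof (intro allI impI conjI)
    fix j assume j: "0 < j \<and> j \<le> u"
    have "k < cnt f j \<Longrightarrow> k < cnt g j" for k
      
    proof -
      assume "k < cnt f j"
      then have "j \<le> f k" using cnt_gt_iff[OF assms(1)] j by simp
      also have "\<dots> \<le> g k" using int by (simp add: interlaced_def)
      finally show ?thesis using cnt_gt_iff[OF assms(2)] j by simp
    qed
    then show "cnt f j \<le> cnt g j" by (meson less_irrefl not_le)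
    have "k < cnt g j \<Longrightarrow> k < Suc (cnt f j)" for k
    proof (cases k)
      case (Suc i)
      assume "k < cnt g j"
      then have "j \<le> g (Suc i)" using cnt_gt_iff[OF assms(2)] j Suc by simp
      also have "\<dots> \<le> f i" using int by (simp add: interlaced_def)
      finally show ?thesis using cnt_gt_iff[OF assms(1)] j Suc by simp
    qed simp
    then show "cnt g j \<le> Suc (cnt f j)" by (meson less_irrefl not_le)
  qed
next
  assume c: "\<forall>j. 0 < j \<and> j \<le> u \<longrightarrow> cnt f j \<le> cnt g j \<and> cnt g j \<le> Suc (cnt f j)"
  show "interlaced f g"
    unfolding interlaced_def
  proof (intro allI conjI)
    fix k
    show "f k \<le> g k"
    proof (cases "f k = 0")
      case False
      then have "k < cnt f (f k)" using cnt_gt_iff[OF assms(1), of "f k" k] by simp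
      then have "k < cnt g (f k)" using c False Par_le[OF assms(1), of k] by (meson le_trans not_le neq0_conv)
      then show ?thesis using cnt_gt_iff[OF assms(2)] False by simp
    qed simp
    show "g (Suc k) \<le> f k"
    proof (cases "g (Suc k) = 0")
      case False
      then have "Suc k < cnt g (g (Suc k))" using cnt_gt_iff[OF assms(2), of "g (Suc k)" "Suc k"] by simp
      moreover have "cnt g (g (Suc k)) \<le> Suc (cnt f (g (Suc k)))"
        using c False Par_le[OF assms(2), of "Suc k"] by simp
      ultimately have "k < cnt f (g (Suc k))" by simp
      then show ?thesis using cnt_gt_iff[OF assms(1)] False by simp
    qed simp
  qed
qed

lemma psize_eq_sum:
  assumes "f \<in> Par n u"
  shows "psize u f = (\<Sum>k<n. f k)"
proof -
  have "psize u f = (\<Sum>j\<in>{1..u}. cnt f j)"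
    unfolding psize_def by (rule sum.reindex_bij_witness[where i = "\<lambda>j. u - j" and j = "\<lambda>i. u - i"]) auto
  also have "\<dots> = (\<Sum>j\<in>{1..u}. \<Sum>k<n. of_bool (j \<le> f k))"
  proof (intro sum.cong refl)
    fix j assume j: "j \<in> {1..u}"
    have "{..<n} \<inter> {k. j \<le> f k} = {k. j \<le> f k}"
    proof -
      have "k < n" if "j \<le> f k" for k
      proof (rule ccontr)
        assume "\<not> k < n"
        then have "f k = 0" using assms by (simp add: Par_def)
        with that j show False by simp
      qed
      then show ?thesis by auto
    qed
    then show "cnt f j = (\<Sum>k<n. of_bool (j \<le> f k))"
      by (simp add: cnt_def)
  qed
  also have "\<dots> = (\<Sum>k<n. \<Sum>j\<in>{1..u}. of_bool (j \<le> f k))"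
    by (rule sum.swap)
  also have "\<dots> = (\<Sum>k<n. f k)"
  proof (intro sum.cong refl)
    fix k
    have "{1..u} \<inter> {j. j \<le> f k} = {1..f k}" using Par_le[OF assms, of k] by auto
    then show "(\<Sum>j\<in>{1..u}. of_bool (j \<le> f k)) = f k" by simp
  qed
  finally show ?thesis .
qed

lemma pos_strict_mono:
  assumes "f \<in> Par n u" "i < j" "j < u"
  shows "pos u f i < pos u f j"
proof -
  have "cnt f (u - i) \<le> cnt f (u - j)"
    by (rule cnt_antimono[OF assms(1)]) (use assms in auto)
  with assms show ?thesis by (simp add: pos_def)
qed

lemma pos_inject: "f \<in> Par n u \<Longrightarrow> g \<in> Par m u \<Longrightarrow> pos u f = pos u g \<Longrightarrow> f = g"
proof (rule Par_eqI)
  fix j assume *: "f \<in> Par n u" "g \<in> Par m u" "pos u f = pos u g" "0 < j" "j \<le> u"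
  then have "pos u f (u - j) = pos u g (u - j)" by simp
  then show "cnt f j = cnt g j" using *(4,5) by (simp add: pos_def)
qed

text \<open>The column lengths are \<open>l i - i\<close>, weakly increasing in \<open>i\<close>
  because \<open>l\<close> is strictly increasing; the parts are then recovered by
  conjugation.\<close>

lemma pos_surj:
  assumes "\<And>i j. i < j \<Longrightarrow> j < u \<Longrightarrow> l i < l j" "\<And>i. i < u \<Longrightarrow> 0 \<le> l i"
    "\<And>i. i < u \<Longrightarrow> l i \<le> int (i + n)" "\<And>i. u \<le> i \<Longrightarrow> l i = 0"
  obtains f where "f \<in> Par n u" "pos u f = l"
proof -
  define c where "c j = nat (l (u - j) - int (u - j))" for j
  define f where "f k = card {j \<in> {1..u}. k < c j}" for k
  have lge: "int i \<le> l i" if "i < u" for i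
    using that
  proof (induction i)
    case (Suc i)
    then show ?case using assms(1)[of i "Suc i"] by simp
  qed (use assms(2) in auto)
  have wmono: "l i - int i \<le> l (i + d) - int (i + d)" if "i + d < u" for i d
    using that
  proof (induction d)
    case (Suc d)
    then show ?case using assms(1)[of "i + d" "Suc (i + d)"] by simp
  qed simp
  have c_anti: "c j \<le> c i" if "1 \<le> i" "i \<le> j" "j \<le> u" for i j
    using that wmono[of "u - j" "j - i"] unfolding c_def by simp
  have c_le: "c j \<le> n" if "1 \<le> j" "j \<le> u" for j
    using assms(3)[of "u - j"] that by (simp add: c_def)
  have key: "j \<le> f k \<longleftrightarrow> k < c j" if j: "1 \<le> j" "j \<le> u" for j k
  proof
    assume "k < c j"
    then have "{1..j} \<subseteq> {j \<in> {1..u}. k < c j}" 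
      using c_anti[OF _ _ j(2)] j by (auto intro: less_le_trans[of _ "c j"])
    from card_mono[OF _ this] show "j \<le> f k" by (simp add: f_def)
  next
    assume "j \<le> f k"
    show "k < c j"
    proof (rule ccontr)
      assume "\<not> k < c j"
      have "{j \<in> {1..u}. k < c j} \<subseteq> {1..<j}"
      proof (rule subsetI, rule ccontr)
        fix i assume i: "i \<in> {j \<in> {1..u}. k < c j}" "i \<notin> {1..<j}"
        then have "c i \<le> c j" using j by (intro c_anti) auto
        with i \<open>\<not> k < c j\<close> show False by auto
      qed
      from card_mono[OF _ this] \<open>j \<le> f k\<close> j show False by (simp add: f_def)
    qed
  qed
  have "f \<in> Par n u"
    unfolding Par_def
  proof (intro CollectI conjI allI impI)
    show "antimono f"
      unfolding f_def by (intro antimonoI card_mono) auto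
    have "card {j \<in> {1..u}. 0 < c j} \<le> card {1..u}" by (rule card_mono) auto
    then show "f 0 \<le> u" by (simp add: f_def)
    fix k assume "n \<le> k"
    then have "{j \<in> {1..u}. k < c j} = {}" using c_le by (force simp: not_less)
    then show "f k = 0" by (simp add: f_def)
  qed
  moreover have "pos u f = l"
  proof
    fix i
    show "pos u f i = l i"
    proof (cases "i < u")
      case True
      have "cnt f (u - i) = card {..<c (u - i)}"
        unfolding cnt_def using key[of "u - i"] True by (intro arg_cong[of _ _ card]) auto
      then show ?thesis using True lge[OF True] by (simp add: pos_def c_def)
    qed (use assms(4) in \<open>auto simp: pos_def\<close>)
  qed
  ultimately show ?thesis using that by blast
qed

section \<open>The Vandermonde product: sign, support and leading coefficient\<close>

definition vandermonde :: "nat \<Rightarrow> laurent" where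
  "vandermonde u = (\<Prod>j<u. \<Prod>i<j. ymon (unitv j) - ymon (unitv i))"

lemma vandermonde_Suc: "vandermonde (Suc u) = vandermonde u * (\<Prod>i<u. ymon (unitv u) - ymon (unitv i))"
  by (simp add: vandermonde_def)

lemma vandermonde_pairs:
  "vandermonde u = (\<Prod>(i, j)\<in>{(i, j). i < j \<and> j < u}. ymon (unitv j) - ymon (unitv i))"
proof -
  have "vandermonde u = (\<Prod>(j, i)\<in>Sigma {..<u} (\<lambda>j. {..<j}). ymon (unitv j) - ymon (unitv i))"
    unfolding vandermonde_def by (rule prod.Sigma) auto
  also have "\<dots> = (\<Prod>(i, j)\<in>{(i, j). i < j \<and> j < u}. ymon (unitv j) - ymon (unitv i))"
    by (rule prod.reindex_bij_witness[where i = "\<lambda>(i, j). (j, i)" and j = "\<lambda>(i, j). (j, i)"]) auto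
  finally show ?thesis .
qed

text \<open>An adjacent swap permutes the pairs \<open>i < j\<close>, except for the pair
  \<open>(a, Suc a)\<close> itself, whose factor changes sign.\<close>

lemma subst_swap_vand_adjacent:
  assumes "Suc a < u"
  shows "subst (swap_coords a (Suc a)) (vandermonde u) = - vandermonde u"
proof -
  let ?t = "\<lambda>k. if k = a then Suc a else if k = Suc a then a else k"
  let ?F = "\<lambda>i j. ymon (unitv j) - ymon (unitv i)"
  let ?P = "{(i, j). i < j \<and> j < u}"
  let ?P' = "?P - {(a, Suc a)}"
  have fin: "finite ?P" by (rule finite_subset[of _ "{..<u} \<times> {..<u}"]) auto
  have V: "vandermonde u = ?F a (Suc a) * (\<Prod>(i, j)\<in>?P'. ?F i j)"
    unfolding vandermonde_pairs using assms fin by (subst prod.remove[of _ "(a, Suc a)"]) auto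
  have "subst (swap_coords a (Suc a)) (vandermonde u) = ?F (Suc a) a * (\<Prod>(i, j)\<in>?P'. ?F (?t i) (?t j))"
    unfolding V
    by (simp add: subst_swap_simps case_prod_unfold swap_coords_unitv)
  also have "(\<Prod>(i, j)\<in>?P'. ?F (?t i) (?t j)) = (\<Prod>(i, j)\<in>?P'. ?F i j)"
    by (rule prod.reindex_bij_witness[where i = "\<lambda>(i, j). (?t i, ?t j)"
          and j = "\<lambda>(i, j). (?t i, ?t j)"])
       (use assms in \<open>auto split: if_splits\<close>)
  finally show ?thesis unfolding V by (simp add: left_diff_distrib)
qed

lemma subst_swap_vandermonde:
  "a < b \<Longrightarrow> b < u \<Longrightarrow> subst (swap_coords a b) (vandermonde u) = - vandermonde u"
proof (induction b)
  case (Suc b)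
  show ?case
  proof (cases "a = b")
    case True
    then show ?thesis using subst_swap_vand_adjacent Suc.prems by simp
  next
    case False
    \<comment> \<open>Conjugating by the adjacent swap brings the two indices closer; of the three
      sign changes one remains.\<close>
    have "subst (swap_coords a (Suc b)) (vandermonde u) =
      subst (swap_coords b (Suc b)) (subst (swap_coords a b) (subst (swap_coords b (Suc b)) (vandermonde u)))"
    proof (rule poly_mapping_eqI)
      fix l
      have "swap_coords a (Suc b) l = swap_coords b (Suc b) (swap_coords a b (swap_coords b (Suc b) l))"
        using False Suc.prems by (auto simp: swap_coords_def fun_eq_iff)
      then show "coef (subst (swap_coords a (Suc b)) (vandermonde u)) l =
        coef (subst (swap_coords b (Suc b)) (subst (swap_coords a b) (subst (swap_coords b (Suc b)) (vandermonde u)))) l"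
        by (simp only: additive_involution.coef_subst[OF swap_coords_involution])
    qed
    also have "\<dots> = - vandermonde u"
      using Suc False by (simp add: subst_swap_vand_adjacent subst_swap_simps)
    finally show ?thesis .
  qed
qed simp

lemma alternating_vandermonde: "alternating u (coef (vandermonde u))"
  unfolding alternating_lookup_iff
proof (intro allI impI)
  fix i j assume ij: "i < u" "j < u" "i \<noteq> j"
  have "swap_coords i j = swap_coords j i"
    by (auto simp: swap_coords_def fun_eq_iff)
  then show "subst (swap_coords i j) (vandermonde u) = - vandermonde u"
    using subst_swap_vandermonde[of i j u] subst_swap_vandermonde[of j i u] ij by (metis linorder_neqE_nat)
qed

definition supported :: "(nat \<Rightarrow> int) set \<Rightarrow> laurent \<Rightarrow> bool" where
  "supported S A \<longleftrightarrow> (\<forall>l. coef A l \<noteq> 0 \<longrightarrow> l \<in> S)"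

lemma supportedD: "supported S A \<Longrightarrow> l \<notin> S \<Longrightarrow> coef A l = 0"
  by (auto simp: supported_def)

lemma coef_minus_times: "coef ((ymon v - ymon w) * A) l = coef A (l - v) - coef A (l - w)"
  by (simp add: left_diff_distrib lookup_minus coef_ymon_times)

lemma supported_times_diff:
  assumes "supported S A" "\<And>l. l \<in> S \<Longrightarrow> l + v \<in> S'" "\<And>l. l \<in> S \<Longrightarrow> l + w \<in> S'"
  shows "supported S' ((ymon v - ymon w) * A)"
  unfolding supported_def coef_minus_times
proof (intro allI impI)
  fix l assume "coef A (l - v) - coef A (l - w) \<noteq> 0"
  then have "coef A (l - v) \<noteq> 0 \<or> coef A (l - w) \<noteq> 0" by auto
  then have "l - v \<in> S \<or> l - w \<in> S" using assms(1) unfolding supported_def by blast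
  then have "(l - v) + v \<in> S' \<or> (l - w) + w \<in> S'" using assms(2,3) by blast
  then show "l \<in> S'" unfolding diff_add_cancel by blast
qed

lemma supported_times_one_plus:
  assumes "supported S A" "S \<subseteq> S'" "\<And>l. l \<in> S \<Longrightarrow> l + v \<in> S'"
  shows "supported S' ((1 + Poly_Mapping.single v x) * A)"
  unfolding supported_def coef_one_plus_single_times
proof (intro allI impI)
  fix l assume "coef A l + x * coef A (l - v) \<noteq> 0"
  then have "coef A l \<noteq> 0 \<or> coef A (l - v) \<noteq> 0" by auto
  then have "l \<in> S \<or> l - v \<in> S" using assms(1) unfolding supported_def by blast
  then have "l \<in> S' \<or> (l - v) + v \<in> S'" using assms(2,3) by blast
  then show "l \<in> S'" unfolding diff_add_cancel by blast
qed

lemma supported_one: "0 \<in> S \<Longrightarrow> supported S 1"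
  by (auto simp: supported_def lookup_one when_def)

lemma supported_vand_nonneg: "supported {l. \<forall>i. 0 \<le> l i} (vandermonde u)"
proof (induction u)
  case (Suc u)
  have "supported {l. \<forall>i. 0 \<le> l i} ((\<Prod>i<k. ymon (unitv u) - ymon (unitv i)) * vandermonde u)" for k
  proof (induction k)
    case (Suc k)
    have "supported {l. \<forall>i. 0 \<le> l i} ((ymon (unitv u) - ymon (unitv k)) *
        ((\<Prod>i<k. ymon (unitv u) - ymon (unitv i)) * vandermonde u))"
      by (rule supported_times_diff[OF Suc]) (auto simp: unitv_def)
    then show ?case by (simp add: mult_ac)
  qed (use Suc in simp)
  then show ?case by (simp add: vandermonde_Suc mult.commute)
qed (simp add: vandermonde_def supported_one)

lemma supported_up_nonneg:
  assumes "supported {l. \<forall>i. 0 \<le> l i} A"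
  shows "supported {l. \<forall>i. 0 \<le> l i} (up u x * A)"
proof (induction u)
  case (Suc u)
  have "supported {l. \<forall>i. 0 \<le> l i} ((1 + Poly_Mapping.single (unitv u) x) * (up u x * A))"
    by (rule supported_times_one_plus[OF Suc]) (auto simp: unitv_def)
  then show ?case by (simp add: up_def mult_ac)
qed (simp add: up_def assms)

lemma supported_vand_degree:
  "u \<le> v \<Longrightarrow> supported {l. (\<Sum>i<v. l i) = (\<Sum>i<u. int i)} (vandermonde u)"
proof (induction u)
  case (Suc u)
  have "supported {l. (\<Sum>i<v. l i) = (\<Sum>i<u. int i) + int k} ((\<Prod>i<k. ymon (unitv u) - ymon (unitv i)) * vandermonde u)"
    if "k \<le> u" for k
    using that
  proof (induction k)
    case (Suc k)
    have s: "(\<Sum>i<v. (l + unitv j) i) = (\<Sum>i<v. l i) + 1" if "j < v" for l j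
      using that by (simp add: unitv_def sum.distrib)
    have "supported {l. (\<Sum>i<v. l i) = (\<Sum>i<u. int i) + int (Suc k)} ((ymon (unitv u) - ymon (unitv k)) *
        ((\<Prod>i<k. ymon (unitv u) - ymon (unitv i)) * vandermonde u))"
      by (rule supported_times_diff[OF Suc.IH]) (use Suc.prems \<open>Suc u \<le> v\<close> s in auto)
    then show ?case by (simp add: mult_ac)
  qed (use Suc in simp)
  from this[of u] show ?case by (simp add: vandermonde_Suc mult.commute)
qed (simp add: vandermonde_def supported_one)

lemma supported_vand_coord: "u \<le> m \<Longrightarrow> supported {l. l m = 0} (vandermonde u)"
proof (induction u)
  case (Suc u)
  have "supported {l. l m = 0} ((\<Prod>i<k. ymon (unitv u) - ymon (unitv i)) * vandermonde u)" if "k \<le> u" for k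
    using that
  proof (induction k)
    case (Suc k)
    have "supported {l. l m = 0} ((ymon (unitv u) - ymon (unitv k)) *
        ((\<Prod>i<k. ymon (unitv u) - ymon (unitv i)) * vandermonde u))"
      by (rule supported_times_diff[OF Suc.IH]) (use Suc.prems \<open>Suc u \<le> m\<close> in \<open>auto simp: unitv_def\<close>)
    then show ?case by (simp add: mult_ac)
  qed (use Suc in simp)
  from this[of u] show ?case by (simp add: vandermonde_Suc mult.commute)
qed (simp add: vandermonde_def supported_one)

text \<open>Exponent \<open>j\<close> in coordinate \<open>u\<close> is reached only by taking the
  variable \<open>u\<close> from each of the \<open>j\<close> factors; the support bound rules out
  every other choice.\<close>

lemma coef_vand_top:
  assumes "j \<le> u"
  shows "supported {l. l u \<le> int j} ((\<Prod>i<j. ymon (unitv u) - ymon (unitv i)) * vandermonde u) \<and>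
    coef ((\<Prod>i<j. ymon (unitv u) - ymon (unitv i)) * vandermonde u) ((staircase u 0)(u := int j)) = coef (vandermonde u) (staircase u 0)"
  using assms
proof (induction j)
  case 0
  have "(staircase u 0)(u := int 0) = staircase u 0"
    by (auto simp: staircase_def)
  then show ?case using supported_vand_coord[of u u]
    by (auto simp: supported_def simp del: fun_upd_apply zero_fun_apply)
next
  case (Suc j)
  let ?A = "(\<Prod>i<j. ymon (unitv u) - ymon (unitv i)) * vandermonde u"
  have eq: "(\<Prod>i<Suc j. ymon (unitv u) - ymon (unitv i)) * vandermonde u = (ymon (unitv u) - ymon (unitv j)) * ?A"
    by (simp add: mult_ac)
  have IH1: "supported {l. l u \<le> int j} ?A"
    using Suc by simp
  have IH2: "coef ?A ((staircase u 0)(u := int j)) = coef (vandermonde u) (staircase u 0)"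
    using Suc by (simp del: fun_upd_apply zero_fun_apply)
  show ?case
    unfolding eq
  proof
    show "supported {l. l u \<le> int (Suc j)} ((ymon (unitv u) - ymon (unitv j)) * ?A)"
      by (rule supported_times_diff[OF IH1]) (auto simp: unitv_def)
    let ?l = "(staircase u 0)(u := int (Suc j))"
    have "?l - unitv u = (staircase u 0)(u := int j)"
      by (auto simp: unitv_def fun_eq_iff)
    moreover have "coef ?A (?l - unitv j) = 0"
      by (rule supportedD[OF IH1]) (use Suc.prems in \<open>simp add: unitv_def\<close>)
    ultimately show "coef ((ymon (unitv u) - ymon (unitv j)) * ?A) ?l = coef (vandermonde u) (staircase u 0)"
      unfolding coef_minus_times using IH2 by (simp only: diff_0_right)
  qed
qed

lemma coef_vand_staircase: "coef (vandermonde u) (staircase u 0) = 1"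
proof (induction u)
  case 0
  have *: "staircase 0 0 = 0" by (auto simp: staircase_def)
  show ?case unfolding * by (simp add: vandermonde_def del: zero_fun_apply)
next
  case (Suc u)
  have "staircase (Suc u) 0 = (staircase u 0)(u := int u)"
    by (auto simp: staircase_def)
  then show ?case using coef_vand_top[of u u] Suc
    by (simp add: vandermonde_Suc mult.commute del: zero_fun_apply fun_upd_apply)
qed

text \<open>Each factor adds terms of strictly smaller total degree only, so the part of
  \<open>A\<close> in the top degree \<open>d\<close> is unchanged.\<close>

lemma prod_one_minus_degree:
  assumes "supported {l. (\<Sum>i<u. l i) \<le> d} A" "finite I" "\<And>x. x \<in> I \<Longrightarrow> 0 < (\<Sum>i<u. v x i)"
  shows "supported {l. (\<Sum>i<u. l i) \<le> d} ((\<Prod>x\<in>I. 1 - ymon (- v x)) * A) \<and>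
    (\<forall>l. d \<le> (\<Sum>i<u. l i) \<longrightarrow> coef ((\<Prod>x\<in>I. 1 - ymon (- v x)) * A) l = coef A l)"
  using assms(2,3)
proof (induction I rule: finite_induct)
  case empty
  then show ?case using assms(1) by simp
next
  case (insert x I)
  let ?B = "(\<Prod>x\<in>I. 1 - ymon (- v x)) * A"
  have eq: "(\<Prod>x\<in>insert x I. 1 - ymon (- v x)) * A = (1 - ymon (- v x)) * ?B"
    using insert.hyps by (simp add: mult.assoc del: uminus_apply)
  have eq': "(1 - ymon (- v x)) * ?B = (ymon 0 - ymon (- v x)) * ?B"
    by (simp only: ymon_zero)
  have IH: "supported {l. (\<Sum>i<u. l i) \<le> d} ?B \<and> (\<forall>l. d \<le> (\<Sum>i<u. l i) \<longrightarrow> coef ?B l = coef A l)"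
    using insert.IH insert.prems by blast
  then have sB: "supported {l. (\<Sum>i<u. l i) \<le> d} ?B" by blast
  have pos: "0 < (\<Sum>i<u. v x i)" using insert by simp
  show ?case
    unfolding eq
  proof (intro conjI allI impI)
    show "supported {l. (\<Sum>i<u. l i) \<le> d} ((1 - ymon (- v x)) * ?B)"
      unfolding eq'
      by (rule supported_times_diff[OF sB]) (use pos in \<open>auto simp: sum.distrib sum_negf sum_subtractf\<close>)
    fix l :: "nat \<Rightarrow> int" assume l: "d \<le> (\<Sum>i<u. l i)"
    have "coef ?B (l + v x) = 0"
      by (rule supportedD[OF sB]) (use l pos in \<open>simp add: sum.distrib\<close>)
    then show "coef ((1 - ymon (- v x)) * ?B) l = coef A l"
      using IH l unfolding coef_one_minus_ymon_times by (simp del: plus_fun_apply)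
  qed
qed

lemma sum_pos: "(\<Sum>i<u. pos u f i) = (\<Sum>i<u. int i) + int (psize u f)"
  by (simp add: pos_def psize_def sum.distrib)

lemma pos_zero: "pos u (\<lambda>_. 0) = staircase u 0"
  by (auto simp: pos_def staircase_def cnt_def)

lemma coef_littlewood_vandermonde:
  assumes "(\<Sum>i<u. int i) \<le> (\<Sum>i<u. l i)"
  shows "coef (littlewood u * vandermonde u) l = coef (vandermonde u) l"
proof -
  let ?I = "{(i, j). i \<le> j \<and> j < u}"
  let ?v = "\<lambda>p. unitv (fst p) + unitv (snd p)"
  have "finite ?I" by (rule finite_subset[of _ "{..<u} \<times> {..<u}"]) auto
  moreover have "supported {l. (\<Sum>i<u. l i) \<le> (\<Sum>i<u. int i)} (vandermonde u)"
    using supported_vand_degree[of u u] by (auto simp: supported_def)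
  moreover have "0 < (\<Sum>i<u. ?v p i)" if "p \<in> ?I" for p
    using that by (auto simp: unitv_def sum.distrib)
  ultimately have "coef ((\<Prod>p\<in>?I. 1 - ymon (- ?v p)) * vandermonde u) l = coef (vandermonde u) l"
    using prod_one_minus_degree[of u "\<Sum>i<u. int i" "vandermonde u" ?I ?v] assms by blast
  then show ?thesis by (simp only: littlewood_pairs case_prod_unfold)
qed

text \<open>The product is homogeneous of the degree of the staircase, and the degree of
  \<open>pos u f\<close> is larger by the size of \<open>f\<close>.\<close>

lemma coef_vand_pos:
  assumes "f \<in> Par n u"
  shows "coef (vandermonde u) (pos u f) = of_bool (f = (\<lambda>_. 0))"
proof (cases "psize u f = 0")
  case True
  have "f = (\<lambda>_. 0)"
  proof (rule Par_eqI[OF assms])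
    show "(\<lambda>_. 0) \<in> Par 0 u" by (auto simp: Par_def antimono_def)
    fix j assume j: "0 < j" "j \<le> u"
    have "\<forall>i\<in>{..<u}. cnt f (u - i) = 0"
      using True by (simp add: psize_def)
    then have "cnt f (u - (u - j)) = 0" by (rule bspec) (use j in simp)
    then have "cnt f j = 0" using j by simp
    then show "cnt f j = cnt (\<lambda>_. 0) j"
      using j by (simp add: cnt_def[of "\<lambda>_. 0"])
  qed
  then show ?thesis by (simp add: pos_zero coef_vand_staircase)
next
  case False
  then have "f \<noteq> (\<lambda>_. 0)" by (auto simp: psize_def cnt_def)
  moreover have "coef (vandermonde u) (pos u f) = 0"
    by (rule supportedD[OF supported_vand_degree[of u u]]) (use False in \<open>simp_all add: sum_pos\<close>)
  ultimately show ?thesis by simp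
qed

lemma coef_littlewood_vand_pos:
  "coef (littlewood u * vandermonde u) (pos u f) = coef (vandermonde u) (pos u f)"
  by (rule coef_littlewood_vandermonde) (simp add: sum_pos)

section \<open>Horizontal strips from multiplication\<close>

text \<open>Expanding the product lowers a set \<open>K\<close> of positions by one. If two
  positions collide, the coefficient vanishes by alternation; if one reaches -1, it vanishes by
  \<open>wall\<close>. The surviving sets are those of the columns in which \<open>g\<close> has one
  cell more than some \<open>f\<close>.\<close>

lemma coef_up_pos:
  assumes alt: "alternating u (coef G)" and g: "g \<in> Par n u"
    and wall: "\<And>l i. i < u \<Longrightarrow> l i = -1 \<Longrightarrow> coef G l = 0"
  shows "coef (up u x * G) (pos u g) =
    (\<Sum>f\<in>{f \<in> Par n u. interlaced f g}. x ^ (psize u g - psize u f) * coef G (pos u f))"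
proof -
  let ?S = "{f \<in> Par n u. interlaced f g}"
  define T where "T f = {i \<in> {..<u}. cnt f (u - i) \<noteq> cnt g (u - i)}" for f
  have c: "cnt g (u - i) = cnt f (u - i) + of_bool (i \<in> T f)" if "f \<in> ?S" "i < u" for f i
  proof -
    have "cnt f (u - i) \<le> cnt g (u - i) \<and> cnt g (u - i) \<le> Suc (cnt f (u - i))"
      using interlaced_iff_cnt[of f n u g n] g that by simp
    then show ?thesis using that by (auto simp: T_def)
  qed
  have T: "pos u g - ind (T f) = pos u f" if "f \<in> ?S" for f
  proof
    fix i show "(pos u g - ind (T f)) i = pos u f i"
      using c[OF that, of i] by (cases "i < u") (auto simp: pos_def ind_def, auto simp: T_def)
  qed
  have card: "card (T f) = psize u g - psize u f" if "f \<in> ?S" for f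
  proof -
    have "psize u g = psize u f + (\<Sum>i<u. of_bool (i \<in> T f))"
      unfolding psize_def sum.distrib[symmetric] by (intro sum.cong refl c[OF that]) auto
    also have "(\<Sum>i<u. of_bool (i \<in> T f)) = card (T f)"
    proof -
      have "{..<u} \<inter> {i. i \<in> T f} = T f" by (auto simp: T_def)
      then show ?thesis by simp
    qed
    finally show ?thesis by simp
  qed
  have inj: "inj_on T ?S"
  proof (rule inj_onI)
    fix f f' assume *: "f \<in> ?S" "f' \<in> ?S" "T f = T f'"
    then have "pos u f = pos u f'" using T by metis
    then show "f = f'" using * pos_inject by blast
  qed
  have "coef (up u x * G) (pos u g) = (\<Sum>K\<in>Pow {..<u}. x ^ card K * coef G (pos u g - ind K))"
    by (rule coef_up_times)
  also have "\<dots> = (\<Sum>K\<in>T ` ?S. x ^ card K * coef G (pos u g - ind K))"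
  proof (rule sum.mono_neutral_right)
    show "T ` ?S \<subseteq> Pow {..<u}" by (auto simp: T_def)
    show "\<forall>K\<in>Pow {..<u} - T ` ?S. x ^ card K * coef G (pos u g - ind K) = 0"
    proof (rule ballI, rule ccontr)
      fix K assume K: "K \<in> Pow {..<u} - T ` ?S" and nz: "x ^ card K * coef G (pos u g - ind K) \<noteq> 0"
      define l where "l = pos u g - ind K"
      have nz: "coef G l \<noteq> 0" using nz by (auto simp: l_def)
      have l: "l i = int (i + cnt g (u - i)) - of_bool (i \<in> K)" if "i < u" for i
        using that by (simp add: l_def pos_def ind_def)
      have ge: "0 \<le> l i" if "i < u" for i
      proof -
        have "l i \<noteq> -1" using wall[of i l] nz that by auto
        moreover have "-1 \<le> l i" unfolding l[OF that] by auto
        ultimately show ?thesis by linarith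
      qed
      have mono: "l i < l j" if ij: "i < j" "j < u" for i j
      proof -
        have "l i \<noteq> l j" using alternating_eq_0[OF alt, of i j l] nz ij by auto
        moreover have "l i \<le> l j"
          using pos_strict_mono[OF g ij] ij unfolding l_def by (auto simp: ind_def)
        ultimately show ?thesis by simp
      qed
      have le: "l i \<le> int (i + n)" if "i < u" for i
        using cnt_le[OF g, of "u - i"] that unfolding l[OF that] by simp
      have zero: "l i = 0" if "u \<le> i" for i
        using K that by (auto simp: l_def pos_def ind_def)
      obtain f where f: "f \<in> Par n u" "pos u f = l"
        by (rule pos_surj[of u l n]) (use mono ge le zero in blast)+
      have cf: "int (cnt f (u - i)) = int (cnt g (u - i)) - of_bool (i \<in> K)" if "i < u" for i
        using fun_cong[OF f(2), of i] l[OF that] that by (simp add: pos_def)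
      have "interlaced f g"
        unfolding interlaced_iff_cnt[OF f(1) g]
      proof (intro allI impI)
        fix j assume "0 < j \<and> j \<le> u"
        then show "cnt f j \<le> cnt g j \<and> cnt g j \<le> Suc (cnt f j)" using cf[of "u - j"]
          by (cases "u - j \<in> K") auto
      qed
      moreover have "K = T f"
        using K cf by (force simp: T_def)
      ultimately show False using K f(1) by blast
    qed
  qed simp
  also have "\<dots> = (\<Sum>f\<in>?S. x ^ card (T f) * coef G (pos u g - ind (T f)))"
    by (simp add: sum.reindex[OF inj])
  also have "\<dots> = (\<Sum>f\<in>?S. x ^ (psize u g - psize u f) * coef G (pos u f))"
    by (intro sum.cong refl) (simp only: card T)
  finally show ?thesis .
qed

text \<open>The adjoint expansion: positions are raised and move away from the wall, collisions
  again cancel, and the columns, hence the number of parts, can grow by one.\<close>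

lemma coef_dn_pos:
  assumes alt: "alternating u (coef G)" and f: "f \<in> Par n u"
  shows "coef (dn u x * G) (pos u f) =
    (\<Sum>g\<in>{g \<in> Par (Suc n) u. interlaced f g}. x ^ (psize u g - psize u f) * coef G (pos u g))"
proof -
  let ?S = "{g \<in> Par (Suc n) u. interlaced f g}"
  define T where "T g = {i \<in> {..<u}. cnt f (u - i) \<noteq> cnt g (u - i)}" for g
  have c: "cnt g (u - i) = cnt f (u - i) + of_bool (i \<in> T g)" if "g \<in> ?S" "i < u" for g i
  proof -
    have "cnt f (u - i) \<le> cnt g (u - i) \<and> cnt g (u - i) \<le> Suc (cnt f (u - i))"
      using interlaced_iff_cnt[of f n u g "Suc n"] f that by simp
    then show ?thesis using that by (auto simp: T_def)
  qed
  have T: "pos u f + ind (T g) = pos u g" if "g \<in> ?S" for g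
  proof
    fix i show "(pos u f + ind (T g)) i = pos u g i"
      using c[OF that, of i] by (cases "i < u") (auto simp: pos_def ind_def, auto simp: T_def)
  qed
  have card: "card (T g) = psize u g - psize u f" if "g \<in> ?S" for g
  proof -
    have "psize u g = psize u f + (\<Sum>i<u. of_bool (i \<in> T g))"
      unfolding psize_def sum.distrib[symmetric] by (intro sum.cong refl c[OF that]) auto
    also have "(\<Sum>i<u. of_bool (i \<in> T g)) = card (T g)"
    proof -
      have "{..<u} \<inter> {i. i \<in> T g} = T g" by (auto simp: T_def)
      then show ?thesis by simp
    qed
    finally show ?thesis by simp
  qed
  have inj: "inj_on T ?S"
  proof (rule inj_onI)
    fix g g' assume *: "g \<in> ?S" "g' \<in> ?S" "T g = T g'"
    then have "pos u g = pos u g'" using T by metis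
    then show "g = g'" using * pos_inject by blast
  qed
  have "coef (dn u x * G) (pos u f) = (\<Sum>K\<in>Pow {..<u}. x ^ card K * coef G (pos u f + ind K))"
    by (rule coef_dn_times)
  also have "\<dots> = (\<Sum>K\<in>T ` ?S. x ^ card K * coef G (pos u f + ind K))"
  proof (rule sum.mono_neutral_right)
    show "T ` ?S \<subseteq> Pow {..<u}" by (auto simp: T_def)
    show "\<forall>K\<in>Pow {..<u} - T ` ?S. x ^ card K * coef G (pos u f + ind K) = 0"
    proof (rule ballI, rule ccontr)
      fix K assume K: "K \<in> Pow {..<u} - T ` ?S" and nz: "x ^ card K * coef G (pos u f + ind K) \<noteq> 0"
      define l where "l = pos u f + ind K"
      have nz: "coef G l \<noteq> 0" using nz by (auto simp: l_def)
      have l: "l i = int (i + cnt f (u - i)) + of_bool (i \<in> K)" if "i < u" for i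
        using that by (simp add: l_def pos_def ind_def)
      have ge: "0 \<le> l i" if "i < u" for i
        unfolding l[OF that] by simp
      have mono: "l i < l j" if ij: "i < j" "j < u" for i j
      proof -
        have "l i \<noteq> l j" using alternating_eq_0[OF alt, of i j l] nz ij by auto
        moreover have "l i \<le> l j"
          using pos_strict_mono[OF f ij] ij unfolding l_def by (auto simp: ind_def)
        ultimately show ?thesis by simp
      qed
      have le: "l i \<le> int (i + Suc n)" if "i < u" for i
        using cnt_le[OF f, of "u - i"] that unfolding l[OF that] by simp
      have zero: "l i = 0" if "u \<le> i" for i
        using K that by (auto simp: l_def pos_def ind_def)
      obtain g where g: "g \<in> Par (Suc n) u" "pos u g = l"
        by (rule pos_surj[of u l "Suc n"]) (use mono ge le zero in blast)+
      have cf: "int (cnt g (u - i)) = int (cnt f (u - i)) + of_bool (i \<in> K)" if "i < u" for i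
        using fun_cong[OF g(2), of i] l[OF that] that by (simp add: pos_def)
      have "interlaced f g"
        unfolding interlaced_iff_cnt[OF f g(1)]
      proof (intro allI impI)
        fix j assume "0 < j \<and> j \<le> u"
        then show "cnt f j \<le> cnt g j \<and> cnt g j \<le> Suc (cnt f j)" using cf[of "u - j"]
          by (cases "u - j \<in> K") auto
      qed
      moreover have "K = T g"
        using K cf by (force simp: T_def)
      ultimately show False using K g(1) by blast
    qed
  qed simp
  also have "\<dots> = (\<Sum>g\<in>?S. x ^ card (T g) * coef G (pos u f + ind (T g)))"
    by (simp add: sum.reindex[OF inj])
  also have "\<dots> = (\<Sum>g\<in>?S. x ^ (psize u g - psize u f) * coef G (pos u g))"
    by (intro sum.cong refl) (simp only: card T)
  finally show ?thesis .
qed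

section \<open>Schur and symplectic Schur functions as coefficients\<close>

definition ups :: "nat \<Rightarrow> real list \<Rightarrow> laurent" where
  "ups u xs = prod_list (map (up u) xs)"

definition dns :: "nat \<Rightarrow> real list \<Rightarrow> laurent" where
  "dns u xs = prod_list (map (dn u) xs)"

definition col_schur :: "nat \<Rightarrow> real list \<Rightarrow> (nat \<Rightarrow> nat) \<Rightarrow> real" where
  "col_schur u xs f = coef (ups u xs * vandermonde u) (pos u f)"

text \<open>For \<open>f\<close> with at most \<open>length xs\<close> parts and nonzero variables
  this is the symplectic Schur polynomial of the complement of \<open>f\<close>, times the product
  of the variables to the power \<open>u\<close>; see \<open>symp_fiber_eq_col_symp\<close>.\<close>

definition col_symp :: "nat \<Rightarrow> real list \<Rightarrow> (nat \<Rightarrow> nat) \<Rightarrow> real" where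
  "col_symp u xs f = coef (dns u xs * ups u xs * (littlewood u * vandermonde u)) (pos u f)"

lemma ups_snoc: "ups u (xs @ [x]) = up u x * ups u xs"
  by (simp add: ups_def mult.commute)

lemma dns_snoc: "dns u (xs @ [x]) = dn u x * dns u xs"
  by (simp add: dns_def mult.commute)

lemma symmetric_ups: "symmetric u (ups u xs)"
  by (induction xs) (simp_all add: ups_def symmetric_one symmetric_times symmetric_up)

lemma symmetric_dns: "symmetric u (dns u xs)"
  by (induction xs) (simp_all add: dns_def symmetric_one symmetric_times symmetric_dn)

lemma supported_ups_nonneg: "supported {l. \<forall>i. 0 \<le> l i} (ups u xs * vandermonde u)"
  by (induction xs) (simp_all add: ups_def mult.assoc supported_vand_nonneg supported_up_nonneg)

lemma alternating_ups_vandermonde: "alternating u (coef (ups u xs * vandermonde u))"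
  by (rule alternating_times[OF symmetric_ups alternating_vandermonde])

lemma Par_0: "Par 0 u = {\<lambda>_. 0}"
  by (auto simp: Par_def antimono_def)

lemma col_schur_Nil: "f \<in> Par n u \<Longrightarrow> col_schur u [] f = of_bool (f = (\<lambda>_. 0))"
  by (simp add: col_schur_def ups_def coef_vand_pos)

lemma col_schur_snoc:
  assumes "f \<in> Par n u"
  shows "col_schur u (xs @ [x]) f =
    (\<Sum>g\<in>{g \<in> Par n u. interlaced g f}. x ^ (psize u f - psize u g) * col_schur u xs g)"
  unfolding col_schur_def ups_snoc mult.assoc
proof (rule coef_up_pos[OF alternating_ups_vandermonde assms])
  fix l :: "nat \<Rightarrow> int" and i assume "l i = -1"
  then have "l \<notin> {l. \<forall>i. 0 \<le> l i}" by (metis mem_Collect_eq neg_0_le_iff_le not_one_le_zero)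
  then show "coef (ups u xs * vandermonde u) l = 0"
    by (rule supportedD[OF supported_ups_nonneg])
qed

text \<open>Each variable adds a horizontal strip, hence at most one further row.\<close>

lemma col_schur_eq_0:
  "f \<in> Par n u \<Longrightarrow> f (length xs) \<noteq> 0 \<Longrightarrow> col_schur u xs f = 0"
proof (induction xs arbitrary: f rule: rev_induct)
  case Nil
  then show ?case by (auto simp: col_schur_Nil)
next
  case (snoc x xs)
  have "col_schur u xs g = 0" if "g \<in> Par n u" "interlaced g f" for g
  proof (rule snoc.IH[OF that(1)])
    have "f (Suc (length xs)) \<le> g (length xs)" using that(2) by (simp add: interlaced_def)
    then show "g (length xs) \<noteq> 0" using snoc.prems(2) by simp
  qed
  then show ?case by (simp add: col_schur_snoc[OF snoc.prems(1)])
qed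

lemma Par_iff_zero:
  assumes "m \<le> n" "f \<in> Par n u"
  shows "f \<in> Par m u \<longleftrightarrow> f m = 0"
proof
  assume "f m = 0"
  moreover have "f k \<le> f m" if "m \<le> k" for k
    using assms that by (auto simp: Par_def dest: antimonoD)
  ultimately show "f \<in> Par m u" using assms by (simp add: Par_def)
qed (simp add: Par_def)

lemma Par_Suc_iff: "f \<in> Par n u \<longleftrightarrow> f \<in> Par (Suc n) u \<and> f n = 0"
  using Par_iff_zero[of n "Suc n" f u] Par_mono[of f n u "Suc n"] by auto

text \<open>The factors \<open>1 + x / y\<close> build a partition up from the empty one by the same
  strips by which the factors \<open>1 + x y\<close> take it down. \<open>G\<close> is arbitrary
  because the last factor is absorbed into it before the induction hypothesis applies.\<close>

lemma coef_dns_pos_zero: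
  assumes "alternating u (coef G)"
  shows "coef (dns u xs * G) (pos u (\<lambda>_. 0)) = (\<Sum>f\<in>Par (length xs) u. col_schur u xs f * coef G (pos u f))"
  using assms
proof (induction xs arbitrary: G rule: rev_induct)
  case Nil
  have "(\<lambda>_. 0) \<in> Par 0 u" by (simp add: Par_0)
  from col_schur_Nil[OF this] show ?case by (simp add: Par_0 dns_def)
next
  case (snoc x xs)
  let ?n = "length xs"
  have alt: "alternating u (coef (dn u x * G))"
    by (rule alternating_times[OF symmetric_dn snoc.prems])
  have "coef (dns u (xs @ [x]) * G) (pos u (\<lambda>_. 0)) = coef (dns u xs * (dn u x * G)) (pos u (\<lambda>_. 0))"
    by (simp add: dns_snoc mult_ac)
  also have "\<dots> = (\<Sum>f\<in>Par ?n u. col_schur u xs f * coef (dn u x * G) (pos u f))"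
    by (rule snoc.IH[OF alt])
  also have "\<dots> = (\<Sum>f\<in>Par ?n u. \<Sum>g\<in>Par (Suc ?n) u. of_bool (interlaced f g) *
      (x ^ (psize u g - psize u f) * col_schur u xs f * coef G (pos u g)))"
  proof (intro sum.cong refl)
    fix f assume f: "f \<in> Par ?n u"
    have "col_schur u xs f * coef (dn u x * G) (pos u f) = (\<Sum>g\<in>{g \<in> Par (Suc ?n) u. interlaced f g}.
        x ^ (psize u g - psize u f) * col_schur u xs f * coef G (pos u g))"
      unfolding coef_dn_pos[OF snoc.prems f] sum_distrib_left by (simp only: mult_ac)
    also have "\<dots> = (\<Sum>g\<in>Par (Suc ?n) u. of_bool (interlaced f g) *
        (x ^ (psize u g - psize u f) * col_schur u xs f * coef G (pos u g)))"
      unfolding sum.inter_filter[OF finite_Par] by (intro sum.cong refl) simp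
    finally show "col_schur u xs f * coef (dn u x * G) (pos u f) = (\<Sum>g\<in>Par (Suc ?n) u. of_bool (interlaced f g) *
        (x ^ (psize u g - psize u f) * col_schur u xs f * coef G (pos u g)))" .
  qed
  also have "\<dots> = (\<Sum>g\<in>Par (Suc ?n) u. \<Sum>f\<in>Par ?n u. of_bool (interlaced f g) *
      (x ^ (psize u g - psize u f) * col_schur u xs f * coef G (pos u g)))"
    by (rule sum.swap)
  also have "\<dots> = (\<Sum>g\<in>Par (Suc ?n) u. col_schur u (xs @ [x]) g * coef G (pos u g))"
  proof (intro sum.cong refl)
    fix g assume g: "g \<in> Par (Suc ?n) u"
    have "(\<Sum>f\<in>Par ?n u. of_bool (interlaced f g) *
      (x ^ (psize u g - psize u f) * col_schur u xs f * coef G (pos u g))) =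
      (\<Sum>f\<in>Par (Suc ?n) u. of_bool (interlaced f g) *
      (x ^ (psize u g - psize u f) * col_schur u xs f * coef G (pos u g)))"
    \<comment> \<open>The inner range may be enlarged: \<open>col_schur\<close> vanishes on
      partitions with more parts than variables.\<close>
    proof (rule sum.mono_neutral_left)
      show "\<forall>f\<in>Par (Suc ?n) u - Par ?n u. of_bool (interlaced f g) *
         (x ^ (psize u g - psize u f) * col_schur u xs f * coef G (pos u g)) = 0"
        using col_schur_eq_0[of _ "Suc ?n" u xs] Par_Suc_iff[of _ ?n u] by auto
    qed (auto simp: finite_Par intro: Par_mono)
    also have "\<dots> = col_schur u (xs @ [x]) g * coef G (pos u g)"
      unfolding col_schur_snoc[OF g] sum_distrib_right sum.inter_filter[OF finite_Par]
      by (intro sum.cong refl) simp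
    finally show "(\<Sum>f\<in>Par ?n u. of_bool (interlaced f g) *
      (x ^ (psize u g - psize u f) * col_schur u xs f * coef G (pos u g))) =
      col_schur u (xs @ [x]) g * coef G (pos u g)" .
  qed
  finally show ?case by simp
qed

section \<open>Reflection at the wall and the symplectic branching\<close>

definition neg_coord :: "nat \<Rightarrow> (nat \<Rightarrow> int) \<Rightarrow> nat \<Rightarrow> int" where
  "neg_coord i l = l(i := - l i)"

lemma neg_coord_involution: "additive_involution (neg_coord i)"
  by unfold_locales (auto simp: neg_coord_def fun_eq_iff)

lemmas subst_neg_simps =
  additive_involution.subst_mult[OF neg_coord_involution]
  additive_involution.subst_prod[OF neg_coord_involution]
  additive_involution.subst_add[OF neg_coord_involution]
  additive_involution.subst_diff[OF neg_coord_involution]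
  additive_involution.subst_uminus[OF neg_coord_involution]
  additive_involution.subst_one[OF neg_coord_involution]
  additive_involution.subst_ymon[OF neg_coord_involution]
  additive_involution.subst_single[OF neg_coord_involution]

lemma neg_coord_unitv: "neg_coord i (unitv k) = (if k = i then - unitv k else unitv k)"
  "neg_coord i (- unitv k) = (if k = i then unitv k else - unitv k)"
  by (auto simp: neg_coord_def unitv_def fun_eq_iff)

text \<open>In terms of coefficients: antisymmetry under \<open>l i \<mapsto> - 2 - l i\<close>, the reflection at the wall \<open>-1\<close>.\<close>

definition reflecting :: "nat \<Rightarrow> laurent \<Rightarrow> bool" where
  "reflecting u A \<longleftrightarrow> (\<forall>i<u. ymon (- (unitv i + unitv i)) * subst (neg_coord i) A = - A)"

text \<open>Exponent -1 is fixed by the reflection, so the coefficient there is its own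
  negative.\<close>

lemma reflecting_wall:
  assumes "reflecting u A" "i < u" "l i = -1"
  shows "coef A l = 0"
proof -
  have "neg_coord i (l - - (unitv i + unitv i)) = l"
    using assms(3) by (auto simp: neg_coord_def unitv_def fun_eq_iff)
  then have "coef A l = coef (ymon (- (unitv i + unitv i)) * subst (neg_coord i) A) l"
    by (simp only: coef_ymon_times additive_involution.coef_subst[OF neg_coord_involution])
  also have "\<dots> = - coef A l"
    using assms by (simp add: reflecting_def)
  finally show ?thesis by simp
qed

lemma reflecting_times:
  assumes "reflecting u A" "\<And>i. i < u \<Longrightarrow> subst (neg_coord i) P = P"
  shows "reflecting u (P * A)"
  using assms by (simp add: reflecting_def subst_neg_simps mult.left_commute)

lemma subst_neg_dn_up: "subst (neg_coord i) (dn u x * up u x) = dn u x * up u x"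
proof -
  have "dn u x * up u x = (\<Prod>k<u. (1 + Poly_Mapping.single (- unitv k) x) * (1 + Poly_Mapping.single (unitv k) x))"
    by (simp add: dn_def up_def prod.distrib)
  then show ?thesis
    by (simp add: subst_neg_simps neg_coord_unitv if_distrib[of "\<lambda>v. Poly_Mapping.single v x"] mult.commute
        cong: if_cong) (auto intro!: prod.cong simp: mult.commute)
qed

lemma subst_neg_dns_ups: "subst (neg_coord i) (dns u xs * ups u xs) = dns u xs * ups u xs"
proof (induction xs)
  case (Cons x xs)
  have "dns u (x # xs) * ups u (x # xs) = (dn u x * up u x) * (dns u xs * ups u xs)"
    by (simp add: dns_def ups_def mult_ac)
  then show ?case
    using Cons by (simp only: subst_neg_simps(1)[of i "dn u x * up u x"] subst_neg_dn_up)
qed (simp add: dns_def ups_def subst_neg_simps)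

text \<open>The second product is a Vandermonde product in the quantities \<open>y + 1 / y\<close>,
  so inverting a variable affects only the first product.\<close>

lemma littlewood_vandermonde:
  "littlewood u * vandermonde u = (\<Prod>j<u. 1 - ymon (- (unitv j + unitv j))) *
    (\<Prod>j<u. \<Prod>i<j. (ymon (unitv j) + ymon (- unitv j)) - (ymon (unitv i) + ymon (- unitv i)))"
proof -
  let ?F = "\<lambda>i j. 1 - ymon (- (unitv i + unitv j))"
  have *: "?F i j * (ymon (unitv j) - ymon (unitv i)) =
     (ymon (unitv j) + ymon (- unitv j)) - (ymon (unitv i) + ymon (- unitv i))" for i j
    by (simp add: left_diff_distrib right_diff_distrib ymon_mult algebra_simps)
  have "littlewood u = (\<Prod>j<u. ?F j j) * (\<Prod>j<u. \<Prod>i<j. ?F i j)"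
    unfolding littlewood_def prod.distrib[symmetric]
    by (intro prod.cong refl) (simp add: mult.commute flip: lessThan_Suc_atMost del: minus_add_distrib)
  then show ?thesis
    by (simp only: vandermonde_def mult.assoc flip: prod.distrib *)
qed

lemma reflecting_littlewood_vandermonde: "reflecting u (littlewood u * vandermonde u)"
  unfolding reflecting_def
proof (intro allI impI)
  fix i assume i: "i < u"
  let ?T = "\<lambda>k. ymon (unitv k) + ymon (- unitv k)"
  let ?R = "\<Prod>j\<in>{..<u} - {i}. 1 - ymon (- (unitv j + unitv j))"
  let ?V = "\<Prod>j<u. \<Prod>i<j. ?T j - ?T i"
  have T: "subst (neg_coord i) (?T k) = ?T k" for k
    by (simp add: subst_neg_simps neg_coord_unitv add.commute)
  have V: "subst (neg_coord i) ?V = ?V"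
    by (simp only: subst_neg_simps(2,4) T)
  have nn: "neg_coord i (- (unitv j + unitv j)) = (if j = i then unitv j + unitv j else - (unitv j + unitv j))" for j
    by (auto simp: neg_coord_def unitv_def fun_eq_iff)
  have R: "subst (neg_coord i) ?R = ?R"
    unfolding subst_neg_simps nn by (intro prod.cong refl) auto
  have eq: "littlewood u * vandermonde u = (1 - ymon (- (unitv i + unitv i))) * ?R * ?V"
    unfolding littlewood_vandermonde using i
    by (subst prod.remove[of "{..<u}" i "\<lambda>j. 1 - ymon (- (unitv j + unitv j))"]) auto
  have "ymon (- (unitv i + unitv i)) * subst (neg_coord i) (1 - ymon (- (unitv i + unitv i))) =
      - (1 - ymon (- (unitv i + unitv i)))"
    by (simp only: subst_neg_simps nn if_True simp_thms right_diff_distrib ymon_mult left_minus ymon_zero mult_1_right minus_diff_eq)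
  then show "ymon (- (unitv i + unitv i)) * subst (neg_coord i) (littlewood u * vandermonde u) = - (littlewood u * vandermonde u)"
    unfolding eq by (simp only: subst_neg_simps(1)[of i "_ * _"] subst_neg_simps(1)[of i "1 - _"] R V
        mult.assoc[symmetric] mult_minus_left)
qed

lemma reflecting_symp: "reflecting u (dns u xs * ups u xs * (littlewood u * vandermonde u))"
  by (rule reflecting_times[OF reflecting_littlewood_vandermonde]) (rule subst_neg_dns_ups)

lemma alternating_symp: "alternating u (coef (dns u xs * ups u xs * (littlewood u * vandermonde u)))"
  by (intro alternating_times symmetric_times symmetric_ups symmetric_dns symmetric_littlewood alternating_vandermonde)

lemma col_symp_Nil: "f \<in> Par n u \<Longrightarrow> col_symp u [] f = of_bool (f = (\<lambda>_. 0))"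
  by (simp add: col_symp_def ups_def dns_def coef_littlewood_vand_pos coef_vand_pos)

text \<open>The two factors of one variable act in turn: a strip is added to \<open>t\<close>,
  giving \<open>k\<close>, and a strip is removed from \<open>k\<close>, giving \<open>v\<close>.
  These are the two rows which one variable occupies in a symplectic pattern.\<close>

lemma col_symp_snoc_aux:
  assumes t: "t \<in> Par n u"
  shows "col_symp u (xs @ [x]) t =
    (\<Sum>k\<in>{k \<in> Par (Suc n) u. interlaced t k}. \<Sum>v\<in>{v \<in> Par (Suc n) u. interlaced v k}.
       x ^ (psize u k - psize u t) * x ^ (psize u k - psize u v) * col_symp u xs v)"
proof -
  let ?G = "dns u xs * ups u xs * (littlewood u * vandermonde u)"
  have "col_symp u (xs @ [x]) t = coef (dn u x * (up u x * ?G)) (pos u t)"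
    unfolding col_symp_def ups_snoc dns_snoc by (simp add: mult_ac)
  also have "\<dots> = (\<Sum>k\<in>{k \<in> Par (Suc n) u. interlaced t k}. x ^ (psize u k - psize u t) * coef (up u x * ?G) (pos u k))"
    by (rule coef_dn_pos[OF _ t]) (intro alternating_times symmetric_up alternating_symp symmetric_times symmetric_ups symmetric_dns symmetric_littlewood alternating_vandermonde)
  also have "\<dots> = (\<Sum>k\<in>{k \<in> Par (Suc n) u. interlaced t k}. \<Sum>v\<in>{v \<in> Par (Suc n) u. interlaced v k}.
       x ^ (psize u k - psize u t) * x ^ (psize u k - psize u v) * col_symp u xs v)"
  proof (intro sum.cong refl)
    fix k assume "k \<in> {k \<in> Par (Suc n) u. interlaced t k}"
    then have k: "k \<in> Par (Suc n) u" by simp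
    have "coef (up u x * ?G) (pos u k) = (\<Sum>v\<in>{v \<in> Par (Suc n) u. interlaced v k}.
       x ^ (psize u k - psize u v) * col_symp u xs v)"
      unfolding col_symp_def
      by (rule coef_up_pos[OF alternating_symp k]) (rule reflecting_wall[OF reflecting_symp])
    then show "x ^ (psize u k - psize u t) * coef (up u x * ?G) (pos u k) =
      (\<Sum>v\<in>{v \<in> Par (Suc n) u. interlaced v k}.
       x ^ (psize u k - psize u t) * x ^ (psize u k - psize u v) * col_symp u xs v)"
      by (simp add: sum_distrib_left mult.assoc)
  qed
  finally show ?thesis .
qed

lemma col_symp_eq_0:
  "t \<in> Par n u \<Longrightarrow> t (length xs) \<noteq> 0 \<Longrightarrow> col_symp u xs t = 0"
proof (induction xs arbitrary: n t rule: rev_induct)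
  case Nil
  then show ?case by (auto simp: col_symp_Nil)
next
  case (snoc x xs)
  have "col_symp u xs v = 0" if "v \<in> Par (Suc n) u" "interlaced v k" "interlaced t k" for v k
  proof (rule snoc.IH[OF that(1)])
    have "t (Suc (length xs)) \<le> k (Suc (length xs))" "k (Suc (length xs)) \<le> v (length xs)"
      using that by (simp_all add: interlaced_def)
    then show "v (length xs) \<noteq> 0" using snoc.prems(2) by simp
  qed
  then show ?case unfolding col_symp_snoc_aux[OF snoc.prems(1)] by (auto intro!: sum.neutral)
qed

text \<open>Cuts the ranges down to the row lengths of a symplectic pattern. Partitions
  \<open>v\<close> with more than \<open>n\<close> parts have coefficient zero, and a
  \<open>v\<close> with at most \<open>n\<close> parts can interlace only with a \<open>k\<close>
  that has at most \<open>n + 1\<close>.\<close>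

lemma col_symp_snoc:
  assumes t: "t \<in> Par (Suc n) u" and n: "length xs = n"
  shows "col_symp u (xs @ [x]) t =
    (\<Sum>k\<in>{k \<in> Par (Suc n) u. interlaced t k}. \<Sum>v\<in>{v \<in> Par n u. interlaced v k}.
       x ^ (psize u k - psize u t) * x ^ (psize u k - psize u v) * col_symp u xs v)"
proof -
  let ?N = "Suc (Suc n)"
  let ?h = "\<lambda>k v. x ^ (psize u k - psize u t) * x ^ (psize u k - psize u v) * col_symp u xs v"
  have "col_symp u (xs @ [x]) t = (\<Sum>k\<in>{k \<in> Par ?N u. interlaced t k}. \<Sum>v\<in>{v \<in> Par ?N u. interlaced v k}. ?h k v)"
    by (rule col_symp_snoc_aux[OF t])
  also have "\<dots> = (\<Sum>k\<in>{k \<in> Par ?N u. interlaced t k}. \<Sum>v\<in>{v \<in> Par n u. interlaced v k}. ?h k v)"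
  proof (rule sum.cong[OF refl])
    fix k
    show "(\<Sum>v\<in>{v \<in> Par ?N u. interlaced v k}. ?h k v) = (\<Sum>v\<in>{v \<in> Par n u. interlaced v k}. ?h k v)"
    proof (rule sum.mono_neutral_right)
      show "\<forall>v\<in>{v \<in> Par ?N u. interlaced v k} - {v \<in> Par n u. interlaced v k}. ?h k v = 0"
        using col_symp_eq_0[of _ ?N u xs] Par_iff_zero[of n ?N _ u] n by auto
    qed (auto simp: finite_Par intro: Par_mono)
  qed
  also have "\<dots> = (\<Sum>k\<in>{k \<in> Par (Suc n) u. interlaced t k}. \<Sum>v\<in>{v \<in> Par n u. interlaced v k}. ?h k v)"
  proof (rule sum.mono_neutral_right)
    show "\<forall>k\<in>{k \<in> Par ?N u. interlaced t k} - {k \<in> Par (Suc n) u. interlaced t k}.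
        (\<Sum>v\<in>{v \<in> Par n u. interlaced v k}. ?h k v) = 0"
    proof
      fix k assume k: "k \<in> {k \<in> Par ?N u. interlaced t k} - {k \<in> Par (Suc n) u. interlaced t k}"
      then have "k (Suc n) \<noteq> 0" using Par_Suc_iff[of k "Suc n" u] by auto
      moreover have "k (Suc n) = 0" if "v \<in> Par n u" "interlaced v k" for v
      proof -
        have "k (Suc n) \<le> v n" using that(2) by (simp add: interlaced_def)
        moreover have "v n = 0" using that(1) by (simp add: Par_def)
        ultimately show ?thesis by simp
      qed
      ultimately have "{v \<in> Par n u. interlaced v k} = {}" by auto
      then show "(\<Sum>v\<in>{v \<in> Par n u. interlaced v k}. ?h k v) = 0" by (simp only: sum.empty)
    qed
  qed (auto simp: finite_Par intro: Par_mono)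
  finally show ?thesis .
qed

section \<open>Evaluation of the sums over partitions\<close>

text \<open>The sum over all \<open>0 \<le> l 0 < \<dots> < l (m - 1) < a\<close>, in which every coordinate of the wrong parity carries
  a factor \<open>\<alpha>\<close>.\<close>

primrec weighted_sum :: "real \<Rightarrow> nat \<Rightarrow> nat \<Rightarrow> ((nat \<Rightarrow> int) \<Rightarrow> real) \<Rightarrow> (nat \<Rightarrow> int) \<Rightarrow> real" where
  "weighted_sum \<alpha> 0 a g r = g r"
| "weighted_sum \<alpha> (Suc m) a g r = (\<Sum>b<a. (if odd (b + m) then \<alpha> else 1) * weighted_sum \<alpha> m b g (r(m := int b)))"

lemma weighted_sum_eq_0:
  assumes "\<And>l. (\<And>i. m \<le> i \<Longrightarrow> l i = r i) \<Longrightarrow> g l = 0"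
  shows "weighted_sum \<alpha> m a g r = 0"
  using assms
proof (induction m arbitrary: a r)
  case (Suc m)
  have "weighted_sum \<alpha> m b g (r(m := int b)) = 0" for b
    by (rule Suc.IH) (rule Suc.prems, force)
  then show ?case by simp
qed simp

lemma parity_sum_translate: "(\<And>i. i < m \<Longrightarrow> v i = 0) \<Longrightarrow> parity_sum c m a (\<lambda>l. h (l - v)) r = parity_sum c m a h (r - v)"
proof (induction m arbitrary: a r)
  case (Suc m)
  have "r(m := int b) - v = (r - v)(m := int b)" for b
    using Suc.prems by (auto simp: fun_eq_iff)
  moreover have "parity_sum c m b (\<lambda>l. h (l - v)) s = parity_sum c m b h (s - v)" for b s
    by (rule Suc.IH) (use Suc.prems in auto)
  ultimately show ?case by (simp del: fun_upd_apply minus_apply)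
qed simp

lemma parity_sum_add: "parity_sum c m a (\<lambda>l. g l + x * h l) r = parity_sum c m a g r + x * parity_sum c m a h r"
  by (induction m arbitrary: a r)
     (simp_all add: distrib_left sum.distrib sum_distrib_left mult_ac del: fun_upd_apply sum_mult_of_bool_eq sum_of_bool_mult_eq)

text \<open>Each \<open>b\<close> of the wrong parity lies one below a value of the right parity.
  Since \<open>a - 1\<close> has the right parity when \<open>a > 0\<close>, that value is still
  below \<open>a\<close>.\<close>

lemma sum_parity_shift:
  fixes X :: "nat \<Rightarrow> real"
  assumes "odd (a + m)"
  shows "(\<Sum>b<a. of_bool (even (b + m)) * (X b + \<alpha> * (if b = 0 then 0 else X (b - 1)))) =
    (\<Sum>b<a. (if odd (b + m) then \<alpha> else 1) * X b)"
proof -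
  have "(\<Sum>b<a. (if odd (b + m) then \<alpha> else 1) * X b) =
    (\<Sum>b<a. of_bool (even (b + m)) * (X b + \<alpha> * (if b = 0 then 0 else X (b - 1)))) +
    (if even (a + m) \<and> 0 < a then \<alpha> * X (a - 1) else 0)"
    by (induction a) auto
  then show ?thesis using assms by simp
qed

text \<open>The factor \<open>1 + \<alpha> y\<close> lets a coordinate of the right parity draw on
  its own value or on the one below it, which has the wrong parity and receives the factor
  \<open>\<alpha>\<close>. Drawing on -1 gives zero by the assumption on \<open>G\<close>.\<close>

lemma parity_sum_up:
  assumes "alternating u (coef G)" "\<And>l i. i < u \<Longrightarrow> l i = -1 \<Longrightarrow> coef G l = 0"
    "m \<le> u" "even (a + m)"
  shows "parity_sum 0 m a (coef (up m \<alpha> * G)) r = weighted_sum \<alpha> m a (coef G) r"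
  using assms(3,4)
proof (induction m arbitrary: a r)
  case 0
  then show ?case by (simp add: up_def)
next
  case (Suc m)
  let ?X = "\<lambda>b. weighted_sum \<alpha> m b (coef G) (r(m := int b))"
  have eq: "coef (up (Suc m) \<alpha> * G) = (\<lambda>l. coef (up m \<alpha> * G) l + \<alpha> * coef (up m \<alpha> * G) (l - unitv m))"
  proof -
    have "up (Suc m) \<alpha> * G = (1 + Poly_Mapping.single (unitv m) \<alpha>) * (up m \<alpha> * G)"
      by (simp add: up_def mult_ac)
    then show ?thesis by (simp only: coef_one_plus_single_times fun_eq_iff simp_thms)
  qed
  have step: "of_bool (even (b + m)) * parity_sum 0 m b (coef (up (Suc m) \<alpha> * G)) (r(m := int b)) =
     of_bool (even (b + m)) * (?X b + \<alpha> * (if b = 0 then 0 else ?X (b - 1)))" for b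
  proof (cases "even (b + m)")
    case True
    have IH: "parity_sum 0 m b (coef (up m \<alpha> * G)) s = weighted_sum \<alpha> m b (coef G) s" for s
      using Suc True by simp
    have "parity_sum 0 m b (coef (up (Suc m) \<alpha> * G)) (r(m := int b)) = ?X b + \<alpha> * weighted_sum \<alpha> m b (coef G) (r(m := int b) - unitv m)"
      unfolding eq parity_sum_add IH by (subst parity_sum_translate) (simp_all add: unitv_def IH del: fun_upd_apply minus_apply)
    also have "weighted_sum \<alpha> m b (coef G) (r(m := int b) - unitv m) = (if b = 0 then 0 else ?X (b - 1))"
    proof (cases b)
      case 0
      have "weighted_sum \<alpha> m b (coef G) (r(m := int b) - unitv m) = 0"
      proof (rule weighted_sum_eq_0)
        fix l assume "\<And>i. m \<le> i \<Longrightarrow> l i = (r(m := int b) - unitv m) i"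
        from this[of m] have "l m = -1" by (simp add: 0 unitv_def)
        then show "coef G l = 0" using assms(2)[of m l] Suc.prems by simp
      qed
      then show ?thesis using 0 by simp
    next
      case (Suc c)
      have r: "r(m := int b) - unitv m = r(m := int c)"
        by (auto simp: Suc unitv_def fun_eq_iff)
      \<comment> \<open>Once coordinate \<open>m\<close> has been lowered to \<open>c\<close>, the
        coordinates below it may still reach \<open>c\<close>; that extra term is a collision and
        vanishes.\<close>
      have "weighted_sum \<alpha> m (Suc c) (coef G) (r(m := int c)) = weighted_sum \<alpha> m c (coef G) (r(m := int c))"
      proof (cases m)
        case (Suc k)
        have "weighted_sum \<alpha> k c (coef G) (r(m := int c, k := int c)) = 0"
        proof (rule weighted_sum_eq_0)
          fix l assume l: "\<And>i. k \<le> i \<Longrightarrow> l i = (r(m := int c, k := int c)) i"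
          show "coef G l = 0"
            by (rule alternating_eq_0[OF assms(1), of k m]) (use l[of k] l[of m] Suc.prems(1) Suc \<open>Suc m \<le> u\<close> in auto)
        qed
        then show ?thesis by (simp add: Suc del: fun_upd_apply)
      qed simp
      then show ?thesis unfolding r by (simp add: Suc del: fun_upd_apply)
    qed
    finally show ?thesis by (simp only:)
  qed simp
  have "parity_sum 0 (Suc m) a (coef (up (Suc m) \<alpha> * G)) r =
    (\<Sum>b<a. of_bool (even (b + m)) * (?X b + \<alpha> * (if b = 0 then 0 else ?X (b - 1))))"
    unfolding parity_sum.simps add_0_right by (intro sum.cong refl step)
  also have "\<dots> = weighted_sum \<alpha> (Suc m) a (coef G) r"
    unfolding weighted_sum.simps by (rule sum_parity_shift) (use Suc.prems in simp)
  finally show ?case .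
qed

section \<open>Nested sums as sums over partitions\<close>

definition incr_seqs :: "nat \<Rightarrow> nat \<Rightarrow> (nat \<Rightarrow> int) \<Rightarrow> (nat \<Rightarrow> int) set" where
  "incr_seqs m a r = {l. (\<forall>i\<ge>m. l i = r i) \<and> (\<forall>i<m. 0 \<le> l i \<and> l i < int a) \<and> (\<forall>i j. i < j \<and> j < m \<longrightarrow> l i < l j)}"

lemma incr_seqsD:
  assumes "l \<in> incr_seqs m a r"
  shows "m \<le> i \<Longrightarrow> l i = r i" "i < m \<Longrightarrow> 0 \<le> l i" "i < m \<Longrightarrow> l i < int a"
    "i < j \<Longrightarrow> j < m \<Longrightarrow> l i < l j"
  using assms by (simp_all add: incr_seqs_def)

lemma incr_seqsI:
  assumes "\<And>i. m \<le> i \<Longrightarrow> l i = r i" "\<And>i. i < m \<Longrightarrow> 0 \<le> l i" "\<And>i. i < m \<Longrightarrow> l i < int a"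
    "\<And>i j. i < j \<Longrightarrow> j < m \<Longrightarrow> l i < l j"
  shows "l \<in> incr_seqs m a r"
  using assms by (simp add: incr_seqs_def)

lemma incr_seqs_Suc: "incr_seqs (Suc m) a r = (\<Union>b<a. incr_seqs m b (r(m := int b)))"
proof (intro equalityI subsetI)
  fix l assume l: "l \<in> incr_seqs (Suc m) a r"
  note D = incr_seqsD[OF l]
  have m: "0 \<le> l m" "l m < int a" using D by auto
  then have b: "nat (l m) < a" "int (nat (l m)) = l m" by auto
  have "l \<in> incr_seqs m (nat (l m)) (r(m := int (nat (l m))))"
  proof (rule incr_seqsI)
    fix i assume "m \<le> i"
    then show "l i = (r(m := int (nat (l m)))) i" using D(1)[of i] b by (cases "i = m") auto
  next
    fix i assume "i < m"
    then show "0 \<le> l i" "l i < int (nat (l m))" using D(2)[of i] D(4)[of i m] b by auto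
  next
    fix i j assume "i < j" "j < m"
    then show "l i < l j" using D(4) by simp
  qed
  then show "l \<in> (\<Union>b<a. incr_seqs m b (r(m := int b)))" using b by blast
next
  fix l assume "l \<in> (\<Union>b<a. incr_seqs m b (r(m := int b)))"
  then obtain b where b: "b < a" and l: "l \<in> incr_seqs m b (r(m := int b))" by blast
  note D = incr_seqsD[OF l]
  have lm: "l m = int b" using D(1)[of m] by simp
  show "l \<in> incr_seqs (Suc m) a r"
  proof (rule incr_seqsI)
    fix i assume "Suc m \<le> i"
    then show "l i = r i" using D(1)[of i] by simp
  next
    fix i assume "i < Suc m"
    then consider "i < m" | "i = m" by linarith
    then show "0 \<le> l i" using D(2)[of i] lm by cases auto
    consider "i < m" | "i = m" using \<open>i < Suc m\<close> by linarith
    then show "l i < int a" using D(3)[of i] lm b by cases auto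
  next
    fix i j assume ij: "i < j" "j < Suc m"
    then consider "j < m" | "j = m" by linarith
    then show "l i < l j" using D(3)[of i] D(4)[of i j] lm ij by cases auto
  qed
qed

lemma finite_incr_seqs: "finite (incr_seqs m a r)"
proof (induction m arbitrary: a r)
  case 0
  have "incr_seqs 0 a r = {r}" by (auto simp: incr_seqs_def)
  then show ?case by simp
qed (simp add: incr_seqs_Suc)

lemma weighted_sum_eq_sum:
  "weighted_sum \<alpha> m a g r = (\<Sum>l\<in>incr_seqs m a r. \<alpha> ^ card {i \<in> {..<m}. odd (l i + int i)} * g l)"
proof (induction m arbitrary: a r)
  case 0
  have "incr_seqs 0 a r = {r}" by (auto simp: incr_seqs_def)
  then show ?case by simp
next
  case (Suc m)
  have "(\<Sum>l\<in>incr_seqs (Suc m) a r. \<alpha> ^ card {i \<in> {..<Suc m}. odd (l i + int i)} * g l) =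
    (\<Sum>b<a. \<Sum>l\<in>incr_seqs m b (r(m := int b)). \<alpha> ^ card {i \<in> {..<Suc m}. odd (l i + int i)} * g l)"
    unfolding incr_seqs_Suc
  proof (rule sum.UNION_disjoint)
    show "\<forall>b\<in>{..<a}. \<forall>b'\<in>{..<a}. b \<noteq> b' \<longrightarrow>
        incr_seqs m b (r(m := int b)) \<inter> incr_seqs m b' (r(m := int b')) = {}"
    proof (intro ballI impI equals0I)
      fix b b' l assume "b \<noteq> b'" "l \<in> incr_seqs m b (r(m := int b)) \<inter> incr_seqs m b' (r(m := int b'))"
      then have "l m = int b" "l m = int b'" using incr_seqsD(1)[of l m _ _ m] by fastforce+
      then show False using \<open>b \<noteq> b'\<close> by simp
    qed
  qed (auto simp: finite_incr_seqs)
  also have "\<dots> = weighted_sum \<alpha> (Suc m) a g r"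
    unfolding weighted_sum.simps Suc sum_distrib_left
  proof (intro sum.cong refl)
    fix b l assume l: "l \<in> incr_seqs m b (r(m := int b))"
    have lm: "l m = int b" using incr_seqsD(1)[OF l, of m] by simp
    have "{i \<in> {..<Suc m}. odd (l i + int i)} =
       (if odd (b + m) then insert m {i \<in> {..<m}. odd (l i + int i)} else {i \<in> {..<m}. odd (l i + int i)})"
      using lm by (auto simp: less_Suc_eq)
    then have "card {i \<in> {..<Suc m}. odd (l i + int i)} =
       of_bool (odd (b + m)) + card {i \<in> {..<m}. odd (l i + int i)}"
      by simp
    then show "\<alpha> ^ card {i \<in> {..<Suc m}. odd (l i + int i)} * g l =
       (if odd (b + m) then \<alpha> else 1) * (\<alpha> ^ card {i \<in> {..<m}. odd (l i + int i)} * g l)"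
      by simp
  qed
  finally show ?case by simp
qed

lemma eventually_bounded_above: "\<exists>N. \<forall>a\<ge>N. bounded_above m (int a) A"
proof -
  define N where "N = Suc (\<Sum>l\<in>Poly_Mapping.keys A. \<Sum>i<m. nat \<bar>l i\<bar>)"
  have "bounded_above m (int a) A" if "N \<le> a" for a
    unfolding bounded_above_def
  proof (intro allI impI, rule ccontr)
    fix l assume "\<exists>i<m. int a \<le> l i" and nz: "coef A l \<noteq> 0"
    then obtain i where i: "i < m" "int a \<le> l i" by blast
    have "nat \<bar>l i\<bar> \<le> (\<Sum>i<m. nat \<bar>l i\<bar>)"
      by (rule member_le_sum) (use i in auto)
    also have "\<dots> \<le> (\<Sum>l\<in>Poly_Mapping.keys A. \<Sum>i<m. nat \<bar>l i\<bar>)"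
      by (rule member_le_sum) (use nz in \<open>auto simp: in_keys_iff\<close>)
    finally have "nat \<bar>l i\<bar> < a" using that by (simp add: N_def)
    with i show False by simp
  qed
  then show ?thesis by blast
qed

text \<open>Littlewood's identity is applied to the product with the plain Vandermonde factor.
  Multiplication by \<open>littlewood u\<close> turns that factor into the type C denominator, so
  the coefficients become \<open>col_symp\<close>, while \<open>up u \<alpha>\<close> converts the
  parity restriction into weights.\<close>

theorem sum_col_symp:
  assumes "length xs = n"
  shows "(\<Sum>t\<in>Par n u. \<alpha> ^ card {i \<in> {..<u}. odd (cnt t (u - i))} * col_symp u xs t) =
    coef (up u \<alpha> * (dns u xs * ups u xs * vandermonde u)) (pos u (\<lambda>_. 0))"
proof -
  let ?A = "up u \<alpha> * (dns u xs * ups u xs * vandermonde u)"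
  let ?G = "dns u xs * ups u xs * (littlewood u * vandermonde u)"
  obtain N where N: "\<And>a. N \<le> a \<Longrightarrow> bounded_above u (int a) ?A"
    using eventually_bounded_above by blast
  \<comment> \<open>Beyond the exponent bound \<open>N\<close>, beyond the positions of all
    partitions with at most \<open>n\<close> parts, and congruent to \<open>u\<close> modulo 2, as
    \<open>parity_sum_up\<close> demands.\<close>
  define a where "a = 2 * (N + n) + u"
  have altA: "alternating u (coef ?A)"
    by (intro alternating_times symmetric_times symmetric_up symmetric_ups symmetric_dns alternating_vandermonde)
  have G: "littlewood u * ?A = up u \<alpha> * ?G" by (simp add: mult_ac)
  have "coef ?A (pos u (\<lambda>_. 0)) = coef ?A (staircase u 0)" by (simp only: pos_zero)
  also have "\<dots> = parity_sum 0 u a (coef (littlewood u * ?A)) 0"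
    by (rule parity_sum_littlewood[symmetric, OF altA N]) (simp add: a_def)
  also have "\<dots> = weighted_sum \<alpha> u a (coef ?G) 0"
    unfolding G by (rule parity_sum_up[OF alternating_symp reflecting_wall[OF reflecting_symp]]) (simp_all add: a_def)
  also have "\<dots> = (\<Sum>l\<in>incr_seqs u a 0. \<alpha> ^ card {i \<in> {..<u}. odd (l i + int i)} * coef ?G l)"
    by (rule weighted_sum_eq_sum)
  also have "\<dots> = (\<Sum>l\<in>pos u ` Par n u. \<alpha> ^ card {i \<in> {..<u}. odd (l i + int i)} * coef ?G l)"
  proof (rule sum.mono_neutral_right)
    show "finite (incr_seqs u a 0)" by (rule finite_incr_seqs)
    show "pos u ` Par n u \<subseteq> incr_seqs u a 0"
    proof
      fix l assume "l \<in> pos u ` Par n u"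
      then obtain t where t: "t \<in> Par n u" "l = pos u t" by blast
      have 1: "pos u t i < int a" if "i < u" for i
        using cnt_le[OF t(1), of "u - i"] that by (simp add: pos_def a_def)
      show "l \<in> incr_seqs u a 0"
        unfolding t(2) by (rule incr_seqsI) (use 1 pos_strict_mono[OF t(1)] in \<open>simp_all add: pos_def\<close>)
    qed
    show "\<forall>l\<in>incr_seqs u a 0 - pos u ` Par n u. \<alpha> ^ card {i \<in> {..<u}. odd (l i + int i)} * coef ?G l = 0"
    proof
      fix l assume l: "l \<in> incr_seqs u a 0 - pos u ` Par n u"
      from l have inc: "l \<in> incr_seqs u a 0" by blast
      obtain t where t: "t \<in> Par a u" "pos u t = l"
      proof (rule pos_surj[of u l a])
        show "l i < l j" if "i < j" "j < u" for i j
          using incr_seqsD[OF inc] that by simp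
        show "0 \<le> l i" if "i < u" for i
          using incr_seqsD[OF inc] that by simp
        show "l i \<le> int (i + a)" if "i < u" for i
        proof -
          have "l i < int a" using incr_seqsD[OF inc] that by simp
          then show ?thesis by simp
        qed
        show "l i = 0" if "u \<le> i" for i
          using incr_seqsD[OF inc] that by simp
      qed
      then have "t \<notin> Par n u" using l by auto
      then have "t n \<noteq> 0" using Par_iff_zero[of n a t u] t(1) by (simp add: a_def)
      then have "coef ?G l = 0"
        using col_symp_eq_0[OF t(1), of xs] assms t(2) by (simp add: col_symp_def)
      then show "\<alpha> ^ card {i \<in> {..<u}. odd (l i + int i)} * coef ?G l = 0" by simp
    qed
  qed
  also have "\<dots> = (\<Sum>t\<in>Par n u. \<alpha> ^ card {i \<in> {..<u}. odd (pos u t i + int i)} * coef ?G (pos u t))"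
  proof -
    have "inj_on (pos u) (Par n u)" using pos_inject by (blast intro: inj_onI)
    then show ?thesis by (simp add: sum.reindex)
  qed
  also have "\<dots> = (\<Sum>t\<in>Par n u. \<alpha> ^ card {i \<in> {..<u}. odd (cnt t (u - i))} * col_symp u xs t)"
  proof (intro sum.cong refl)
    fix t
    have "{i \<in> {..<u}. odd (pos u t i + int i)} = {i \<in> {..<u}. odd (cnt t (u - i))}"
      by (auto simp: pos_def)
    then show "\<alpha> ^ card {i \<in> {..<u}. odd (pos u t i + int i)} * coef ?G (pos u t) =
       \<alpha> ^ card {i \<in> {..<u}. odd (cnt t (u - i))} * col_symp u xs t"
      by (simp only: col_symp_def)
  qed
  finally show ?thesis by (rule sym)
qed

theorem sum_col_schur:
  assumes "length xs = n"
  shows "(\<Sum>t\<in>Par n u. col_schur u xs t * col_schur u (xs @ [\<alpha>]) t) =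
    coef (up u \<alpha> * (dns u xs * ups u xs * vandermonde u)) (pos u (\<lambda>_. 0))"
proof -
  have "coef (dns u xs * (ups u (xs @ [\<alpha>]) * vandermonde u)) (pos u (\<lambda>_. 0)) =
     (\<Sum>t\<in>Par n u. col_schur u xs t * col_schur u (xs @ [\<alpha>]) t)"
    using coef_dns_pos_zero[of u "ups u (xs @ [\<alpha>]) * vandermonde u" xs] assms
    by (simp add: alternating_ups_vandermonde col_schur_def)
  then show ?thesis by (simp add: ups_snoc mult_ac)
qed

definition rect :: "nat \<Rightarrow> nat \<Rightarrow> nat \<Rightarrow> nat" where
  "rect n u = (\<lambda>k. if k < n then u else 0)"

lemma single_prod: "(\<Prod>i\<in>I. Poly_Mapping.single (v i) (c i)) = Poly_Mapping.single (\<Sum>i\<in>I. v i) (\<Prod>i\<in>I. c i :: real)"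
  by (induction I rule: infinite_finite_induct) (simp_all add: mult_single)

lemma sum_unitv: "(\<Sum>i<u. unitv i) = raise u"
  by (induction u) (auto simp: unitv_def raise_def fun_eq_iff)

text \<open>Since \<open>1 + y / x = (y / x) (1 + x / y)\<close>, the inverted variables supply the
  factors \<open>dn\<close> up to a constant and a monomial raising every position by
  \<open>n\<close>. All columns of the rectangle have length \<open>n\<close>, so this shift carries
  it to the empty partition.\<close>

theorem col_schur_rect:
  assumes "length xs = n" "\<And>x. x \<in> set xs \<Longrightarrow> x \<noteq> 0"
  shows "prod_list xs ^ u * col_schur u (map inverse xs @ xs @ [\<alpha>]) (rect n u) =
    coef (up u \<alpha> * (dns u xs * ups u xs * vandermonde u)) (pos u (\<lambda>_. 0))"
proof -
  have inv: "Poly_Mapping.single 0 (x ^ u) * up u (inverse x) = ymon (raise u) * dn u x" if "x \<noteq> 0" for x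
  proof -
    have "Poly_Mapping.single 0 (x ^ u) * up u (inverse x) = (\<Prod>i<u. Poly_Mapping.single 0 x * (1 + Poly_Mapping.single (unitv i) (inverse x)))"
      unfolding prod.distrib up_def single_prod by simp
    also have "\<dots> = (\<Prod>i<u. Poly_Mapping.single (unitv i) 1 * (1 + Poly_Mapping.single (- unitv i) x))"
      using that by (intro prod.cong refl) (simp add: distrib_left mult_single add.commute)
    also have "\<dots> = ymon (raise u) * dn u x"
      unfolding prod.distrib dn_def single_prod sum_unitv ymon_def by simp
    finally show ?thesis .
  qed
  have main: "Poly_Mapping.single 0 (prod_list xs ^ u) * ups u (map inverse xs) = ymon (\<lambda>i. int n * raise u i) * dns u xs"
    using assms
  proof (induction xs arbitrary: n)
    case Nil
    then show ?case by (simp add: ups_def dns_def ymon_def flip: zero_fun_def)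
  next
    case (Cons x xs)
    have IH: "Poly_Mapping.single 0 (prod_list xs ^ u) * ups u (map inverse xs) = ymon (\<lambda>i. int (length xs) * raise u i) * dns u xs"
      by (rule Cons.IH[OF refl]) (use Cons.prems in auto)
    have "Poly_Mapping.single 0 (prod_list (x # xs) ^ u) * ups u (map inverse (x # xs)) =
      (Poly_Mapping.single 0 (x ^ u) * up u (inverse x)) * (Poly_Mapping.single 0 (prod_list xs ^ u) * ups u (map inverse xs))"
    proof -
      have "Poly_Mapping.single 0 (prod_list (x # xs) ^ u) =
         (Poly_Mapping.single 0 (x ^ u) * Poly_Mapping.single 0 (prod_list xs ^ u) :: laurent)"
        by (simp add: mult_single power_mult_distrib)
      then show ?thesis by (simp add: ups_def mult_ac)
    qed
    also have "\<dots> = (ymon (raise u) * dn u x) * (ymon (\<lambda>i. int (length xs) * raise u i) * dns u xs)"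
    proof -
      have "x \<noteq> 0" using Cons.prems(2) by simp
      from inv[OF this] show ?thesis by (simp only: IH)
    qed
    also have "\<dots> = (ymon (raise u) * ymon (\<lambda>i. int (length xs) * raise u i)) * dns u (x # xs)"
      by (simp add: dns_def mult_ac)
    also have "ymon (raise u) * ymon (\<lambda>i. int (length xs) * raise u i) = ymon (\<lambda>i. int n * raise u i)"
    proof -
      have "raise u + (\<lambda>i. int (length xs) * raise u i) = (\<lambda>i. int n * raise u i)"
        using Cons.prems(1) by (auto simp: fun_eq_iff algebra_simps)
      then show ?thesis by (simp only: ymon_mult)
    qed
    finally show ?case .
  qed
  have "prod_list xs ^ u * col_schur u (map inverse xs @ xs @ [\<alpha>]) (rect n u) =
     coef (Poly_Mapping.single 0 (prod_list xs ^ u) * (ups u (map inverse xs @ xs @ [\<alpha>]) * vandermonde u)) (pos u (rect n u))"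
    by (simp add: col_schur_def coef_single_times)
  also have "Poly_Mapping.single 0 (prod_list xs ^ u) * (ups u (map inverse xs @ xs @ [\<alpha>]) * vandermonde u) =
     (Poly_Mapping.single 0 (prod_list xs ^ u) * ups u (map inverse xs)) * (up u \<alpha> * ups u xs * vandermonde u)"
    by (simp add: ups_def mult_ac)
  also have "\<dots> = ymon (\<lambda>i. int n * raise u i) * (up u \<alpha> * (dns u xs * ups u xs * vandermonde u))"
    unfolding main by (simp add: mult_ac)
  also have "coef \<dots> (pos u (rect n u)) = coef (up u \<alpha> * (dns u xs * ups u xs * vandermonde u)) (pos u (rect n u) - (\<lambda>i. int n * raise u i))"
    by (rule coef_ymon_times)
  also have "pos u (rect n u) - (\<lambda>i. int n * raise u i) = pos u (\<lambda>_. 0)"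
  proof
    fix i
    have "cnt (rect n u) (u - i) = n" if "i < u"
    proof -
      have "{k. u - i \<le> rect n u k} = {..<n}" using that by (auto simp: rect_def)
      then show ?thesis by (simp add: cnt_def)
    qed
    then show "(pos u (rect n u) - (\<lambda>i. int n * raise u i)) i = pos u (\<lambda>_. 0) i"
      by (simp add: pos_def raise_def cnt_def[of "\<lambda>_. 0"])
  qed
  finally show ?thesis .
qed

section \<open>Semistandard tableaux\<close>

lemma sorted_split_max:
  fixes r :: "nat list"
  assumes "sorted r" "set r \<subseteq> {..<Suc m}"
  shows "r = filter (\<lambda>k. k < m) r @ replicate (length r - length (filter (\<lambda>k. k < m) r)) m"
  using assms
proof (induction r)
  case (Cons a r)
  show ?case
  proof (cases "a < m")
    case True
    with Cons show ?thesis by simp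
  next
    case False
    have all: "b = m" if "b \<in> set (a # r)" for b
    proof -
      have "a \<le> b" "b < Suc m" using Cons.prems that by auto
      with False show ?thesis by simp
    qed
    then have eq: "a # r = replicate (length (a # r)) m"
      by (intro replicate_eqI refl)
    have "filter (\<lambda>k. k < m) (a # r) = []"
      using all by (force simp: filter_empty_conv)
    then have "filter (\<lambda>k. k < m) (a # r) @ replicate (length (a # r) - length (filter (\<lambda>k. k < m) (a # r))) m
        = replicate (length (a # r)) m"
      by (simp only: list.size diff_zero append_Nil)
    with eq show ?thesis by (rule trans[OF _ sym])
  qed
qed simp

lemma finite_ssyt: "finite (ssyt m \<mu>)"
proof (rule finite_subset)
  let ?R = "{r. set r \<subseteq> {..<m} \<and> length r \<le> sum_list \<mu>}"
  show "ssyt m \<mu> \<subseteq> {T. set T \<subseteq> ?R \<and> length T = length \<mu>}"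
  proof
    fix T assume T: "T \<in> ssyt m \<mu>"
    then have len: "map length T = \<mu>" by (simp add: ssyt_def)
    have "length r \<le> sum_list \<mu>" if "r \<in> set T" for r
      using that len by (intro member_le_sum_list) auto
    moreover have "length T = length \<mu>" using len by auto
    ultimately show "T \<in> {T. set T \<subseteq> ?R \<and> length T = length \<mu>}" using T by (auto simp: ssyt_def)
  qed
  show "finite {T. set T \<subseteq> ?R \<and> length T = length \<mu>}"
    by (intro finite_lists_length_eq finite_lists_length_le) simp
qed

lemma ssyt_iff:
  "T \<in> ssyt m (map f [0..<n]) \<longleftrightarrow> length T = n \<and> (\<forall>k<n. length (T ! k) = f k \<and> sorted (T ! k) \<and> set (T ! k) \<subseteq> {..<m}) \<and>
    (\<forall>k j. Suc k < n \<and> j < f (Suc k) \<longrightarrow> T ! k ! j < T ! Suc k ! j)"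
proof -
  have *: "map length T = map f [0..<n] \<longleftrightarrow> length T = n \<and> (\<forall>k<n. length (T ! k) = f k)"
  proof
    assume eq: "map length T = map f [0..<n]"
    then have len: "length T = n" using map_eq_imp_length_eq by fastforce
    moreover have "length (T ! k) = f k" if "k < n" for k
      using arg_cong[OF eq, of "\<lambda>l. l ! k"] that len by simp
    ultimately show "length T = n \<and> (\<forall>k<n. length (T ! k) = f k)" by blast
  next
    assume "length T = n \<and> (\<forall>k<n. length (T ! k) = f k)"
    then show "map length T = map f [0..<n]" by (intro nth_equalityI) simp_all
  qed
  show ?thesis
  proof (cases "length T = n \<and> (\<forall>k<n. length (T ! k) = f k)")
    case True
    then have "map length T = map f [0..<n]" using * by blast
    moreover have "(Suc k < n \<and> j < length (T ! Suc k)) = (Suc k < n \<and> j < f (Suc k))" for k j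
      using True by auto
    ultimately show ?thesis using True unfolding ssyt_def all_set_conv_all_nth by simp
  next
    case False
    then have "map length T \<noteq> map f [0..<n]" using * by blast
    with False show ?thesis unfolding ssyt_def by blast
  qed
qed

text \<open>Branching rule: deleting the largest letter \<open>length xs\<close> leaves a tableau in
  the other letters, and strict columns make the deleted cells a horizontal strip. Rows are sorted,
  so the deleted cells are at the row ends and the deletion can be undone.\<close>

lemma schur_snoc:
  fixes xs :: "real list"
  assumes f: "f \<in> Par n u"
  shows "schur (map f [0..<n]) (xs @ [x]) =
    (\<Sum>g\<in>{g \<in> Par n u. interlaced g f}. x ^ (psize u f - psize u g) * schur (map g [0..<n]) xs)"
proof -
  let ?m = "length xs"
  let ?S = "{g \<in> Par n u. interlaced g f}"
  let ?wt = "\<lambda>T. \<Prod>k\<leftarrow>concat T. xs ! k"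
  let ?small = "filter (\<lambda>k. k < ?m)"
  define shape where "shape T k = (if k < n then length (?small (T ! k)) else 0)" for T k
  define ext where "ext g T = map (\<lambda>k. T ! k @ replicate (f k - g k) ?m) [0..<n]" for g and T :: "nat list list"
  have split: "T ! k = ?small (T ! k) @ replicate (f k - shape T k) ?m"
    if "T \<in> ssyt (Suc ?m) (map f [0..<n])" "k < n" for T k
    using sorted_split_max[of "T ! k" ?m] that unfolding ssyt_iff shape_def by simp
  have wt_ext: "(\<Prod>k\<leftarrow>concat (ext g T). (xs @ [x]) ! k) = x ^ (psize u f - psize u g) * ?wt T"
    if g: "g \<in> ?S" and T: "T \<in> ssyt ?m (map g [0..<n])" for g T
  proof -
    have le: "g k \<le> f k" for k using g by (simp add: interlaced_def)
    have len: "length T = n" using T by (simp add: ssyt_iff)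
    have row: "(\<Prod>k\<leftarrow>T ! k @ replicate (f k - g k) ?m. (xs @ [x]) ! k) = x ^ (f k - g k) * (\<Prod>k\<leftarrow>T ! k. xs ! k)" if "k < n" for k
    proof -
      have *: "map (\<lambda>k. (xs @ [x]) ! k) (T ! k) = map (\<lambda>k. xs ! k) (T ! k)"
        using T that by (auto simp: ssyt_iff nth_append)
      show ?thesis unfolding map_append prod_list.append * by (simp add: mult.commute)
    qed
    have prod_concat: "(\<Prod>k\<leftarrow>concat TT. h k) = (\<Prod>r\<leftarrow>TT. \<Prod>k\<leftarrow>r. h k)" for TT and h :: "nat \<Rightarrow> real"
      by (induction TT) auto
    have prod_upt: "(\<Prod>k\<leftarrow>[0..<n]. h k) = (\<Prod>k<n. h k)" for h :: "nat \<Rightarrow> real"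
      using prod.distinct_set_conv_list[of "[0..<n]" h] by (simp add: lessThan_atLeast0)
    have "(\<Prod>k\<leftarrow>concat (ext g T). (xs @ [x]) ! k) = (\<Prod>k<n. \<Prod>k\<leftarrow>T ! k @ replicate (f k - g k) ?m. (xs @ [x]) ! k)"
      unfolding prod_concat ext_def map_map o_def prod_upt ..
    also have "\<dots> = (\<Prod>k<n. x ^ (f k - g k) * (\<Prod>k\<leftarrow>T ! k. xs ! k))"
      by (intro prod.cong refl row) simp
    also have "\<dots> = x ^ (\<Sum>k<n. f k - g k) * (\<Prod>k<n. \<Prod>k\<leftarrow>T ! k. xs ! k)"
      by (simp add: prod.distrib power_sum)
    also have "(\<Sum>k<n. f k - g k) = psize u f - psize u g"
      using psize_eq_sum[OF f] psize_eq_sum[of g n u] g le by (simp add: sum_subtractf_nat)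
    also have "(\<Prod>k<n. \<Prod>k\<leftarrow>T ! k. xs ! k) = ?wt T"
    proof -
      have T_eq: "map (\<lambda>k. T ! k) [0..<n] = T" unfolding len[symmetric] by (rule map_nth)
      have "(\<Prod>k\<leftarrow>concat (map (\<lambda>k. T ! k) [0..<n]). xs ! k) = (\<Prod>k<n. \<Prod>k\<leftarrow>T ! k. xs ! k)"
        unfolding prod_concat map_map o_def prod_upt ..
      then show ?thesis unfolding T_eq by (rule sym)
    qed
    finally show ?thesis .
  qed
  define I where "I b = ext (fst b) (snd b)" for b
  define J where "J T = (shape T, map ?small T)" for T
  define w where "w b = x ^ (psize u f - psize u (fst b)) * ?wt (snd b)" for b :: "(nat \<Rightarrow> nat) \<times> nat list list"
  define w' where "w' T = (\<Prod>k\<leftarrow>concat T. (xs @ [x]) ! k)" for T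
  define Sg where "Sg = Sigma ?S (\<lambda>g. ssyt ?m (map g [0..<n]))"
  have "schur (map f [0..<n]) (xs @ [x]) =
      (\<Sum>T\<in>ssyt (Suc ?m) (map f [0..<n]). w' T)"
    by (simp add: schur_def w'_def)
  also have "\<dots> = (\<Sum>b\<in>Sg. w b)"
  proof (rule sum.reindex_bij_witness[of _ I J])
    fix T assume T: "T \<in> ssyt (Suc ?m) (map f [0..<n])"
    note D = T[unfolded ssyt_iff]
    have len: "length T = n" using D by simp
    have ext: "ext (shape T) (map ?small T) = T"
    proof (rule nth_equalityI)
      fix k assume "k < length (ext (shape T) (map ?small T))"
      then have "k < n" by (simp add: ext_def)
      then show "ext (shape T) (map ?small T) ! k = T ! k"
        using split[OF T, of k, symmetric] len by (simp add: ext_def)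
    qed (simp add: ext_def len)
    then show "I (J T) = T" by (simp add: I_def J_def)
    have le: "shape T k \<le> f k" for k
    proof (cases "k < n")
      case True
      have "length (?small (T ! k)) \<le> length (T ! k)" by (rule length_filter_le)
      then show ?thesis using D True by (simp add: shape_def)
    qed (simp add: shape_def)
    have ge: "f (Suc k) \<le> shape T k" for k
    proof (cases "Suc k < n")
      case True
      \<comment> \<open>An entry with another entry below it is smaller than the largest letter,
        hence survives the deletion.\<close>
      have "T ! k ! j < ?m" if "j < f (Suc k)" for j
      proof -
        have "T ! k ! j < T ! Suc k ! j" using D True that by simp
        moreover have "T ! Suc k ! j \<in> set (T ! Suc k)" using D True that by simp
        then have "T ! Suc k ! j < Suc ?m" using D True by blast
        ultimately show ?thesis by simp
      qed
      moreover have "f (Suc k) \<le> length (T ! k)"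
      proof -
        have "f (Suc k) \<le> f k" using f by (auto simp: Par_def intro: antimonoD)
        then show ?thesis using D True by simp
      qed
      ultimately have "\<forall>a\<in>set (take (f (Suc k)) (T ! k)). a < ?m"
        by (auto simp: in_set_conv_nth)
      then have "?small (take (f (Suc k)) (T ! k)) = take (f (Suc k)) (T ! k)"
        by (simp add: filter_id_conv)
      then have "f (Suc k) \<le> length (?small (take (f (Suc k)) (T ! k) @ drop (f (Suc k)) (T ! k)))"
        using \<open>f (Suc k) \<le> length (T ! k)\<close> by (simp only: filter_append length_append) simp
      then show ?thesis using True by (simp add: shape_def)
    next
      case False
      then show ?thesis using f by (simp add: Par_def)
    qed
    have shape: "shape T \<in> Par n u"
      unfolding Par_def
    proof (intro CollectI conjI allI impI)
      show "antimono (shape T)"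
        by (rule antimono_iff_le_Suc[THEN iffD2]) (use le ge le_trans in blast)
      show "shape T 0 \<le> u" using le[of 0] Par_le[OF f, of 0] by simp
    qed (simp add: shape_def)
    have "map ?small T \<in> ssyt ?m (map (shape T) [0..<n])"
      unfolding ssyt_iff
    proof (intro conjI allI impI)
      fix k j assume k: "Suc k < n \<and> j < shape T (Suc k)"
      have 1: "map ?small T ! i ! j = T ! i ! j" if "i < n" "j < shape T i" for i
      proof -
        have "T ! i ! j = (?small (T ! i) @ replicate (f i - shape T i) ?m) ! j"
          by (rule arg_cong[OF split[OF T that(1)], of "\<lambda>r. r ! j"])
        also have "\<dots> = ?small (T ! i) ! j"
          using that by (simp add: shape_def nth_append)
        finally show ?thesis using that len by simp
      qed
      have "shape T (Suc k) \<le> shape T k" using le[of "Suc k"] ge[of k] by simp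
      then have "map ?small T ! k ! j = T ! k ! j" "map ?small T ! Suc k ! j = T ! Suc k ! j"
        using k by (auto intro: 1)
      then show "map ?small T ! k ! j < map ?small T ! Suc k ! j"
        using D k le[of "Suc k"] by simp
    next
      show "length (map ?small T) = n" by (simp add: len)
      fix k assume k: "k < n"
      then show "length (map ?small T ! k) = shape T k" by (simp add: shape_def len)
      show "sorted (map ?small T ! k)"
        using D k len by (simp add: sorted_wrt_filter)
      show "set (map ?small T ! k) \<subseteq> {..<?m}" using k len by auto
    qed
    then have JT: "(shape T, map ?small T) \<in> Sg"
      unfolding Sg_def using shape le ge by (simp add: interlaced_def)
    then show "J T \<in> Sg" by (simp add: J_def)
    show "w (J T) = w' T"
      using wt_ext[of "shape T" "map ?small T"] JT by (simp add: w_def w'_def J_def Sg_def ext)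
  next
    fix b assume "b \<in> Sg"
    then obtain g T where b: "b = (g, T)" and g: "g \<in> Par n u" "interlaced g f"
      and T: "T \<in> ssyt ?m (map g [0..<n])" unfolding Sg_def by blast
    note D = T[unfolded ssyt_iff]
    have len: "length T = n" using D by simp
    have "?small (T ! k) = T ! k" if "k < n" for k
      using D that by (auto simp: filter_id_conv)
    then have small: "map ?small (ext g T) = T"
      using len by (intro nth_equalityI) (simp_all add: ext_def)
    have "shape (ext g T) = g"
    proof
      fix k
      have "?small (ext g T ! k) = T ! k" if "k < n"
        using arg_cong[OF small, of "\<lambda>TT. TT ! k"] that by (simp add: ext_def)
      then show "shape (ext g T) k = g k"
        using D g(1) by (cases "k < n") (simp_all add: shape_def Par_def)
    qed
    then show "J (I b) = b"
      using small b by (simp add: I_def J_def)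
    have le: "g k \<le> f k" for k using g by (simp add: interlaced_def)
    have "ext g T \<in> ssyt (Suc ?m) (map f [0..<n])"
      unfolding ssyt_iff
    proof (intro conjI allI impI)
      fix k j assume k: "Suc k < n \<and> j < f (Suc k)"
      have "f (Suc k) \<le> g k" using g by (simp add: interlaced_def)
      then have j: "j < g k" using k by simp
      have "T ! k ! j \<in> set (T ! k)" using D k j by simp
      then have "T ! k ! j < ?m" using D k by (meson Suc_lessD lessThan_iff subsetD)
      then show "ext g T ! k ! j < ext g T ! Suc k ! j"
        using D k j le[of "Suc k"] by (auto simp: ext_def nth_append)
    next
      show "length (ext g T) = n" by (simp add: ext_def)
      fix k assume k: "k < n"
      have set: "set (T ! k) \<subseteq> {..<?m}" and srt: "sorted (T ! k)" and l: "length (T ! k) = g k"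
        using D k by auto
      show "length (ext g T ! k) = f k" using k l le[of k] by (simp add: ext_def)
      have "\<forall>a\<in>set (T ! k). a \<le> ?m" using set by (auto intro: less_imp_le)
      then show "sorted (ext g T ! k)" using k srt by (simp add: ext_def sorted_append)
      show "set (ext g T ! k) \<subseteq> {..<Suc ?m}" using k set by (auto simp: ext_def)
    qed
    then show "I b \<in> ssyt (Suc ?m) (map f [0..<n])" using b by (simp add: I_def)
  qed
  also have "\<dots> = (\<Sum>g\<in>?S. \<Sum>T\<in>ssyt ?m (map g [0..<n]). x ^ (psize u f - psize u g) * ?wt T)"
    unfolding Sg_def w_def by (subst sum.Sigma) (auto simp: finite_Par finite_ssyt case_prod_unfold)
  also have "\<dots> = (\<Sum>g\<in>?S. x ^ (psize u f - psize u g) * schur (map g [0..<n]) xs)"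
    by (simp add: schur_def sum_distrib_left)
  finally show ?thesis .
qed

lemma schur_Nil:
  assumes "f \<in> Par n u"
  shows "schur (map f [0..<n]) [] = (of_bool (f = (\<lambda>_. 0)) :: real)"
proof -
  have "T \<in> ssyt 0 (map f [0..<n]) \<longleftrightarrow> T = replicate n [] \<and> f = (\<lambda>_. 0)" for T
  proof
    assume "T \<in> ssyt 0 (map f [0..<n])"
    then have T: "length T = n" "\<And>k. k < n \<Longrightarrow> length (T ! k) = f k \<and> T ! k = []"
      by (auto simp: ssyt_iff)
    have "f k = 0" for k
    proof (cases "k < n")
      case True
      then show ?thesis using T(2)[of k] by (metis list.size(3))
    next
      case False
      then show ?thesis using assms by (simp add: Par_def)
    qed
    then have "f = (\<lambda>_. 0)" by blast
    moreover have "T = replicate n []"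
      using T by (intro nth_equalityI) simp_all
    ultimately show "T = replicate n [] \<and> f = (\<lambda>_. 0)" by blast
  next
    assume *: "T = replicate n [] \<and> f = (\<lambda>_. 0)"
    show "T \<in> ssyt 0 (map f [0..<n])"
      unfolding ssyt_iff using * by simp
  qed
  then have "ssyt 0 (map f [0..<n]) = (if f = (\<lambda>_. 0) then {replicate n []} else {})" by auto
  then show ?thesis by (simp add: schur_def)
qed

theorem schur_eq_col_schur:
  "f \<in> Par n u \<Longrightarrow> schur (map f [0..<n]) xs = col_schur u xs f"
proof (induction xs arbitrary: f rule: rev_induct)
  case Nil
  then show ?case by (simp add: schur_Nil col_schur_Nil)
next
  case (snoc x xs)
  then show ?case by (simp add: schur_snoc col_schur_snoc)
qed

section \<open>Symplectic patterns\<close>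

text \<open>The rows of a pattern are complemented in \<open>u\<close>, so the shape is \<open>u\<^sup>k\<close> minus the partition \<open>t\<close>.\<close>

definition symp_fiber :: "nat \<Rightarrow> nat \<Rightarrow> (nat \<Rightarrow> nat) \<Rightarrow> (nat \<Rightarrow> nat \<Rightarrow> nat) set" where
  "symp_fiber u k t = {z \<in> symplectic_patterns (2 * k). \<forall>i\<in>{1..k}. z (2 * k) i = u - t (k - i)}"

definition symp_weight :: "real list \<Rightarrow> (nat \<Rightarrow> nat \<Rightarrow> nat) \<Rightarrow> real" where
  "symp_weight xs z = (\<Prod>i = 1..length xs. (xs ! (i - 1)) powi (pattern_type z (2 * i) - pattern_type z (2 * i - 1)))"

lemma symplectic_patternsD:
  assumes "z \<in> symplectic_patterns h"
  shows "(i, j) \<notin> pattern_index h \<Longrightarrow> z i j = 0"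
    "(i, j) \<in> pattern_index h \<Longrightarrow> i < h \<Longrightarrow> z i j \<le> z (Suc i) j"
    "(i, j) \<in> pattern_index h \<Longrightarrow> (Suc i, Suc j) \<in> pattern_index h \<Longrightarrow> z (Suc i) (Suc j) \<le> z i j"
  using assms by (auto simp: symplectic_patterns_def pattern_index_def)

lemma symplectic_patternsI:
  assumes "\<And>i j. (i, j) \<notin> pattern_index h \<Longrightarrow> z i j = 0"
    "\<And>i j. (i, j) \<in> pattern_index h \<Longrightarrow> (Suc i, j) \<in> pattern_index h \<Longrightarrow> z i j \<le> z (Suc i) j"
    "\<And>i j. (i, j) \<in> pattern_index h \<Longrightarrow> (Suc i, Suc j) \<in> pattern_index h \<Longrightarrow> z (Suc i) (Suc j) \<le> z i j"
  shows "z \<in> symplectic_patterns h"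
  using assms by (auto simp: symplectic_patterns_def)

text \<open>At a fixed column index the entries grow with the row index up to the last row, which is
  at most \<open>u\<close>. So the truncated subtraction in the complements loses nothing.\<close>

lemma symp_fiber_le:
  assumes "z \<in> symp_fiber u k t"
  shows "z i j \<le> u"
proof (cases "(i, j) \<in> pattern_index (2 * k)")
  case True
  have z: "z \<in> symplectic_patterns (2 * k)" using assms by (simp add: symp_fiber_def)
  have "z i j \<le> u" if "i + d = 2 * k" "(i, j) \<in> pattern_index (2 * k)" for d i
    using that
  proof (induction d arbitrary: i)
    case 0
    then have "j \<in> {1..k}" "i = 2 * k" by (auto simp: pattern_index_def)
    then show ?case using assms by (auto simp: symp_fiber_def)
  next
    case (Suc d)
    have "z i j \<le> z (Suc i) j"
      using symplectic_patternsD(2)[OF z Suc.prems(2)] Suc.prems(1) by simp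
    also have "(Suc i, j) \<in> pattern_index (2 * k)"
    proof -
      have "(i + 1) div 2 \<le> (Suc i + 1) div 2" by (rule div_le_mono) simp
      then show ?thesis using Suc.prems by (simp add: pattern_index_def)
    qed
    then have "z (Suc i) j \<le> u" using Suc.prems by (intro Suc.IH) auto
    finally show ?case .
  qed
  from this[of i "2 * k - i"] True show ?thesis by (auto simp: pattern_index_def)
next
  case False
  then show ?thesis using assms symplectic_patternsD(1)[of z "2 * k" i j] by (simp add: symp_fiber_def)
qed

lemma finite_pattern_index: "finite (pattern_index h)"
  by (rule finite_subset[of _ "{..h} \<times> {..h}"]) (auto simp: pattern_index_def)

lemma finite_symp_fiber: "finite (symp_fiber u k t)"
proof -
  let ?F = "{f. \<forall>p. (p \<in> pattern_index (2 * k) \<longrightarrow> f p \<in> {..u}) \<and> (p \<notin> pattern_index (2 * k) \<longrightarrow> f p = (0::nat))}"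
  have "finite ?F" by (rule finite_set_of_finite_funs) (auto simp: finite_pattern_index)
  moreover have "symp_fiber u k t \<subseteq> curry ` ?F"
  proof
    fix z assume z: "z \<in> symp_fiber u k t"
    have "case_prod z \<in> ?F"
      using symp_fiber_le[OF z] z symplectic_patternsD(1)[of z "2 * k"]
      by (auto simp: symp_fiber_def)
    moreover have "z = curry (case_prod z)" by simp
    ultimately show "z \<in> curry ` ?F" by blast
  qed
  ultimately show ?thesis using finite_surj by blast
qed

lemma pattern_type_cong:
  "(\<And>j. z i j = z' i j) \<Longrightarrow> (\<And>j. z (i - 1) j = z' (i - 1) j) \<Longrightarrow> pattern_type z i = pattern_type z' i"
  by (simp add: pattern_type_def)

lemma symp_weight_snoc:
  assumes "\<And>i j. i \<le> 2 * length xs \<Longrightarrow> z i j = z' i j" "k = length xs"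
  shows "symp_weight (xs @ [x]) z = symp_weight xs z' *
    x powi ((\<Sum>j = 1..Suc k. int (z (2 * k + 2) j)) - 2 * (\<Sum>j = 1..Suc k. int (z (2 * k + 1) j)) +
      (\<Sum>j = 1..k. int (z (2 * k) j)))"
proof -
  have "symp_weight (xs @ [x]) z =
    (\<Prod>i = 1..k. ((xs @ [x]) ! (i - 1)) powi (pattern_type z (2 * i) - pattern_type z (2 * i - 1))) *
    x powi (pattern_type z (2 * Suc k) - pattern_type z (2 * Suc k - 1))"
    by (simp add: symp_weight_def assms(2) nth_append)
  also have "(\<Prod>i = 1..k. ((xs @ [x]) ! (i - 1)) powi (pattern_type z (2 * i) - pattern_type z (2 * i - 1))) =
    symp_weight xs z'"
    unfolding symp_weight_def assms(2)[symmetric]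
  proof (intro prod.cong refl)
    fix i assume i: "i \<in> {1..k}"
    have *: "pattern_type z (2 * i) = pattern_type z' (2 * i)" "pattern_type z (2 * i - 1) = pattern_type z' (2 * i - 1)"
      using i assms by (auto intro!: pattern_type_cong)
    show "((xs @ [x]) ! (i - 1)) powi (pattern_type z (2 * i) - pattern_type z (2 * i - 1)) =
       (xs ! (i - 1)) powi (pattern_type z' (2 * i) - pattern_type z' (2 * i - 1))"
    proof -
      have "i - 1 < k" using i by auto
      then show ?thesis using * assms(2) by (simp add: nth_append)
    qed
  qed
  also have "pattern_type z (2 * Suc k) - pattern_type z (2 * Suc k - 1) =
      (\<Sum>j = 1..Suc k. int (z (2 * k + 2) j)) - 2 * (\<Sum>j = 1..Suc k. int (z (2 * k + 1) j)) +
      (\<Sum>j = 1..k. int (z (2 * k) j))"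
    by (simp add: pattern_type_def del: sum.cl_ivl_Suc)
  finally show ?thesis .
qed

lemma sum_complement:
  assumes "f \<in> Par k u"
  shows "(\<Sum>j = 1..k. int (u - f (k - j))) = int k * int u - int (psize u f)"
proof -
  have "(\<Sum>j = 1..k. int (u - f (k - j))) = (\<Sum>i<k. int (u - f i))"
    by (rule sum.reindex_bij_witness[of _ "\<lambda>i. k - i" "\<lambda>j. k - j"]) auto
  also have "\<dots> = (\<Sum>i<k. int u - int (f i))"
    by (intro sum.cong refl) (simp add: Par_le[OF assms] of_nat_diff)
  also have "\<dots> = int k * int u - int (psize u f)"
    by (simp add: psize_eq_sum[OF assms] sum_subtractf)
  finally show ?thesis .
qed

text \<open>Rows \<open>2 * k + 1\<close> and \<open>2 * k\<close> are complemented to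
  \<open>q\<close> and \<open>v\<close>, which reverses the inequalities: \<open>t\<close> and
  \<open>v\<close> both interlace below \<open>q\<close>. The exponent is the sum of row
  \<open>2 * k + 2\<close>, minus twice that of row \<open>2 * k + 1\<close>, plus that of row
  \<open>2 * k\<close>. These rows have \<open>k + 1\<close>, \<open>k + 1\<close> and
  \<open>k\<close> entries, so complementing leaves the term \<open>- u\<close>.\<close>

lemma sum_symp_fiber_snoc:
  assumes t: "t \<in> Par (Suc k) u" and k: "k = length xs"
  shows "(\<Sum>z\<in>symp_fiber u (Suc k) t. symp_weight (xs @ [x]) z) =
    (\<Sum>q\<in>{q \<in> Par (Suc k) u. interlaced t q}. \<Sum>v\<in>{v \<in> Par k u. interlaced v q}.
       x powi (2 * int (psize u q) - int (psize u t) - int (psize u v) - int u) *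
       (\<Sum>z\<in>symp_fiber u k v. symp_weight xs z))"
proof -
  let ?Q = "{q \<in> Par (Suc k) u. interlaced t q}"
  let ?V = "\<lambda>q. {v \<in> Par k u. interlaced v q}"
  define I where "I b = (\<lambda>i j. if i \<le> 2 * k then snd (snd b) i j
      else if i = 2 * k + 1 \<and> 1 \<le> j \<and> j \<le> k + 1 then u - fst b (k + 1 - j)
      else if i = 2 * k + 2 \<and> 1 \<le> j \<and> j \<le> k + 1 then u - t (k + 1 - j) else 0)"
    for b :: "(nat \<Rightarrow> nat) \<times> (nat \<Rightarrow> nat) \<times> (nat \<Rightarrow> nat \<Rightarrow> nat)"
  \<comment> \<open>Complementing turns a decreasing row into an increasing one; reading it
    backwards restores the order of a partition.\<close>
  define row where "row z h m = (\<lambda>j. if j < m then u - z h (m - j) else 0)" for z :: "nat \<Rightarrow> nat \<Rightarrow> nat" and h m :: nat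
  define rest where "rest z = (\<lambda>i j. if i \<le> 2 * k then z i j else 0)" for z :: "nat \<Rightarrow> nat \<Rightarrow> nat"
  define J where "J z = (row z (2 * k + 1) (k + 1), row z (2 * k) k, rest z)" for z
  define Sg where "Sg = Sigma ?Q (\<lambda>q. Sigma (?V q) (\<lambda>v. symp_fiber u k v))"
  define w where "w b = x powi (2 * int (psize u (fst b)) - int (psize u t) - int (psize u (fst (snd b))) - int u) *
      symp_weight xs (snd (snd b))" for b
  have idx: "(i, j) \<in> pattern_index (2 * k) \<longleftrightarrow> (i, j) \<in> pattern_index (2 * Suc k) \<and> i \<le> 2 * k" for i j
    by (auto simp: pattern_index_def)
  have idx1: "(2 * k + 1, j) \<in> pattern_index (2 * Suc k) \<longleftrightarrow> 1 \<le> j \<and> j \<le> k + 1" for j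
    by (auto simp: pattern_index_def)
  have idx2: "(2 * k + 2, j) \<in> pattern_index (2 * Suc k) \<longleftrightarrow> 1 \<le> j \<and> j \<le> k + 1" for j
    by (auto simp: pattern_index_def)
  have idx0: "(2 * k, j) \<in> pattern_index (2 * Suc k) \<longleftrightarrow> 1 \<le> j \<and> j \<le> k" for j
    by (auto simp: pattern_index_def)
  have wI: "symp_weight (xs @ [x]) z = w (q, v, z')"
    if q: "q \<in> Par (Suc k) u" and v: "v \<in> Par k u" and z: "z' \<in> symp_fiber u k v" and zI: "z = I (q, v, z')" for q v z' z
  proof -
    have "symp_weight (xs @ [x]) z = symp_weight xs z' *
      x powi ((\<Sum>j = 1..Suc k. int (z (2 * k + 2) j)) - 2 * (\<Sum>j = 1..Suc k. int (z (2 * k + 1) j)) +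
      (\<Sum>j = 1..k. int (z (2 * k) j)))"
      by (rule symp_weight_snoc) (auto simp: zI I_def k)
    also have "(\<Sum>j = 1..Suc k. int (z (2 * k + 2) j)) = (\<Sum>j = 1..Suc k. int (u - t (Suc k - j)))"
      by (intro sum.cong refl) (simp add: zI I_def)
    also have "\<dots> = int (Suc k) * int u - int (psize u t)" by (rule sum_complement[OF t])
    also have "(\<Sum>j = 1..Suc k. int (z (2 * k + 1) j)) = (\<Sum>j = 1..Suc k. int (u - q (Suc k - j)))"
      by (intro sum.cong refl) (simp add: zI I_def)
    also have "\<dots> = int (Suc k) * int u - int (psize u q)" by (rule sum_complement[OF q])
    also have "(\<Sum>j = 1..k. int (z (2 * k) j)) = (\<Sum>j = 1..k. int (u - v (k - j)))"
      using z by (intro sum.cong refl) (simp add: zI I_def symp_fiber_def)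
    also have "\<dots> = int k * int u - int (psize u v)" by (rule sum_complement[OF v])
    also have "int (Suc k) * int u - int (psize u t) - 2 * (int (Suc k) * int u - int (psize u q)) +
      (int k * int u - int (psize u v)) = 2 * int (psize u q) - int (psize u t) - int (psize u v) - int u"
      by (simp add: algebra_simps)
    finally show ?thesis by (simp add: w_def mult.commute)
  qed
  have "(\<Sum>z\<in>symp_fiber u (Suc k) t. symp_weight (xs @ [x]) z) = (\<Sum>b\<in>Sg. w b)"
  proof (rule sum.reindex_bij_witness[of _ I J])
    fix z assume z: "z \<in> symp_fiber u (Suc k) t"
    then have zp: "z \<in> symplectic_patterns (2 * Suc k)" by (simp add: symp_fiber_def)
    note D = symplectic_patternsD[OF zp]
    have top: "z (2 * k + 2) i = u - t (k + 1 - i)" if "1 \<le> i" "i \<le> k + 1" for i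
      using z that by (auto simp: symp_fiber_def)
    note le = symp_fiber_le[OF z]
    define q where "q = row z (2 * k + 1) (k + 1)"
    define v where "v = row z (2 * k) k"
    have q: "q j = (if j < k + 1 then u - z (2 * k + 1) (k + 1 - j) else 0)" for j
      by (simp add: q_def row_def)
    have v: "v j = (if j < k then u - z (2 * k) (k - j) else 0)" for j
      by (simp add: v_def row_def)
    have tq: "interlaced t q"
      unfolding interlaced_def
    proof (intro allI conjI)
      fix j
      show "t j \<le> q j"
      proof (cases "j < k + 1")
        case True
        have "z (2 * k + 1) (k + 1 - j) \<le> z (Suc (2 * k + 1)) (k + 1 - j)"
          by (rule D(2)) (use True idx1[of "k + 1 - j"] in auto)
        also have "\<dots> = u - t j" using top[of "k + 1 - j"] True by simp
        finally show ?thesis using True Par_le[OF t, of j] by (simp add: q)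
      next
        case False
        then show ?thesis using t by (simp add: Par_def)
      qed
      show "q (Suc j) \<le> t j"
      proof (cases "j < k")
        case True
        have "z (Suc (2 * k + 1)) (Suc (k - j)) \<le> z (2 * k + 1) (k - j)"
          by (rule D(3)) (use True idx1[of "k - j"] idx2[of "Suc (k - j)"] in auto)
        moreover have "z (Suc (2 * k + 1)) (Suc (k - j)) = u - t j"
          using top[of "Suc (k - j)"] True by (simp add: Suc_diff_le)
        ultimately show ?thesis using True Par_le[OF t, of j] by (simp add: q)
      qed (simp add: q)
    qed
    have vq: "interlaced v q"
      unfolding interlaced_def
    proof (intro allI conjI)
      fix j
      show "v j \<le> q j"
      proof (cases "j < k")
        case True
        have "z (Suc (2 * k)) (Suc (k - j)) \<le> z (2 * k) (k - j)"
          by (rule D(3)) (use True idx0[of "k - j"] idx1[of "Suc (k - j)"] in auto)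
        then show ?thesis using True by (simp add: q v Suc_diff_le diff_le_mono2)
      qed (simp add: v)
      show "q (Suc j) \<le> v j"
      proof (cases "j < k")
        case True
        have "z (2 * k) (k - j) \<le> z (Suc (2 * k)) (k - j)"
          by (rule D(2)) (use True idx0[of "k - j"] in auto)
        then show ?thesis using True by (simp add: q v diff_le_mono2)
      qed (simp add: q)
    qed
    have qP: "q \<in> Par (Suc k) u"
      unfolding Par_def
    proof (intro CollectI conjI allI impI)
      show "antimono q"
        unfolding antimono_iff_le_Suc
      proof
        fix j have "q (Suc j) \<le> t j" "t j \<le> q j" using tq by (simp_all add: interlaced_def)
        then show "q (Suc j) \<le> q j" by simp
      qed
    qed (simp_all add: q)
    have vP: "v \<in> Par k u"
      unfolding Par_def
    proof (intro CollectI conjI allI impI)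
      show "antimono v"
        unfolding antimono_iff_le_Suc
      proof
        fix j have "v (Suc j) \<le> q (Suc j)" "q (Suc j) \<le> v j" using vq by (simp_all add: interlaced_def)
        then show "v (Suc j) \<le> v j" by simp
      qed
    qed (simp_all add: v)
    have rest: "rest z \<in> symp_fiber u k v"
      unfolding symp_fiber_def
    proof (intro CollectI conjI ballI)
      show "rest z \<in> symplectic_patterns (2 * k)"
      proof (rule symplectic_patternsI)
        fix i j assume "(i, j) \<notin> pattern_index (2 * k)"
        then show "rest z i j = 0" using D(1)[of i j] idx[of i j] by (auto simp: rest_def)
      next
        fix i j assume "(i, j) \<in> pattern_index (2 * k)" "(Suc i, j) \<in> pattern_index (2 * k)"
        then show "rest z i j \<le> rest z (Suc i) j"
          using D(2)[of i j] idx[of i j] idx[of "Suc i" j] by (auto simp: rest_def)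
      next
        fix i j assume "(i, j) \<in> pattern_index (2 * k)" "(Suc i, Suc j) \<in> pattern_index (2 * k)"
        then show "rest z (Suc i) (Suc j) \<le> rest z i j"
          using D(3)[of i j] idx[of i j] idx[of "Suc i" "Suc j"] by (auto simp: rest_def)
      qed
      fix i assume i: "i \<in> {1..k}"
      then have "k - i < k" "k - (k - i) = i" by auto
      then show "rest z (2 * k) i = u - v (k - i)"
        using le[of "2 * k" i] by (simp add: rest_def v)
    qed
    have J: "J z = (q, v, rest z)" by (simp add: J_def q_def v_def)
    have "I (J z) i j = z i j" for i j
    proof -
      consider "i \<le> 2 * k" | "i = 2 * k + 1" "1 \<le> j" "j \<le> k + 1" | "i = 2 * k + 2" "1 \<le> j" "j \<le> k + 1"
        | "(i, j) \<notin> pattern_index (2 * Suc k)" "i > 2 * k" "\<not> (i = 2 * k + 1 \<and> 1 \<le> j \<and> j \<le> k + 1)"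
          "\<not> (i = 2 * k + 2 \<and> 1 \<le> j \<and> j \<le> k + 1)"
        by (auto simp: pattern_index_def) linarith
      then show ?thesis
      proof cases
        case 1
        then show ?thesis by (simp add: I_def J rest_def)
      next
        case 2
        then have "k + 1 - j < k + 1" "k + 1 - (k + 1 - j) = j" by auto
        then show ?thesis using 2 le[of "2 * k + 1" j] unfolding I_def J by (simp add: q)
      next
        case 3
        then show ?thesis using top[of j] by (simp add: I_def)
      next
        case 4
        then show ?thesis using D(1)[of i j] by (auto simp: I_def)
      qed
    qed
    then show IJ: "I (J z) = z" by (simp add: fun_eq_iff)
    show "J z \<in> Sg" unfolding J Sg_def using tq vq qP vP rest by blast
    show "w (J z) = symp_weight (xs @ [x]) z"
      using wI[OF qP vP rest, of z] IJ unfolding J by simp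
  next
    fix b assume b: "b \<in> Sg"
    obtain q v z where b_eq: "b = (q, v, z)" by (cases b)
    from b have q: "q \<in> Par (Suc k) u" "interlaced t q" and v: "v \<in> Par k u" "interlaced v q"
      and z: "z \<in> symp_fiber u k v" unfolding Sg_def b_eq by blast+
    have zp: "z \<in> symplectic_patterns (2 * k)" using z by (simp add: symp_fiber_def)
    note D = symplectic_patternsD[OF zp]
    have top: "z (2 * k) i = u - v (k - i)" if "1 \<le> i" "i \<le> k" for i
      using z that by (simp add: symp_fiber_def)
    have I0: "I b i j = z i j" if "i \<le> 2 * k" for i j
      using that by (simp add: I_def b_eq)
    have I1: "I b (2 * k + 1) j = u - q (k + 1 - j)" if "1 \<le> j" "j \<le> k + 1" for j
      using that by (simp add: I_def b_eq)
    have I2: "I b (2 * k + 2) j = u - t (k + 1 - j)" if "1 \<le> j" "j \<le> k + 1" for j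
      using that by (simp add: I_def)
    have Iz: "I b i j = 0" if "(i, j) \<notin> pattern_index (2 * Suc k)" for i j
    proof (cases "i \<le> 2 * k")
      case True
      then show ?thesis using D(1)[of i j] idx[of i j] that I0 by simp
    next
      case False
      then show ?thesis using that by (auto simp: I_def pattern_index_def)
    qed
    have "I b \<in> symplectic_patterns (2 * Suc k)"
    proof (rule symplectic_patternsI[OF Iz])
      fix i j assume ij: "(i, j) \<in> pattern_index (2 * Suc k)" "(Suc i, j) \<in> pattern_index (2 * Suc k)"
      then consider "i < 2 * k" | "i = 2 * k" | "i = 2 * k + 1" by (auto simp: pattern_index_def) linarith
      then show "I b i j \<le> I b (Suc i) j"
      proof cases
        case 1
        then show ?thesis using D(2)[of i j] idx[of i j] ij I0[of i j] I0[of "Suc i" j] by simp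
      next
        case 2
        then have j: "1 \<le> j" "j \<le> k" using ij idx0 by auto
        have "q (Suc (k - j)) \<le> v (k - j)" using v(2) by (simp add: interlaced_def)
        then show ?thesis using I0[of "2 * k" j] I1[of j] top[of j] j 2 by (simp add: Suc_diff_le diff_le_mono2)
      next
        case 3
        then have j: "1 \<le> j" "j \<le> k + 1" using ij idx1 by auto
        have "t (k + 1 - j) \<le> q (k + 1 - j)" using q(2) by (simp add: interlaced_def)
        then show ?thesis using I1[of j] I2[of j] j 3 by (simp add: diff_le_mono2)
      qed
    next
      fix i j assume ij: "(i, j) \<in> pattern_index (2 * Suc k)" "(Suc i, Suc j) \<in> pattern_index (2 * Suc k)"
      then consider "i < 2 * k" | "i = 2 * k" | "i = 2 * k + 1" by (auto simp: pattern_index_def) linarith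
      then show "I b (Suc i) (Suc j) \<le> I b i j"
      proof cases
        case 1
        then show ?thesis using D(3)[of i j] idx[of i j] idx[of "Suc i" "Suc j"] ij I0[of i j] I0[of "Suc i" "Suc j"] by simp
      next
        case 2
        then have j: "1 \<le> j" "j \<le> k" using ij idx0 by auto
        have "v (k - j) \<le> q (k - j)" using v(2) by (simp add: interlaced_def)
        then show ?thesis using I0[of "2 * k" j] I1[of "Suc j"] top[of j] j 2 by (simp add: diff_le_mono2)
      next
        case 3
        then have j: "1 \<le> j" "j \<le> k" using ij idx2[of "Suc j"] idx1[of j] by auto
        have "q (Suc (k - j)) \<le> t (k - j)" using q(2) by (simp add: interlaced_def)
        then show ?thesis using I1[of j] I2[of "Suc j"] j 3 by (simp add: Suc_diff_le diff_le_mono2)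
      qed
    qed
    moreover have "I b (2 * Suc k) i = u - t (Suc k - i)" if "i \<in> {1..Suc k}" for i
      using I2[of i] that by simp
    ultimately show "I b \<in> symp_fiber u (Suc k) t" by (simp add: symp_fiber_def)
    have "row (I b) (2 * k + 1) (k + 1) = q"
    proof
      fix j
      show "row (I b) (2 * k + 1) (k + 1) j = q j"
      proof (cases "j < k + 1")
        case True
        then have "k + 1 - (k + 1 - j) = j" by simp
        then show ?thesis using True I1[of "k + 1 - j"] Par_le[OF q(1), of j] by (simp add: row_def)
      next
        case False
        then show ?thesis using q(1) by (simp add: row_def Par_def)
      qed
    qed
    moreover have "row (I b) (2 * k) k = v"
    proof
      fix j
      show "row (I b) (2 * k) k j = v j"
      proof (cases "j < k")
        case True
        then have "k - (k - j) = j" by simp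
        then show ?thesis using True I0[of "2 * k" "k - j"] top[of "k - j"] Par_le[OF v(1), of j] by (simp add: row_def)
      next
        case False
        then show ?thesis using v(1) by (simp add: row_def Par_def)
      qed
    qed
    moreover have "rest (I b) = z"
    proof (intro ext)
      fix i j
      show "rest (I b) i j = z i j"
        using I0[of i j] D(1)[of i j] idx[of i j] by (cases "i \<le> 2 * k") (simp_all add: rest_def)
    qed
    ultimately show "J (I b) = b" by (simp add: J_def b_eq)
  qed
  also have "\<dots> = (\<Sum>q\<in>?Q. \<Sum>p\<in>Sigma (?V q) (\<lambda>v. symp_fiber u k v). w (q, p))"
    unfolding Sg_def by (subst sum.Sigma) (auto simp: finite_Par finite_symp_fiber)
  also have "\<dots> = (\<Sum>q\<in>?Q. \<Sum>v\<in>?V q. \<Sum>z\<in>symp_fiber u k v. w (q, v, z))"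
    by (intro sum.cong refl, subst sum.Sigma) (auto simp: finite_Par finite_symp_fiber)
  finally show ?thesis by (simp add: w_def sum_distrib_left)
qed

text \<open>Both sides obey the same recursion: \<open>x ^ u\<close> cancels the \<open>- u\<close>
  in the exponent of \<open>sum_symp_fiber_snoc\<close>, and the rest of the exponent is the sum of
  the two strip sizes in \<open>col_symp_snoc\<close>.\<close>

theorem symp_fiber_eq_col_symp:
  assumes "t \<in> Par (length xs) u" "\<And>x. x \<in> set xs \<Longrightarrow> x \<noteq> 0"
  shows "prod_list xs ^ u * (\<Sum>z\<in>symp_fiber u (length xs) t. symp_weight xs z) = col_symp u xs t"
  using assms
proof (induction xs arbitrary: t rule: rev_induct)
  case Nil
  have "z = (\<lambda>_ _. 0)" if "z \<in> symplectic_patterns 0" for z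
    using symplectic_patternsD(1)[OF that] by (intro ext) (simp add: pattern_index_def)
  then have "symp_fiber u 0 t = {\<lambda>_ _. 0}"
    by (auto simp: symp_fiber_def symplectic_patterns_def)
  then show ?case using Nil col_symp_Nil[of t 0 u] by (simp add: symp_weight_def Par_0)
next
  case (snoc x xs)
  let ?k = "length xs"
  have t: "t \<in> Par (Suc ?k) u" using snoc.prems by simp
  have x: "x \<noteq> 0" using snoc.prems by simp
  have IH: "prod_list xs ^ u * (\<Sum>z\<in>symp_fiber u ?k v. symp_weight xs z) = col_symp u xs v" if "v \<in> Par ?k u" for v
    by (rule snoc.IH[OF that]) (use snoc.prems in auto)
  have "prod_list (xs @ [x]) ^ u * (\<Sum>z\<in>symp_fiber u (length (xs @ [x])) t. symp_weight (xs @ [x]) z) =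
    (\<Sum>q\<in>{q \<in> Par (Suc ?k) u. interlaced t q}. \<Sum>v\<in>{v \<in> Par ?k u. interlaced v q}.
       x ^ u * x powi (2 * int (psize u q) - int (psize u t) - int (psize u v) - int u) *
       (prod_list xs ^ u * (\<Sum>z\<in>symp_fiber u ?k v. symp_weight xs z)))"
  proof -
    define M where "M v = (\<Sum>z\<in>symp_fiber u ?k v. symp_weight xs z)" for v
    have "(\<Sum>z\<in>symp_fiber u (length (xs @ [x])) t. symp_weight (xs @ [x]) z) =
      (\<Sum>q\<in>{q \<in> Par (Suc ?k) u. interlaced t q}. \<Sum>v\<in>{v \<in> Par ?k u. interlaced v q}.
       x powi (2 * int (psize u q) - int (psize u t) - int (psize u v) - int u) * M v)"
      using sum_symp_fiber_snoc[OF t refl, of x] by (simp add: M_def)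
    then show ?thesis
      unfolding M_def[symmetric] by (simp add: sum_distrib_left power_mult_distrib mult_ac)
  qed
  also have "\<dots> = (\<Sum>q\<in>{q \<in> Par (Suc ?k) u. interlaced t q}. \<Sum>v\<in>{v \<in> Par ?k u. interlaced v q}.
       x ^ (psize u q - psize u t) * x ^ (psize u q - psize u v) * col_symp u xs v)"
  proof (intro sum.cong refl)
    fix q v assume q: "q \<in> {q \<in> Par (Suc ?k) u. interlaced t q}" and v: "v \<in> {v \<in> Par ?k u. interlaced v q}"
    have mono: "psize u f \<le> psize u q" if "f \<in> Par (Suc ?k) u" "interlaced f q" for f
      using that q psize_eq_sum[of f "Suc ?k" u] psize_eq_sum[of q "Suc ?k" u]
      by (auto simp: interlaced_def intro!: add_mono sum_mono)
    have 1: "psize u t \<le> psize u q" using mono[OF t] q by simp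
    have 2: "psize u v \<le> psize u q" using mono[of v] v Par_mono[of v ?k u "Suc ?k"] by simp
    have pw: "x ^ u * x powi e = x powi (int u + e)" for e
      using x by (simp add: power_int_add)
    have "x ^ u * x powi (2 * int (psize u q) - int (psize u t) - int (psize u v) - int u) =
       x powi (int u + (2 * int (psize u q) - int (psize u t) - int (psize u v) - int u))"
      by (rule pw)
    also have "\<dots> = x powi (int (psize u q - psize u t) + int (psize u q - psize u v))"
      using 1 2 by (simp add: of_nat_diff)
    also have "\<dots> = x ^ (psize u q - psize u t) * x ^ (psize u q - psize u v)"
      using x by (simp add: power_int_add)
    finally show "x ^ u * x powi (2 * int (psize u q) - int (psize u t) - int (psize u v) - int u) *
       (prod_list xs ^ u * (\<Sum>z\<in>symp_fiber u ?k v. symp_weight xs z)) =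
       x ^ (psize u q - psize u t) * x ^ (psize u q - psize u v) * col_symp u xs v"
      using IH v by simp
  qed
  also have "\<dots> = col_symp u (xs @ [x]) t"
    by (rule col_symp_snoc[OF t refl, symmetric])
  finally show ?case .
qed

section \<open>Last passage percolation on the half triangle\<close>

text \<open>For \<open>s = 2 * n + 1\<close> this is a fundamental domain of the two reflections of
  the square; a general \<open>s\<close> is needed for growing it one antidiagonal at a
  time.\<close>

definition half_triangle :: "nat \<Rightarrow> (nat \<times> nat) set" where
  "half_triangle s = {(i, j). 1 \<le> i \<and> i \<le> j \<and> i + j \<le> s}"

text \<open>An array on the half triangle is read as a symmetric array on the whole triangle.\<close>

definition sym_entry :: "(nat \<Rightarrow> nat \<Rightarrow> nat) \<Rightarrow> nat \<Rightarrow> nat \<Rightarrow> nat" where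
  "sym_entry t i j = t (min i j) (max i j)"

text \<open>\<open>lo\<close> and \<open>hi\<close> bound the interval which the neighbours leave to
  a cell of a monotone array; a toggle reflects the entry in this interval. Row and column 0 read as
  0.\<close>

definition lo :: "(nat \<Rightarrow> nat \<Rightarrow> nat) \<Rightarrow> nat \<Rightarrow> nat \<Rightarrow> nat" where
  "lo t i j = max (sym_entry t (i - 1) j) (sym_entry t i (j - 1))"

definition hi :: "(nat \<Rightarrow> nat \<Rightarrow> nat) \<Rightarrow> nat \<Rightarrow> nat \<Rightarrow> nat" where
  "hi t i j = min (sym_entry t (i + 1) j) (sym_entry t i (j + 1))"

definition monotone_arrays :: "nat \<Rightarrow> nat \<Rightarrow> (nat \<Rightarrow> nat \<Rightarrow> nat) set" where
  "monotone_arrays s u = {t. (\<forall>i j. (i, j) \<notin> half_triangle s \<longrightarrow> t i j = 0) \<and>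
     (\<forall>i j. (i, j) \<in> half_triangle s \<longrightarrow> lo t i j \<le> t i j) \<and> (\<forall>i j. t i j \<le> u)}"

text \<open>The step from \<open>s\<close> to \<open>s + 1\<close> of the Robinson--Schensted--Knuth correspondence in its local form: new
  cells on the line \<open>i + j = s + 1\<close> and toggles at the old cells of the same parity.\<close>

definition toggle_up :: "nat \<Rightarrow> (nat \<Rightarrow> nat \<Rightarrow> nat) \<Rightarrow> (nat \<Rightarrow> nat \<Rightarrow> nat) \<Rightarrow> nat \<Rightarrow> nat \<Rightarrow> nat" where
  "toggle_up s t w = (\<lambda>i j. if (i, j) \<in> half_triangle (Suc s) then
      (if i + j = Suc s then lo t i j + w i j
       else if even (i + j + s) then t i j else lo t i j + hi t i j - t i j) else 0)"

definition toggle_down :: "nat \<Rightarrow> (nat \<Rightarrow> nat \<Rightarrow> nat) \<Rightarrow> nat \<Rightarrow> nat \<Rightarrow> nat" where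
  "toggle_down s t = (\<lambda>i j. if (i, j) \<in> half_triangle s then
      (if even (i + j + s) then t i j else lo t i j + hi t i j - t i j) else 0)"

lemma monotone_arraysD:
  assumes "t \<in> monotone_arrays s u"
  shows "(i, j) \<notin> half_triangle s \<Longrightarrow> t i j = 0" "(i, j) \<in> half_triangle s \<Longrightarrow> lo t i j \<le> t i j" "t i j \<le> u"
  using assms unfolding monotone_arrays_def by blast+

lemma half_triangle_mono: "s \<le> s' \<Longrightarrow> (i, j) \<in> half_triangle s \<Longrightarrow> (i, j) \<in> half_triangle s'"
  by (auto simp: half_triangle_def)

lemma sym_entry_zero:
  assumes "\<And>i j. (i, j) \<notin> half_triangle s \<Longrightarrow> t i j = 0"
  shows "sym_entry t 0 j = 0" "sym_entry t i 0 = 0"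
  using assms by (simp_all add: sym_entry_def half_triangle_def)

lemma sym_entry_diag: "sym_entry t (Suc i) i = sym_entry t i (Suc i)"
  by (simp add: sym_entry_def)

lemma monotone_arrays_hi:
  assumes "t \<in> monotone_arrays s u" "(i, j) \<in> half_triangle s" "i + j < s"
  shows "t i j \<le> hi t i j"
proof -
  have ij: "1 \<le> i" "i \<le> j" using assms by (auto simp: half_triangle_def)
  have "t i j = sym_entry t i j" using ij by (simp add: sym_entry_def)
  have right: "t i j \<le> sym_entry t i (j + 1)"
  proof -
    have "t i j \<le> lo t i (j + 1)" using ij by (simp add: lo_def sym_entry_def)
    also have "\<dots> \<le> t i (j + 1)"
      by (rule monotone_arraysD(2)[OF assms(1)]) (use assms in \<open>simp add: half_triangle_def\<close>)
    finally show ?thesis using ij by (simp add: sym_entry_def)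
  qed
  have "t i j \<le> sym_entry t (i + 1) j"
  proof (cases "i = j")
    case True
    then show ?thesis using right sym_entry_diag[of t i] by simp
  next
    case False
    then have "i + 1 \<le> j" using ij by simp
    have "t i j \<le> lo t (i + 1) j" using ij by (simp add: lo_def sym_entry_def)
    also have "\<dots> \<le> t (i + 1) j"
      by (rule monotone_arraysD(2)[OF assms(1)]) (use assms \<open>i + 1 \<le> j\<close> in \<open>simp add: half_triangle_def\<close>)
    finally show ?thesis using \<open>i + 1 \<le> j\<close> by (simp add: sym_entry_def)
  qed
  with right show ?thesis by (simp add: hi_def)
qed

lemma hi_le:
  assumes "t \<in> monotone_arrays s u"
  shows "hi t i j \<le> u"
  using monotone_arraysD(3)[OF assms] unfolding hi_def sym_entry_def by (meson min.coboundedI1)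

text \<open>Entries at cells of the parity opposite to \<open>s\<close> only interact with entries at cells of the
  parity of \<open>s\<close>, which the toggles leave alone.\<close>

lemma lo_cong:
  assumes "\<And>i j. even (i + j + s) \<Longrightarrow> i + j \<le> s \<Longrightarrow> t i j = t' i j"
    "odd (i + j + s)" "i + j \<le> Suc s" "1 \<le> i" "1 \<le> j"
  shows "lo t i j = lo t' i j"
proof -
  have S: "sym_entry t a b = sym_entry t' a b" if "even (a + b + s)" "a + b \<le> s" for a b
  proof -
    have "min a b + max a b = a + b" by (simp add: min_def max_def)
    then show ?thesis using that assms(1)[of "min a b" "max a b"] by (simp add: sym_entry_def)
  qed
  have "even (i - 1 + j + s)" "even (i + (j - 1) + s)"
    using assms by auto
  then have "sym_entry t (i - 1) j = sym_entry t' (i - 1) j" "sym_entry t i (j - 1) = sym_entry t' i (j - 1)"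
    using assms(3-5) by (auto intro!: S)
  then show ?thesis by (simp add: lo_def)
qed

lemma hi_cong:
  assumes "\<And>i j. even (i + j + s) \<Longrightarrow> i + j \<le> s \<Longrightarrow> t i j = t' i j"
    "odd (i + j + s)" "i + j < s"
  shows "hi t i j = hi t' i j"
proof -
  have S: "sym_entry t a b = sym_entry t' a b" if "even (a + b + s)" "a + b \<le> s" for a b
  proof -
    have "min a b + max a b = a + b" by (simp add: min_def max_def)
    then show ?thesis using that assms(1)[of "min a b" "max a b"] by (simp add: sym_entry_def)
  qed
  have "sym_entry t (i + 1) j = sym_entry t' (i + 1) j" "sym_entry t i (j + 1) = sym_entry t' i (j + 1)"
    using assms(2,3) by (auto intro!: S)
  then show ?thesis by (simp add: hi_def)
qed

lemma toggle_up_same: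
  assumes "t \<in> monotone_arrays s u" "even (i + j + s)" "i + j \<le> s"
  shows "toggle_up s t w i j = t i j"
  using assms monotone_arraysD(1)[OF assms(1), of i j]
  by (auto simp: toggle_up_def half_triangle_def)

lemma toggle_down_same:
  assumes "t \<in> monotone_arrays (Suc s) u" "even (i + j + s)" "i + j \<le> s"
  shows "toggle_down s t i j = t i j"
  using assms monotone_arraysD(1)[OF assms(1), of i j]
  by (auto simp: toggle_down_def half_triangle_def)

lemma lo_le_of_neighbours:
  assumes "(i, j) \<in> half_triangle s"
    "\<And>a b. (a, b) \<in> half_triangle s \<Longrightarrow> Suc (a + b) = i + j \<Longrightarrow>
       (a + 1 = i \<and> b = j \<or> a = i \<and> b + 1 = j) \<Longrightarrow> t a b \<le> x"
    "\<And>i j. (i, j) \<notin> half_triangle s \<Longrightarrow> t i j = 0"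
  shows "lo t i j \<le> x"
proof -
  have ij: "1 \<le> i" "i \<le> j" "i + j \<le> s" using assms by (auto simp: half_triangle_def)
  have 1: "sym_entry t (i - 1) j \<le> x"
  proof (cases "i = 1")
    case True
    then show ?thesis using sym_entry_zero(1)[OF assms(3)] by simp
  next
    case False
    then have "t (i - 1) j \<le> x" using ij by (intro assms(2)) (auto simp: half_triangle_def)
    then show ?thesis using ij by (simp add: sym_entry_def)
  qed
  have 2: "sym_entry t i (j - 1) \<le> x"
  proof (cases "i = j")
    case True
    then show ?thesis using 1 ij by (simp add: sym_entry_def min.commute max.commute)
  next
    case False
    then have "t i (j - 1) \<le> x" using ij by (intro assms(2)) (auto simp: half_triangle_def)
    then show ?thesis using ij False by (simp add: sym_entry_def)
  qed
  from 1 2 show ?thesis by (simp add: lo_def)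
qed

lemma hi_le_right: "i \<le> j \<Longrightarrow> hi t i j \<le> t i (j + 1)"
  by (simp add: hi_def sym_entry_def)

lemma hi_le_up: "i + 1 \<le> j \<Longrightarrow> hi t i j \<le> t (i + 1) j"
  by (simp add: hi_def sym_entry_def)

text \<open>A toggled entry stays between \<open>lo\<close> and \<open>hi\<close>, which are read
  off untouched cells, so monotonicity holds on both sides of it and \<open>u\<close> still bounds
  it. For the new line the bound comes from the assumption on \<open>w\<close>.\<close>

lemma toggle_up_in:
  assumes t: "t \<in> monotone_arrays s u"
    and w: "\<And>i j. (i, j) \<in> half_triangle (Suc s) \<Longrightarrow> i + j = Suc s \<Longrightarrow> lo t i j + w i j \<le> u"
  shows "toggle_up s t w \<in> monotone_arrays (Suc s) u"
proof -
  let ?t = "toggle_up s t w"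
  have z: "?t i j = 0" if "(i, j) \<notin> half_triangle (Suc s)" for i j
    using that by (simp add: toggle_up_def)
  have odd_val: "?t i j = lo t i j + hi t i j - t i j \<and> lo t i j \<le> t i j \<and> t i j \<le> hi t i j"
    if "(i, j) \<in> half_triangle (Suc s)" "odd (i + j + s)" "i + j \<noteq> Suc s" for i j
  proof -
    have "i + j \<noteq> s" using that(2) by (metis even_add)
    then have 1: "i + j < s" "(i, j) \<in> half_triangle s" using that by (auto simp: half_triangle_def)
    then show ?thesis
      using that monotone_arraysD(2)[OF t] monotone_arrays_hi[OF t] by (simp add: toggle_up_def)
  qed
  have lo: "lo ?t i j \<le> ?t i j" if ij: "(i, j) \<in> half_triangle (Suc s)" for i j
  proof (cases "even (i + j + s)")
    case False
    have "lo ?t i j = lo t i j"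
      by (rule lo_cong[of s]) (use False ij toggle_up_same[OF t] in \<open>auto simp: half_triangle_def\<close>)
    then show ?thesis
    proof (cases "i + j = Suc s")
      case True
      then show ?thesis using \<open>lo ?t i j = lo t i j\<close> ij by (simp add: toggle_up_def)
    next
      case neq: False
      show ?thesis using odd_val[OF ij False neq] \<open>lo ?t i j = lo t i j\<close> by auto
    qed
  next
    case True
    have "i + j \<noteq> Suc s"
    proof
      assume "i + j = Suc s"
      with True show False by simp
    qed
    then have ijs: "i + j \<le> s" using ij by (auto simp: half_triangle_def)
    have same: "?t i j = t i j" by (rule toggle_up_same[OF t True ijs])
    show ?thesis unfolding same
    proof (rule lo_le_of_neighbours[OF ij _ z])
      fix a b assume ab: "(a, b) \<in> half_triangle (Suc s)" "Suc (a + b) = i + j" "a + 1 = i \<and> b = j \<or> a = i \<and> b + 1 = j"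
      have odd: "odd (a + b + s)" using ab(2) True by (metis add_Suc even_Suc)
      have "?t a b \<le> hi t a b"
        using odd_val[OF ab(1) odd] ab(2) ijs by auto
      also have "hi t a b \<le> t i j"
        using ab hi_le_right[of a b t] hi_le_up[of a b t] ij by (auto simp: half_triangle_def)
      finally show "?t a b \<le> t i j" .
    qed
  qed
  have le: "?t i j \<le> u" for i j
  proof (cases "(i, j) \<in> half_triangle (Suc s)")
    case True
    consider "i + j = Suc s" | "i + j \<noteq> Suc s" "even (i + j + s)" | "i + j \<noteq> Suc s" "odd (i + j + s)" by blast
    then show ?thesis
    proof cases
      case 1
      then show ?thesis using w[OF True] True by (simp add: toggle_up_def)
    next
      case 2
      then show ?thesis using True monotone_arraysD(3)[OF t, of i j] by (simp add: toggle_up_def)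
    next
      case 3
      then have "?t i j \<le> hi t i j" using odd_val[OF True] by auto
      then show ?thesis using hi_le[OF t, of i j] by simp
    qed
  qed (simp add: z)
  show ?thesis unfolding monotone_arrays_def using z lo le by blast
qed

lemma toggle_down_in:
  assumes t: "t \<in> monotone_arrays (Suc s) u"
  shows "toggle_down s t \<in> monotone_arrays s u"
proof -
  let ?t = "toggle_down s t"
  have z: "?t i j = 0" if "(i, j) \<notin> half_triangle s" for i j
    using that by (simp add: toggle_down_def)
  have odd_val: "?t i j = lo t i j + hi t i j - t i j \<and> lo t i j \<le> t i j \<and> t i j \<le> hi t i j"
    if ij: "(i, j) \<in> half_triangle s" "odd (i + j + s)" for i j
  proof -
    have 1: "i + j < Suc s" "(i, j) \<in> half_triangle (Suc s)" using ij by (auto simp: half_triangle_def)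
    then show ?thesis
      using ij monotone_arraysD(2)[OF t] monotone_arrays_hi[OF t] by (simp add: toggle_down_def)
  qed
  have lo: "lo ?t i j \<le> ?t i j" if ij: "(i, j) \<in> half_triangle s" for i j
  proof (cases "even (i + j + s)")
    case False
    have "lo ?t i j = lo t i j"
      by (rule lo_cong[of s]) (use False ij toggle_down_same[OF t] in \<open>auto simp: half_triangle_def\<close>)
    then show ?thesis using odd_val[OF ij False] by auto
  next
    case True
    have ijs: "i + j \<le> s" using ij by (auto simp: half_triangle_def)
    have same: "?t i j = t i j" by (rule toggle_down_same[OF t True ijs])
    show ?thesis unfolding same
    proof (rule lo_le_of_neighbours[OF ij _ z])
      fix a b assume ab: "(a, b) \<in> half_triangle s" "Suc (a + b) = i + j" "a + 1 = i \<and> b = j \<or> a = i \<and> b + 1 = j"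
      have odd: "odd (a + b + s)" using ab(2) True by (metis add_Suc even_Suc)
      have "?t a b \<le> hi t a b"
        using odd_val[OF ab(1) odd] by auto
      also have "hi t a b \<le> t i j"
        using ab hi_le_right[of a b t] hi_le_up[of a b t] ij by (auto simp: half_triangle_def)
      finally show "?t a b \<le> t i j" .
    qed
  qed
  have le: "?t i j \<le> u" for i j
  proof (cases "(i, j) \<in> half_triangle s")
    case True
    show ?thesis
    proof (cases "even (i + j + s)")
      case even: True
      then show ?thesis using True monotone_arraysD(3)[OF t, of i j] by (simp add: toggle_down_def)
    next
      case False
      then have "?t i j \<le> hi t i j" using odd_val[OF True] by auto
      then show ?thesis using hi_le[OF t, of i j] by simp
    qed
  qed (simp add: z)
  show ?thesis unfolding monotone_arrays_def using z lo le by blast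
qed

lemma toggle_down_up:
  assumes t: "t \<in> monotone_arrays s u"
  shows "toggle_down s (toggle_up s t w) = t"
proof (intro ext)
  fix i j
  let ?t = "toggle_up s t w"
  show "toggle_down s ?t i j = t i j"
  proof (cases "(i, j) \<in> half_triangle s")
    case True
    then have ij: "1 \<le> i" "1 \<le> j" "i + j \<le> s" "(i, j) \<in> half_triangle (Suc s)" by (auto simp: half_triangle_def)
    show ?thesis
    proof (cases "even (i + j + s)")
      case even: True
      then show ?thesis using True toggle_up_same[OF t even ij(3)] by (simp add: toggle_down_def)
    next
      case False
      have "i + j \<noteq> s" using False by (metis even_add)
      then have lt: "i + j < s" using ij by simp
      have "lo ?t i j = lo t i j"
        by (rule lo_cong[of s]) (use False ij toggle_up_same[OF t] in auto)
      moreover have "hi ?t i j = hi t i j"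
        by (rule hi_cong[of s]) (use False lt toggle_up_same[OF t] in auto)
      moreover have "?t i j = lo t i j + hi t i j - t i j"
        using False ij lt by (simp add: toggle_up_def)
      moreover have "lo t i j \<le> t i j" "t i j \<le> hi t i j"
        using monotone_arraysD(2)[OF t True] monotone_arrays_hi[OF t True lt] by auto
      ultimately show ?thesis using True False by (simp add: toggle_down_def)
    qed
  next
    case False
    then show ?thesis using monotone_arraysD(1)[OF t False] by (simp add: toggle_down_def)
  qed
qed

lemma lo_toggle_down:
  assumes t: "t \<in> monotone_arrays (Suc s) u" and ij: "(i, j) \<in> half_triangle (Suc s)" and "odd (i + j + s)"
  shows "lo (toggle_down s t) i j = lo t i j"
  by (rule lo_cong[of s]) (use assms toggle_down_same[OF t] in \<open>auto simp: half_triangle_def\<close>)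

lemma toggle_up_down:
  assumes t: "t \<in> monotone_arrays (Suc s) u"
    and w: "\<And>i j. (i, j) \<in> half_triangle (Suc s) \<Longrightarrow> i + j = Suc s \<Longrightarrow> w i j = t i j - lo t i j"
  shows "toggle_up s (toggle_down s t) w = t"
proof (intro ext)
  fix i j
  let ?t = "toggle_down s t"
  show "toggle_up s ?t w i j = t i j"
  proof (cases "(i, j) \<in> half_triangle (Suc s)")
    case True
    then have ij: "1 \<le> i" "1 \<le> j" "i + j \<le> Suc s" by (auto simp: half_triangle_def)
    have le: "lo t i j \<le> t i j" by (rule monotone_arraysD(2)[OF t True])
    consider "i + j = Suc s" | "i + j \<noteq> Suc s" "even (i + j + s)" | "i + j \<noteq> Suc s" "odd (i + j + s)" by blast
    then show ?thesis
    proof cases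
      case 1
      then have "odd (i + j + s)" by simp
      then have "lo ?t i j = lo t i j" by (rule lo_toggle_down[OF t True])
      then show ?thesis using 1 True le w[OF True 1] by (simp add: toggle_up_def)
    next
      case 2
      then have "?t i j = t i j" using ij by (intro toggle_down_same[OF t]) auto
      then show ?thesis using 2 True by (simp add: toggle_up_def)
    next
      case 3
      then have "i + j \<noteq> s" by (metis even_add)
      then have lt: "i + j < s" using 3 ij by simp
      have in_s: "(i, j) \<in> half_triangle s" using True lt by (auto simp: half_triangle_def)
      have "lo ?t i j = lo t i j" by (rule lo_toggle_down[OF t True 3(2)])
      moreover have "hi ?t i j = hi t i j"
        by (rule hi_cong[of s]) (use 3 lt toggle_down_same[OF t] in auto)
      moreover have "?t i j = lo t i j + hi t i j - t i j"
        using 3 in_s by (simp add: toggle_down_def)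
      moreover have "t i j \<le> hi t i j"
        using monotone_arrays_hi[OF t True] lt by simp
      ultimately show ?thesis using True 3 le by (simp add: toggle_up_def)
    qed
  next
    case False
    then show ?thesis using monotone_arraysD(1)[OF t False] by (simp add: toggle_up_def)
  qed
qed

section \<open>The local correspondence and passage times\<close>

primrec toggles :: "nat \<Rightarrow> (nat \<Rightarrow> nat \<Rightarrow> nat) \<Rightarrow> nat \<Rightarrow> nat \<Rightarrow> nat" where
  "toggles 0 w = (\<lambda>_ _. 0)"
| "toggles (Suc s) w = toggle_up s (toggles s w) w"

text \<open>Passage times through the symmetric extension of \<open>w\<close>, so that the recursion
  has the same form on the diagonal as off it.\<close>

function lpp :: "(nat \<Rightarrow> nat \<Rightarrow> nat) \<Rightarrow> nat \<Rightarrow> nat \<Rightarrow> nat" where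
  "lpp w i j = (if i = 0 \<or> j = 0 then 0 else max (lpp w (i - 1) j) (lpp w i (j - 1)) + sym_entry w i j)"
  by auto
termination by (relation "Wellfounded.measure (\<lambda>(w, i, j). i + j)") auto

declare lpp.simps [simp del]

lemma sym_entry_commute: "sym_entry w i j = sym_entry w j i"
  by (simp add: sym_entry_def min.commute max.commute)

lemma lpp_zero: "lpp w 0 j = 0" "lpp w i 0 = 0"
  by (subst lpp.simps, simp)+

lemma lpp_step: "0 < i \<Longrightarrow> 0 < j \<Longrightarrow> lpp w i j = max (lpp w (i - 1) j) (lpp w i (j - 1)) + sym_entry w i j"
  by (subst lpp.simps) simp

lemma lpp_commute: "lpp w i j = lpp w j i"
proof (induction "i + j" arbitrary: i j rule: less_induct)
  case less
  show ?case
  proof (cases "i = 0 \<or> j = 0")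
    case True
    then show ?thesis by (auto simp: lpp_zero)
  next
    case False
    have "lpp w (i - 1) j = lpp w j (i - 1)" "lpp w i (j - 1) = lpp w (j - 1) i"
      using False by (intro less; simp)+
    then show ?thesis
      using False by (simp add: lpp_step max.commute sym_entry_commute[of w i j])
  qed
qed

lemma toggles_zero: "(i, j) \<notin> half_triangle s \<Longrightarrow> toggles s w i j = 0"
  by (cases s) (simp_all add: toggle_up_def)

text \<open>A new cell receives the maximum of its two predecessors on the previous antidiagonal
  plus its weight, which is the recursion of \<open>lpp\<close>. Later toggles destroy this at inner
  cells, so the statement concerns only the outer line.\<close>

lemma toggles_top: "(i, j) \<in> half_triangle s \<Longrightarrow> i + j = s \<Longrightarrow> toggles s w i j = lpp w i j"
proof (induction s arbitrary: i j)
  case (Suc s)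
  have ij: "1 \<le> i" "i \<le> j" using Suc.prems by (auto simp: half_triangle_def)
  have val: "sym_entry (toggles s w) a b = lpp w a b" if "a + b = s" for a b
  proof (cases "a = 0 \<or> b = 0")
    case True
    then have "sym_entry (toggles s w) a b = 0"
      by (auto simp: sym_entry_def toggles_zero half_triangle_def)
    then show ?thesis using True by (auto simp: lpp_zero)
  next
    case False
    have "toggles s w (min a b) (max a b) = lpp w (min a b) (max a b)"
      using that False by (intro Suc.IH) (auto simp: half_triangle_def min_def max_def)
    then show ?thesis by (simp add: sym_entry_def lpp_commute[of w b a] min_def max_def)
  qed
  have "lo (toggles s w) i j = max (lpp w (i - 1) j) (lpp w i (j - 1))"
    using ij Suc.prems(2) by (simp add: lo_def val)
  then show ?case
    using Suc.prems ij by (simp add: toggle_up_def lpp_step sym_entry_def)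
qed (simp add: half_triangle_def)

lemma toggles_cong:
  "(\<And>i j. (i, j) \<in> half_triangle s \<Longrightarrow> w i j = w' i j) \<Longrightarrow> toggles s w = toggles s w'"
proof (induction s)
  case (Suc s)
  have eq: "toggles s w = toggles s w'"
    by (rule Suc.IH) (use Suc.prems half_triangle_mono[of s "Suc s"] in auto)
  show ?case unfolding toggles.simps eq
    using Suc.prems by (intro ext) (simp add: toggle_up_def)
qed simp

lemma lpp_cong:
  "(\<And>i j. (i, j) \<in> half_triangle s \<Longrightarrow> w i j = w' i j) \<Longrightarrow> i + j \<le> s \<Longrightarrow> lpp w i j = lpp w' i j"
proof (induction "i + j" arbitrary: i j rule: less_induct)
  case less
  show ?case
  proof (cases "i = 0 \<or> j = 0")
    case True
    then show ?thesis by (auto simp: lpp_zero)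
  next
    case False
    have "lpp w (i - 1) j = lpp w' (i - 1) j" "lpp w i (j - 1) = lpp w' i (j - 1)"
      using False less.prems by (intro less; simp)+
    moreover have "sym_entry w i j = sym_entry w' i j"
      unfolding sym_entry_def using False less.prems(2)
      by (intro less.prems(1)) (auto simp: half_triangle_def min_def max_def)
    ultimately show ?thesis using False by (simp add: lpp_step)
  qed
qed

definition lpp_bounded :: "nat \<Rightarrow> nat \<Rightarrow> (nat \<Rightarrow> nat \<Rightarrow> nat) set" where
  "lpp_bounded s u = {w. (\<forall>i j. (i, j) \<notin> half_triangle s \<longrightarrow> w i j = 0) \<and>
     (\<forall>i j. (i, j) \<in> half_triangle s \<longrightarrow> lpp w i j \<le> u)}"

definition restrict_triangle :: "nat \<Rightarrow> (nat \<Rightarrow> nat \<Rightarrow> nat) \<Rightarrow> nat \<Rightarrow> nat \<Rightarrow> nat" where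
  "restrict_triangle s w = (\<lambda>i j. if (i, j) \<in> half_triangle s then w i j else 0)"

lemma restrict_in: "w \<in> lpp_bounded (Suc s) u \<Longrightarrow> restrict_triangle s w \<in> lpp_bounded s u"
proof -
  assume w: "w \<in> lpp_bounded (Suc s) u"
  have "lpp (restrict_triangle s w) i j = lpp w i j" if "(i, j) \<in> half_triangle s" for i j
    by (rule lpp_cong[of s]) (use that in \<open>auto simp: restrict_triangle_def half_triangle_def\<close>)
  then show ?thesis
    using w half_triangle_mono[of s "Suc s"] by (auto simp: lpp_bounded_def restrict_triangle_def)
qed

lemma toggles_restrict: "toggles s (restrict_triangle s w) = toggles s w"
  by (rule toggles_cong) (simp add: restrict_triangle_def)

text \<open>A step can be undone: on the new line the weight is \<open>t - lo t\<close>, where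
  \<open>lo t\<close> reads only cells that the toggles leave alone, and \<open>toggle_down\<close>
  returns the previous array. The bounds match because the new line carries passage times and
  toggled entries stay below old ones.\<close>

theorem bij_betw_toggles: "bij_betw (toggles s) (lpp_bounded s u) (monotone_arrays s u)"
proof (induction s)
  case 0
  have "half_triangle 0 = {}" by (auto simp: half_triangle_def)
  then have "lpp_bounded 0 u = {\<lambda>_ _. 0}" "monotone_arrays 0 u = {\<lambda>_ _. 0}"
    by (auto simp: lpp_bounded_def monotone_arrays_def fun_eq_iff)
  then show ?case by (simp add: bij_betw_def)
next
  case (Suc s)
  have IH_in: "toggles s w \<in> monotone_arrays s u" if "w \<in> lpp_bounded (Suc s) u" for w
    using bij_betwE[OF Suc] restrict_in[OF that] toggles_restrict by metis
  show ?case
    unfolding bij_betw_def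
  proof
    show "inj_on (toggles (Suc s)) (lpp_bounded (Suc s) u)"
    proof (rule inj_onI)
      fix w w' assume w: "w \<in> lpp_bounded (Suc s) u" "w' \<in> lpp_bounded (Suc s) u"
        and eq: "toggles (Suc s) w = toggles (Suc s) w'"
      have eq': "toggles s w = toggles s w'"
        using eq toggle_down_up[OF IH_in[OF w(1)]] toggle_down_up[OF IH_in[OF w(2)]] by (metis toggles.simps(2))
      then have "toggles s (restrict_triangle s w) = toggles s (restrict_triangle s w')" by (simp only: toggles_restrict)
      then have r: "restrict_triangle s w = restrict_triangle s w'"
        using bij_betw_imp_inj_on[OF Suc] restrict_in w by (metis inj_onD)
      show "w = w'"
      proof (intro ext)
        fix i j
        consider "(i, j) \<in> half_triangle s" | "(i, j) \<in> half_triangle (Suc s)" "i + j = Suc s" | "(i, j) \<notin> half_triangle (Suc s)"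
          by (auto simp: half_triangle_def) linarith
        then show "w i j = w' i j"
        proof cases
          case 1
          then show ?thesis using fun_cong[OF fun_cong[OF r, of i], of j] by (simp add: restrict_triangle_def)
        next
          case 2
          then show ?thesis using fun_cong[OF fun_cong[OF eq, of i], of j] eq' by (simp add: toggle_up_def)
        next
          case 3
          then show ?thesis using w by (simp add: lpp_bounded_def)
        qed
      qed
    qed
    show "toggles (Suc s) ` lpp_bounded (Suc s) u = monotone_arrays (Suc s) u"
    proof (intro equalityI subsetI)
      fix t assume "t \<in> toggles (Suc s) ` lpp_bounded (Suc s) u"
      then obtain w where w: "w \<in> lpp_bounded (Suc s) u" "t = toggles (Suc s) w" by blast
      have "lo (toggles s w) i j + w i j \<le> u" if "(i, j) \<in> half_triangle (Suc s)" "i + j = Suc s" for i j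
      proof -
        have "lo (toggles s w) i j + w i j = lpp w i j"
          using toggles_top[OF that, of w] that by (simp add: toggle_up_def)
        then show ?thesis using w(1) that by (simp add: lpp_bounded_def)
      qed
      then show "t \<in> monotone_arrays (Suc s) u"
        using toggle_up_in[OF IH_in[OF w(1)], of w] w(2) by simp
    next
      fix t assume t: "t \<in> monotone_arrays (Suc s) u"
      obtain w0 where w0: "w0 \<in> lpp_bounded s u" "toggles s w0 = toggle_down s t"
        using toggle_down_in[OF t] bij_betw_imp_surj_on[OF Suc] by (metis imageE)
      define w where "w i j = (if (i, j) \<in> half_triangle (Suc s) \<and> i + j = Suc s then t i j - lo t i j else w0 i j)" for i j
      have agree: "w i j = w0 i j" if "(i, j) \<in> half_triangle s" for i j
        using that by (auto simp: w_def half_triangle_def)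
      have ts: "toggles s w = toggle_down s t"
        using toggles_cong[of s w w0] agree w0(2) by simp
      have tt: "toggles (Suc s) w = t"
        unfolding toggles.simps ts by (rule toggle_up_down[OF t]) (simp add: w_def)
      have "w \<in> lpp_bounded (Suc s) u"
        unfolding lpp_bounded_def
      proof (intro CollectI conjI allI impI)
        fix i j assume "(i, j) \<notin> half_triangle (Suc s)"
        then show "w i j = 0" using w0(1) half_triangle_mono[of s "Suc s" i j]
          by (auto simp: w_def lpp_bounded_def)
      next
        fix i j assume ij: "(i, j) \<in> half_triangle (Suc s)"
        show "lpp w i j \<le> u"
        proof (cases "i + j = Suc s")
          case True
          have "lpp w i j = t i j" using toggles_top[OF ij True, of w] tt by simp
          then show ?thesis using monotone_arraysD(3)[OF t] by simp
        next
          case False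
          then have "(i, j) \<in> half_triangle s" using ij by (auto simp: half_triangle_def)
          moreover have "lpp w i j = lpp w0 i j"
            by (rule lpp_cong[of s]) (use agree False ij in \<open>auto simp: half_triangle_def\<close>)
          ultimately show ?thesis using w0(1) by (simp add: lpp_bounded_def)
        qed
      qed
      then show "t \<in> toggles (Suc s) ` lpp_bounded (Suc s) u" using tt by blast
    qed
  qed
qed

section \<open>Diagonal sums and row sums\<close>

definition diagonal_sum :: "nat \<Rightarrow> nat \<Rightarrow> (nat \<Rightarrow> nat \<Rightarrow> nat) \<Rightarrow> nat" where
  "diagonal_sum N d t = (\<Sum>k<N. t (Suc k) (Suc k + d))"

lemma toggle_up_zero: "Suc s < i + j \<Longrightarrow> toggle_up s t w i j = 0"
  by (simp add: toggle_up_def half_triangle_def)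

lemma monotone_arrays_zero: "t \<in> monotone_arrays s u \<Longrightarrow> s < i + j \<Longrightarrow> t i j = 0"
  by (rule monotone_arraysD(1)) (auto simp: half_triangle_def)

text \<open>On one diagonal \<open>i + j\<close> always has the parity of \<open>d\<close>, so a
  step toggles a whole diagonal or none of it.\<close>

lemma diagonal_sum_toggle_up_even:
  assumes t: "t \<in> monotone_arrays s u" and "even (d + s)"
  shows "diagonal_sum N d (toggle_up s t w) = diagonal_sum N d t"
  unfolding diagonal_sum_def
proof (intro sum.cong refl)
  fix k
  have "Suc k + (Suc k + d) + s = 2 * Suc k + (d + s)" by simp
  then have even: "even (Suc k + (Suc k + d) + s)" using assms(2) by (metis dvd_triv_left even_add)
  show "toggle_up s t w (Suc k) (Suc k + d) = t (Suc k) (Suc k + d)"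
  proof (cases "Suc k + (Suc k + d) \<le> s")
    case True
    then show ?thesis by (rule toggle_up_same[OF t even])
  next
    case False
    have "Suc k + (Suc k + d) \<noteq> Suc s"
    proof
      assume "Suc k + (Suc k + d) = Suc s"
      with assms(2) show False by presburger
    qed
    then have "Suc s < Suc k + (Suc k + d)" using False by simp
    then show ?thesis using toggle_up_zero[of s "Suc k" "Suc k + d"] monotone_arrays_zero[OF t, of "Suc k" "Suc k + d"] by simp
  qed
qed

lemma diagonal_sum_trim:
  assumes "\<And>k. m \<le> k \<Longrightarrow> t (Suc k) (Suc k + d) = 0" "m \<le> N"
  shows "diagonal_sum N d t = (\<Sum>k<m. t (Suc k) (Suc k + d))"
  unfolding diagonal_sum_def by (rule sum.mono_neutral_right) (use assms in auto)

text \<open>With \<open>A\<close> and \<open>B\<close> running along the two neighbouring diagonals,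
  old and new entry at index \<open>k\<close> add up to the maximum of \<open>A\<close>,
  \<open>B\<close> at \<open>k\<close> plus their minimum at \<open>Suc k\<close>. Summed along the
  diagonal, maximum and minimum at equal indices recombine to \<open>A + B\<close>; the new cell
  supplies the last maximum, and the missing minimum at 0 is zero. For \<open>d = 0\<close> both
  neighbours are the diagonal at offset 1, by symmetry.\<close>

lemma diagonal_sum_toggle_up_odd:
  assumes t: "t \<in> monotone_arrays s u" and d: "2 * Suc m + d = Suc s" and N: "s \<le> N"
  shows "diagonal_sum N d (toggle_up s t w) + diagonal_sum N d t =
    diagonal_sum N (d + 1) t + diagonal_sum N (if d = 0 then 1 else d - 1) t + w (Suc m) (Suc m + d)"
proof -
  let ?t = "toggle_up s t w"
  define A where "A k = sym_entry t k (Suc k + d)" for k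
  define B where "B k = sym_entry t (Suc k) (k + d)" for k
  have odd: "odd (Suc k + (Suc k + d) + s)" for k
  proof -
    have "even (Suc s + d)" using d by (metis add.assoc dvd_add_triv_right_iff dvd_triv_left even_add)
    moreover have "Suc k + (Suc k + d) + s = 2 * k + (Suc s + d) + 1" by simp
    ultimately show ?thesis by (metis dvd_triv_left even_add odd_one)
  qed
  have lo: "lo t (Suc k) (Suc k + d) = max (A k) (B k)" for k
    by (simp add: lo_def A_def B_def)
  have hi: "hi t (Suc k) (Suc k + d) = min (A (Suc k)) (B (Suc k))" for k
    by (simp add: hi_def A_def B_def min.commute)
  have below: "?t (Suc k) (Suc k + d) + t (Suc k) (Suc k + d) = max (A k) (B k) + min (A (Suc k)) (B (Suc k))" if "k < m" for k
  proof -
    have in_s: "(Suc k, Suc k + d) \<in> half_triangle s" and lt: "Suc k + (Suc k + d) < s"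
      using that d by (auto simp: half_triangle_def)
    have "?t (Suc k) (Suc k + d) = lo t (Suc k) (Suc k + d) + hi t (Suc k) (Suc k + d) - t (Suc k) (Suc k + d)"
      using half_triangle_mono[OF _ in_s, of "Suc s"] lt odd[of k] by (simp add: toggle_up_def)
    moreover have "t (Suc k) (Suc k + d) \<le> hi t (Suc k) (Suc k + d)"
      by (rule monotone_arrays_hi[OF t in_s lt])
    ultimately show ?thesis unfolding lo hi by linarith
  qed
  have top: "?t (Suc m) (Suc m + d) = max (A m) (B m) + w (Suc m) (Suc m + d)"
    using d by (simp add: toggle_up_def half_triangle_def lo[symmetric])
  have top0: "t (Suc m) (Suc m + d) = 0"
    using d by (intro monotone_arrays_zero[OF t]) simp
  have mN: "Suc m \<le> N" using d N by simp
  have "diagonal_sum N d ?t + diagonal_sum N d t = (\<Sum>k<Suc m. ?t (Suc k) (Suc k + d)) + (\<Sum>k<Suc m. t (Suc k) (Suc k + d))"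
    using d by (subst (1 2) diagonal_sum_trim[OF _ mN])
       (auto intro!: toggle_up_zero monotone_arrays_zero[OF t])
  also have "\<dots> = (\<Sum>k<m. ?t (Suc k) (Suc k + d) + t (Suc k) (Suc k + d)) + max (A m) (B m) + w (Suc m) (Suc m + d)"
    by (simp add: top top0 sum.distrib del: add_Suc)
  also have "(\<Sum>k<m. ?t (Suc k) (Suc k + d) + t (Suc k) (Suc k + d)) = (\<Sum>k<m. max (A k) (B k) + min (A (Suc k)) (B (Suc k)))"
    by (intro sum.cong refl below) simp
  also have "\<dots> + max (A m) (B m) = (\<Sum>k<Suc m. max (A k) (B k)) + (\<Sum>k<m. min (A (Suc k)) (B (Suc k)))"
    by (simp add: sum.distrib)
  also have "(\<Sum>k<m. min (A (Suc k)) (B (Suc k))) = (\<Sum>k<Suc m. min (A k) (B k))"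
  proof -
    have "A 0 = 0" using monotone_arraysD(1)[OF t] unfolding A_def by (rule sym_entry_zero)
    then show ?thesis by (simp add: sum.lessThan_Suc_shift del: sum.lessThan_Suc)
  qed
  also have "(\<Sum>k<Suc m. max (A k) (B k)) + (\<Sum>k<Suc m. min (A k) (B k)) = (\<Sum>k<Suc m. A k) + (\<Sum>k<Suc m. B k)"
    unfolding sum.distrib[symmetric] by (intro sum.cong refl) (simp add: max_def min_def)
  also have SA: "(\<Sum>k<Suc m. A k) = diagonal_sum N (d + 1) t"
  proof -
    have "A 0 = 0" using monotone_arraysD(1)[OF t] unfolding A_def by (rule sym_entry_zero)
    then have "(\<Sum>k<Suc m. A k) = (\<Sum>k<m. t (Suc k) (Suc k + (d + 1)))"
      by (simp add: sum.lessThan_Suc_shift A_def sym_entry_def del: sum.lessThan_Suc)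
    also have "\<dots> = diagonal_sum N (d + 1) t"
      using mN d by (intro diagonal_sum_trim[symmetric]) (auto intro!: monotone_arrays_zero[OF t])
    finally show ?thesis .
  qed
  also have "(\<Sum>k<Suc m. B k) = diagonal_sum N (if d = 0 then 1 else d - 1) t"
  proof (cases d)
    case 0
    have "B k = A k" for k by (simp add: A_def B_def 0 sym_entry_commute)
    then show ?thesis using SA by (simp add: 0)
  next
    case (Suc e)
    have "B k = t (Suc k) (Suc k + e)" for k by (simp add: B_def Suc sym_entry_def)
    then have "(\<Sum>k<Suc m. B k) = (\<Sum>k<Suc m. t (Suc k) (Suc k + e))" by simp
    also have "\<dots> = diagonal_sum N e t"
      using mN d Suc by (intro diagonal_sum_trim[symmetric]) (auto intro!: monotone_arrays_zero[OF t])
    finally show ?thesis using Suc by simp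
  qed
  finally show ?thesis .
qed

text \<open>A negative offset names the mirrored diagonal of the symmetric array, so that one
  formula covers rows on both sides of its centre.\<close>

definition signed_diagonal_sum :: "nat \<Rightarrow> int \<Rightarrow> (nat \<Rightarrow> nat \<Rightarrow> nat) \<Rightarrow> int" where
  "signed_diagonal_sum N \<delta> t = int (diagonal_sum N (nat \<bar>\<delta>\<bar>) t)"

definition row_sum :: "nat \<Rightarrow> nat \<Rightarrow> (nat \<Rightarrow> nat \<Rightarrow> nat) \<Rightarrow> nat" where
  "row_sum s k w = (\<Sum>j<s - k. sym_entry w k (Suc j))"

lemma signed_diagonal_sum_toggle_up:
  assumes t: "t \<in> monotone_arrays s u" and k: "1 \<le> k" "k \<le> s" and N: "s \<le> N"
  defines "\<delta> \<equiv> int (Suc s) - 2 * int k"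
  shows "signed_diagonal_sum N \<delta> (toggle_up s t w) =
    signed_diagonal_sum N (\<delta> + 1) t + signed_diagonal_sum N (\<delta> - 1) t - signed_diagonal_sum N \<delta> t + int (sym_entry w k (Suc s - k))"
proof -
  define d where "d = nat \<bar>\<delta>\<bar>"
  define i where "i = min k (Suc s - k)"
  have i: "1 \<le> i" "2 * i + d = Suc s" "i + d = max k (Suc s - k)"
    using k by (auto simp: i_def d_def \<delta>_def min_def max_def)
  then obtain m where m: "i = Suc m" by (cases i) auto
  have "diagonal_sum N d (toggle_up s t w) + diagonal_sum N d t =
    diagonal_sum N (d + 1) t + diagonal_sum N (if d = 0 then 1 else d - 1) t + w (Suc m) (Suc m + d)"
    by (rule diagonal_sum_toggle_up_odd[OF t _ N]) (use i m in simp)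
  also have "w (Suc m) (Suc m + d) = sym_entry w k (Suc s - k)"
    using i(3) unfolding m[symmetric] by (simp add: sym_entry_def i_def)
  also have "diagonal_sum N (d + 1) t + diagonal_sum N (if d = 0 then 1 else d - 1) t =
     diagonal_sum N (nat \<bar>\<delta> + 1\<bar>) t + diagonal_sum N (nat \<bar>\<delta> - 1\<bar>) t"
  proof -
    consider "\<delta> = 0" | "\<delta> > 0" | "\<delta> < 0" by linarith
    then show ?thesis
    proof cases
      case 1
      then show ?thesis by (simp add: d_def)
    next
      case 2
      then have "nat \<bar>\<delta> + 1\<bar> = d + 1" "nat \<bar>\<delta> - 1\<bar> = d - 1" "d \<noteq> 0" by (auto simp: d_def)
      then show ?thesis by (simp only: if_False)
    next
      case 3
      then have "nat \<bar>\<delta> + 1\<bar> = d - 1" "nat \<bar>\<delta> - 1\<bar> = d + 1" "d \<noteq> 0" by (auto simp: d_def)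
      then show ?thesis by (simp only: if_False add.commute)
    qed
  qed
  finally show ?thesis unfolding signed_diagonal_sum_def d_def by linarith
qed

text \<open>The new cell of row \<open>k\<close> lies on the diagonal \<open>?\<delta>\<close>,
  which is toggled, while its neighbour \<open>?\<delta> + 1\<close> is not. The local rule
  therefore turns the difference of the sums at \<open>?\<delta>\<close> and
  \<open>?\<delta> + 1\<close> into the old difference at \<open>?\<delta> - 1\<close> and
  \<open>?\<delta>\<close>, plus the new weight.\<close>

lemma row_sum_toggles:
  assumes "w \<in> lpp_bounded s u" "1 \<le> k" "k \<le> s" "s \<le> N"
  shows "signed_diagonal_sum N (int s - 2 * int k) (toggles s w) - signed_diagonal_sum N (int s - 2 * int k + 1) (toggles s w) =
    int (row_sum s k w)"
  using assms
proof (induction s arbitrary: w)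
  case (Suc s)
  have w': "restrict_triangle s w \<in> lpp_bounded s u" by (rule restrict_in[OF Suc.prems(1)])
  have t: "toggles s w \<in> monotone_arrays s u"
    using bij_betwE[OF bij_betw_toggles[of s u]] w' toggles_restrict[of s w] by metis
  show ?case
  proof (cases "k = Suc s")
    case True
    have 0: "signed_diagonal_sum N \<delta> t' = 0" if "t' \<in> monotone_arrays (Suc s) u" "nat \<bar>\<delta>\<bar> \<ge> s" for \<delta> t'
      using that by (auto simp: signed_diagonal_sum_def diagonal_sum_def intro!: sum.neutral monotone_arrays_zero[OF that(1)])
    have "toggles (Suc s) w \<in> monotone_arrays (Suc s) u"
      using bij_betwE[OF bij_betw_toggles[of "Suc s" u]] Suc.prems(1) by blast
    then show ?thesis using True by (simp add: 0 row_sum_def del: toggles.simps)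
  next
    case False
    then have k: "k \<le> s" using Suc.prems by simp
    let ?\<delta> = "int (Suc s) - 2 * int k"
    have ev: "even (nat \<bar>?\<delta> + 1\<bar> + s)"
    proof -
      have "even (\<bar>?\<delta> + 1\<bar> + int s)" by simp
      then show ?thesis by (simp add: even_nat_iff)
    qed
    have 1: "signed_diagonal_sum N ?\<delta> (toggles (Suc s) w) = signed_diagonal_sum N (?\<delta> + 1) (toggles s w) +
        signed_diagonal_sum N (?\<delta> - 1) (toggles s w) - signed_diagonal_sum N ?\<delta> (toggles s w) + int (sym_entry w k (Suc s - k))"
      unfolding toggles.simps by (rule signed_diagonal_sum_toggle_up[OF t Suc.prems(2) k]) (use Suc.prems in simp)
    have 2: "signed_diagonal_sum N (?\<delta> + 1) (toggles (Suc s) w) = signed_diagonal_sum N (?\<delta> + 1) (toggles s w)"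
      unfolding toggles.simps signed_diagonal_sum_def using diagonal_sum_toggle_up_even[OF t ev] by simp
    have IH: "signed_diagonal_sum N (int s - 2 * int k) (toggles s w) - signed_diagonal_sum N (int s - 2 * int k + 1) (toggles s w) =
      int (row_sum s k (restrict_triangle s w))"
      using Suc.IH[OF w' Suc.prems(2) k] Suc.prems(4) toggles_restrict[of s w] by simp
    have 3: "?\<delta> - 1 = int s - 2 * int k" "?\<delta> = int s - 2 * int k + 1" by simp_all
    have "row_sum s k (restrict_triangle s w) = row_sum s k w"
      unfolding row_sum_def
    proof (intro sum.cong refl)
      fix j assume "j \<in> {..<s - k}"
      then show "sym_entry (restrict_triangle s w) k (Suc j) = sym_entry w k (Suc j)"
        using Suc.prems(2) by (auto simp: sym_entry_def restrict_triangle_def half_triangle_def min_def max_def)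
    qed
    moreover have "row_sum (Suc s) k w = row_sum s k w + sym_entry w k (Suc s - k)"
      using k by (simp add: row_sum_def Suc_diff_le)
    ultimately show ?thesis using 1 2 IH unfolding 3 by simp
  qed
qed simp

section \<open>The diagonal weights\<close>

primrec alt_diag :: "(nat \<Rightarrow> nat \<Rightarrow> nat) \<Rightarrow> nat \<Rightarrow> int" where
  "alt_diag t 0 = 0"
| "alt_diag t (Suc m) = int (t (Suc m) (Suc m)) - alt_diag t m"

lemma alt_diag_cong: "(\<And>i. 1 \<le> i \<Longrightarrow> i \<le> m \<Longrightarrow> t i i = t' i i) \<Longrightarrow> alt_diag t m = alt_diag t' m"
  by (induction m) auto

text \<open>For even \<open>s\<close> the old diagonal is untouched. For odd \<open>s\<close> each
  diagonal entry and its toggled value add up to the two adjacent entries beside the diagonal, so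
  old and new alternating sums up to \<open>j\<close> add up to the single entry
  \<open>t j (j + 1)\<close>. The new corner contains the same entry plus its weight, and only the
  weight remains.\<close>

lemma alt_diag_toggles:
  assumes "w \<in> lpp_bounded s u"
  shows "alt_diag (toggles s w) (s div 2) = (\<Sum>i<s div 2. int (w (Suc i) (Suc i)))"
  using assms
proof (induction s arbitrary: w)
  case (Suc s)
  have w': "restrict_triangle s w \<in> lpp_bounded s u" by (rule restrict_in[OF Suc.prems(1)])
  let ?t = "toggles s w"
  let ?t' = "toggles (Suc s) w"
  have t: "?t \<in> monotone_arrays s u"
    using bij_betwE[OF bij_betw_toggles[of s u]] w' toggles_restrict[of s w] by metis
  have IH: "alt_diag ?t (s div 2) = (\<Sum>i<s div 2. int (w (Suc i) (Suc i)))"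
  proof -
    have "alt_diag ?t (s div 2) = (\<Sum>i<s div 2. int (restrict_triangle s w (Suc i) (Suc i)))"
      using Suc.IH[OF w'] by (simp add: toggles_restrict)
    also have "\<dots> = (\<Sum>i<s div 2. int (w (Suc i) (Suc i)))"
      by (intro sum.cong refl) (auto simp: restrict_triangle_def half_triangle_def)
    finally show ?thesis .
  qed
  show ?case
  proof (cases "even s")
    case True
    have "alt_diag ?t' (s div 2) = alt_diag ?t (s div 2)"
      by (rule alt_diag_cong) (use True toggle_up_same[OF t] in auto)
    then show ?thesis using IH True by simp
  next
    case False
    then obtain m where s: "s = 2 * m + 1" by (auto elim: oddE)
    have diag: "int (?t' (Suc j) (Suc j)) = int (?t j (Suc j)) + int (?t (Suc j) (Suc (Suc j))) - int (?t (Suc j) (Suc j))" if "j < m" for j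
    proof -
      have in_s: "(Suc j, Suc j) \<in> half_triangle s" and lt: "Suc j + Suc j < s" using that s by (auto simp: half_triangle_def)
      have "lo ?t (Suc j) (Suc j) = ?t j (Suc j)" by (simp add: lo_def sym_entry_def)
      moreover have "hi ?t (Suc j) (Suc j) = ?t (Suc j) (Suc (Suc j))" by (simp add: hi_def sym_entry_def)
      moreover have "?t (Suc j) (Suc j) \<le> hi ?t (Suc j) (Suc j)" by (rule monotone_arrays_hi[OF t in_s lt])
      moreover have "?t' (Suc j) (Suc j) = lo ?t (Suc j) (Suc j) + hi ?t (Suc j) (Suc j) - ?t (Suc j) (Suc j)"
        using half_triangle_mono[OF _ in_s, of "Suc s"] lt s by (simp add: toggle_up_def)
      ultimately show ?thesis by simp
    qed
    have flip: "alt_diag ?t' j = int (?t j (Suc j)) - alt_diag ?t j" if "j \<le> m" for j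
      using that
    proof (induction j)
      case 0
      have "?t 0 1 = 0" by (rule monotone_arraysD(1)[OF t]) (simp add: half_triangle_def)
      then show ?case by simp
    next
      case (Suc j)
      then show ?case using diag[of j] by (simp del: toggles.simps)
    qed
    have "?t' (Suc m) (Suc m) = ?t m (Suc m) + w (Suc m) (Suc m)"
      by (simp add: toggle_up_def half_triangle_def s lo_def sym_entry_def)
    then have "alt_diag ?t' (Suc m) = int (w (Suc m) (Suc m)) + alt_diag ?t m"
      using flip[of m] by (simp del: toggles.simps)
    moreover have "Suc s div 2 = Suc m" "s div 2 = m" using s by auto
    ultimately show ?thesis using IH by (simp del: toggles.simps)
  qed
qed simp

text \<open>A column of length \<open>c\<close> contributes \<open>1 - 1 + 1 - ...\<close> with
  \<open>c\<close> terms to the alternating sum of the parts, which is 1 for odd \<open>c\<close>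
  and 0 for even \<open>c\<close>.\<close>

lemma card_odd_cnt:
  assumes f: "f \<in> Par n u"
  shows "int (card {i \<in> {..<u}. odd (cnt f (u - i))}) = (\<Sum>k<n. (-1) ^ k * int (f k))"
proof -
  have alt: "(\<Sum>k<c. (-1) ^ k :: int) = of_bool (odd c)" for c
    by (induction c) auto
  have "(\<Sum>k<n. (-1) ^ k * int (f k)) = (\<Sum>k<n. \<Sum>j\<in>{1..u}. of_bool (j \<le> f k) * (-1) ^ k)"
  proof (intro sum.cong refl)
    fix k
    have "{1..u} \<inter> {j. j \<le> f k} = {1..f k}" using Par_le[OF f, of k] by auto
    then have "(\<Sum>j\<in>{1..u}. of_bool (j \<le> f k)) = int (f k)" by simp
    then show "(-1) ^ k * int (f k) = (\<Sum>j\<in>{1..u}. of_bool (j \<le> f k) * (-1) ^ k)"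
      unfolding sum_distrib_right[symmetric] by (simp only: mult.commute)
  qed
  also have "\<dots> = (\<Sum>j\<in>{1..u}. \<Sum>k<n. of_bool (j \<le> f k) * (-1) ^ k)"
    by (rule sum.swap)
  also have "\<dots> = (\<Sum>j\<in>{1..u}. of_bool (odd (cnt f j)))"
  proof (intro sum.cong refl)
    fix j assume j: "j \<in> {1..u}"
    have "(\<Sum>k<n. of_bool (j \<le> f k) * (-1) ^ k) = (\<Sum>k<cnt f j. (-1) ^ k :: int)"
    proof (rule sum.mono_neutral_cong_right)
      have iff: "k < cnt f j \<longleftrightarrow> j \<le> f k" for k
        by (rule cnt_gt_iff[OF f]) (use j in simp)
      show "{..<cnt f j} \<subseteq> {..<n}" using cnt_le[OF f, of j] j by simp
      show "\<forall>k\<in>{..<n} - {..<cnt f j}. of_bool (j \<le> f k) * (-1) ^ k = (0 :: int)"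
        by (simp flip: iff)
      show "of_bool (j \<le> f k) * (-1) ^ k = ((-1) ^ k :: int)" if "k \<in> {..<cnt f j}" for k
        using iff[of k] that by simp
    qed simp
    then show "(\<Sum>k<n. of_bool (j \<le> f k) * (-1) ^ k) = (of_bool (odd (cnt f j)) :: int)"
      by (simp only: alt)
  qed
  also have "\<dots> = (\<Sum>i<u. of_bool (odd (cnt f (u - i))))"
    by (rule sum.reindex_bij_witness[where i = "\<lambda>i. u - i" and j = "\<lambda>j. u - j"]) auto
  also have "\<dots> = int (card {i \<in> {..<u}. odd (cnt f (u - i))})"
  proof -
    have "{..<u} \<inter> {i. odd (cnt f (u - i))} = {i \<in> {..<u}. odd (cnt f (u - i))}" by auto
    then show ?thesis by simp
  qed
  finally show ?thesis by (rule sym)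
qed

lemma alt_diag_eq_sum: "alt_diag t n = (\<Sum>k<n. (-1) ^ k * int (t (n - k) (n - k)))"
proof (induction n)
  case (Suc n)
  show ?case
    by (simp add: sum.lessThan_Suc_shift Suc sum_negf del: sum.lessThan_Suc)
qed simp

lemma diagonal_sum_cong_row:
  assumes t: "t \<in> monotone_arrays (2 * n + 1) u" and r: "r \<le> 2 * n"
    and z: "\<And>j. 1 \<le> j \<Longrightarrow> j \<le> (r + 1) div 2 \<Longrightarrow> z r j = u - t j (j + (2 * n - r))"
  shows "(\<Sum>j = 1..(r + 1) div 2. int (z r j)) = int ((r + 1) div 2) * int u - int (diagonal_sum (2 * n + 1) (2 * n - r) t)"
proof -
  let ?m = "(r + 1) div 2"
  have zero: "t (Suc k) (Suc k + (2 * n - r)) = 0" if "?m \<le> k" for k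
    by (rule monotone_arrays_zero[OF t]) (use that r in linarith)
  have "(\<Sum>j = 1..?m. int (z r j)) = (\<Sum>k<?m. int (z r (Suc k)))"
    by (rule sum.reindex_bij_witness[where i = Suc and j = "\<lambda>j. j - 1"]) auto
  also have "\<dots> = (\<Sum>k<?m. int u - int (t (Suc k) (Suc k + (2 * n - r))))"
    by (intro sum.cong refl, subst z) (auto simp: monotone_arraysD(3)[OF t] of_nat_diff)
  also have "\<dots> = int ?m * int u - int (diagonal_sum (2 * n + 1) (2 * n - r) t)"
  proof -
    have "diagonal_sum (2 * n + 1) (2 * n - r) t = (\<Sum>k<?m. t (Suc k) (Suc k + (2 * n - r)))"
      by (rule diagonal_sum_trim) (use zero r in auto)
    then show ?thesis by (simp add: sum_subtractf)
  qed
  finally show ?thesis .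
qed

section \<open>Monotone arrays as symplectic patterns\<close>

text \<open>Diagonals of the array become rows of the pattern, the main diagonal its shape.
  Monotonicity in the two directions becomes the two interlacing inequalities, reversed by the
  complement.\<close>

definition array_pattern :: "nat \<Rightarrow> nat \<Rightarrow> (nat \<Rightarrow> nat \<Rightarrow> nat) \<Rightarrow> nat \<Rightarrow> nat \<Rightarrow> nat" where
  "array_pattern n u t = (\<lambda>r i. if (r, i) \<in> pattern_index (2 * n) then u - t i (i + (2 * n - r)) else 0)"

definition pattern_array :: "nat \<Rightarrow> nat \<Rightarrow> (nat \<Rightarrow> nat \<Rightarrow> nat) \<Rightarrow> nat \<Rightarrow> nat \<Rightarrow> nat" where
  "pattern_array n u z = (\<lambda>i j. if (i, j) \<in> half_triangle (2 * n + 1) then u - z (2 * n - (j - i)) i else 0)"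

text \<open>Read from the far end, because the diagonal of a monotone array increases.\<close>

definition diag_par :: "nat \<Rightarrow> (nat \<Rightarrow> nat \<Rightarrow> nat) \<Rightarrow> nat \<Rightarrow> nat" where
  "diag_par n t = (\<lambda>k. if k < n then t (n - k) (n - k) else 0)"

lemma half_triangle_index: "(i, j) \<in> half_triangle (2 * n + 1) \<longleftrightarrow> i \<le> j \<and> j - i \<le> 2 * n \<and> (2 * n - (j - i), i) \<in> pattern_index (2 * n)"
  by (auto simp: half_triangle_def pattern_index_def)

lemma index_half_triangle: "(r, i) \<in> pattern_index (2 * n) \<Longrightarrow> (i, i + (2 * n - r)) \<in> half_triangle (2 * n + 1)"
  by (auto simp: half_triangle_def pattern_index_def)

lemma pattern_array_array_pattern:
  assumes "t \<in> monotone_arrays (2 * n + 1) u"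
  shows "pattern_array n u (array_pattern n u t) = t"
proof (intro ext)
  fix i j
  show "pattern_array n u (array_pattern n u t) i j = t i j"
  proof (cases "(i, j) \<in> half_triangle (2 * n + 1)")
    case True
    then have *: "i \<le> j" "j - i \<le> 2 * n" "(2 * n - (j - i), i) \<in> pattern_index (2 * n)"
      using half_triangle_index by auto
    then have "i + (2 * n - (2 * n - (j - i))) = j" by simp
    then show ?thesis using True * monotone_arraysD(3)[OF assms, of i j]
      by (simp add: pattern_array_def array_pattern_def)
  next
    case False
    then show ?thesis using monotone_arraysD(1)[OF assms False] by (simp add: pattern_array_def)
  qed
qed

lemma array_pattern_pattern_array:
  assumes "z \<in> symplectic_patterns (2 * n)" "\<And>i j. z i j \<le> u"
  shows "array_pattern n u (pattern_array n u z) = z"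
proof (intro ext)
  fix r i
  show "array_pattern n u (pattern_array n u z) r i = z r i"
  proof (cases "(r, i) \<in> pattern_index (2 * n)")
    case True
    then have "r \<le> 2 * n" by (simp add: pattern_index_def)
    then have "2 * n - (i + (2 * n - r) - i) = r" by simp
    then show ?thesis using True index_half_triangle[OF True] assms(2)[of r i]
      by (simp add: pattern_array_def array_pattern_def)
  next
    case False
    then show ?thesis using symplectic_patternsD(1)[OF assms(1) False] by (simp add: array_pattern_def)
  qed
qed

lemma array_pattern_in:
  assumes t: "t \<in> monotone_arrays (2 * n + 1) u"
  shows "array_pattern n u t \<in> symplectic_patterns (2 * n)"
proof (rule symplectic_patternsI)
  fix r i assume "(r, i) \<notin> pattern_index (2 * n)"
  then show "array_pattern n u t r i = 0" by (simp add: array_pattern_def)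
next
  fix r i assume ri: "(r, i) \<in> pattern_index (2 * n)" "(Suc r, i) \<in> pattern_index (2 * n)"
  then have r: "Suc r \<le> 2 * n" "1 \<le> i" by (auto simp: pattern_index_def)
  define j where "j = i + (2 * n - r)"
  have j: "j - 1 = i + (2 * n - Suc r)" "i \<le> j - 1" using r by (auto simp: j_def)
  have "t i (j - 1) = sym_entry t i (j - 1)" using j by (simp add: sym_entry_def)
  also have "\<dots> \<le> lo t i j" by (simp add: lo_def)
  also have "\<dots> \<le> t i j"
    using monotone_arraysD(2)[OF t] index_half_triangle[OF ri(1)] by (simp add: j_def)
  finally show "array_pattern n u t r i \<le> array_pattern n u t (Suc r) i"
    using ri by (simp add: array_pattern_def j(1)[symmetric] flip: j_def)
next
  fix r i assume ri: "(r, i) \<in> pattern_index (2 * n)" "(Suc r, Suc i) \<in> pattern_index (2 * n)"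
  then have r: "Suc r \<le> 2 * n" "1 \<le> i" by (auto simp: pattern_index_def)
  have j: "Suc i + (2 * n - Suc r) = i + (2 * n - r)" using r by simp
  have "t i (i + (2 * n - r)) = sym_entry t (Suc i - 1) (Suc i + (2 * n - Suc r))"
    unfolding j by (simp add: sym_entry_def)
  also have "\<dots> \<le> lo t (Suc i) (Suc i + (2 * n - Suc r))" by (simp add: lo_def)
  also have "\<dots> \<le> t (Suc i) (Suc i + (2 * n - Suc r))"
    by (rule monotone_arraysD(2)[OF t index_half_triangle[OF ri(2)]])
  finally show "array_pattern n u t (Suc r) (Suc i) \<le> array_pattern n u t r i"
    using ri by (simp add: array_pattern_def diff_le_mono2)
qed

lemma pattern_array_in:
  assumes z: "z \<in> symplectic_patterns (2 * n)"
  shows "pattern_array n u z \<in> monotone_arrays (2 * n + 1) u"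
proof -
  let ?t = "pattern_array n u z"
  have out: "?t i j = 0" if "(i, j) \<notin> half_triangle (2 * n + 1)" for i j
    using that by (simp add: pattern_array_def)
  have "lo ?t i j \<le> ?t i j" if ij: "(i, j) \<in> half_triangle (2 * n + 1)" for i j
  proof (rule lo_le_of_neighbours[OF ij _ out])
    fix a b assume ab: "(a, b) \<in> half_triangle (2 * n + 1)" and "Suc (a + b) = i + j"
      and nb: "a + 1 = i \<and> b = j \<or> a = i \<and> b + 1 = j"
    have idx: "(2 * n - (j - i), i) \<in> pattern_index (2 * n)" "j - i \<le> 2 * n" "i \<le> j"
      "(2 * n - (b - a), a) \<in> pattern_index (2 * n)" "b - a \<le> 2 * n" "a \<le> b"
      using ij ab half_triangle_index by auto
    have "z (2 * n - (j - i)) i \<le> z (2 * n - (b - a)) a"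
      using nb
    proof
      assume *: "a + 1 = i \<and> b = j"
      then have "2 * n - (j - i) = Suc (2 * n - (b - a))" "i = Suc a" using idx by auto
      then show ?thesis using symplectic_patternsD(3)[OF z, of "2 * n - (b - a)" a] idx by simp
    next
      assume *: "a = i \<and> b + 1 = j"
      then have "2 * n - (b - a) = Suc (2 * n - (j - i))" "i = a" using idx by auto
      moreover have "2 * n - (j - i) < 2 * n" using * idx by auto
      ultimately show ?thesis using symplectic_patternsD(2)[OF z, of "2 * n - (j - i)" i] idx by simp
    qed
    then show "?t a b \<le> ?t i j" using ij ab by (simp add: pattern_array_def diff_le_mono2)
  qed
  moreover have "?t i j \<le> u" for i j by (simp add: pattern_array_def)
  ultimately show ?thesis unfolding monotone_arrays_def using out by blast
qed

lemma diag_par_in: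
  assumes t: "t \<in> monotone_arrays (2 * n + 1) u"
  shows "diag_par n t \<in> Par n u"
  unfolding Par_def
proof (intro CollectI conjI allI impI)
  show "antimono (diag_par n t)"
    unfolding antimono_iff_le_Suc
  proof
    fix k
    show "diag_par n t (Suc k) \<le> diag_par n t k"
    proof (cases "Suc k < n")
      case True
      define i where "i = n - Suc k"
      have i: "1 \<le> i" "Suc i \<le> n" "n - k = Suc i" using True by (auto simp: i_def)
      have "t i i \<le> lo t i (Suc i)" by (simp add: lo_def sym_entry_def)
      also have "\<dots> \<le> t i (Suc i)"
        by (rule monotone_arraysD(2)[OF t]) (use i in \<open>simp add: half_triangle_def\<close>)
      also have "\<dots> \<le> lo t (Suc i) (Suc i)" by (simp add: lo_def sym_entry_def)
      also have "\<dots> \<le> t (Suc i) (Suc i)"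
        by (rule monotone_arraysD(2)[OF t]) (use i in \<open>simp add: half_triangle_def\<close>)
      finally show ?thesis using True i by (simp add: diag_par_def i_def[symmetric])
    qed (simp add: diag_par_def)
  qed
qed (simp_all add: diag_par_def monotone_arraysD(3)[OF t])

text \<open>Rows \<open>k\<close> and \<open>2 * n + 1 - k\<close> carry the same parameter. Their
  sums combine to twice the diagonal sum at offset \<open>2 * n + 1 - 2 * k\<close> minus those at
  the two adjacent offsets, which belong to the rows \<open>2 * k - 1\<close>,
  \<open>2 * k - 2\<close> and \<open>2 * k\<close> of the pattern. Complementing these rows changes
  the exponent by \<open>u\<close>, the origin of the power \<open>u\<close> of the product.\<close>

theorem sum_lpp_eq_symp:
  fixes p :: "nat \<Rightarrow> real"
  assumes p: "\<And>k. k \<in> {1..n} \<Longrightarrow> 0 < p k"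
  defines "ps \<equiv> map p [1..<Suc n]"
  shows "(\<Sum>w\<in>lpp_bounded (2 * n + 1) u. \<alpha> ^ (\<Sum>i<n. w (Suc i) (Suc i)) *
      (\<Prod>k = 1..n. p k ^ (row_sum (2 * n + 1) k w + row_sum (2 * n + 1) (2 * n + 1 - k) w))) =
    (\<Sum>f\<in>Par n u. \<alpha> ^ card {i \<in> {..<u}. odd (cnt f (u - i))} *
       ((\<Prod>k = 1..n. p k) ^ u * (\<Sum>z\<in>symp_fiber u n f. symp_weight ps z)))"
proof -
  let ?s = "2 * n + 1"
  define D where "D d t = int (diagonal_sum ?s d t)" for d t
  define wt where "wt t = \<alpha> ^ nat (alt_diag t n) *
    (\<Prod>k = 1..n. p k powi (2 * D (2 * n + 1 - 2 * k) t - D (2 * n + 2 - 2 * k) t - D (2 * n - 2 * k) t))" for t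
  define Sg where "Sg = Sigma (Par n u) (symp_fiber u n)"
  define h where "h b = \<alpha> ^ card {i \<in> {..<u}. odd (cnt (fst b) (u - i))} *
       ((\<Prod>k = 1..n. p k) ^ u * symp_weight ps (snd b))" for b
  have "(\<Sum>w\<in>lpp_bounded ?s u. \<alpha> ^ (\<Sum>i<n. w (Suc i) (Suc i)) *
      (\<Prod>k = 1..n. p k ^ (row_sum ?s k w + row_sum ?s (?s - k) w))) = (\<Sum>w\<in>lpp_bounded ?s u. wt (toggles ?s w))"
  proof (intro sum.cong refl)
    fix w assume w: "w \<in> lpp_bounded ?s u"
    have "alt_diag (toggles ?s w) n = int (\<Sum>i<n. w (Suc i) (Suc i))"
      using alt_diag_toggles[OF w] by simp
    then have "nat (alt_diag (toggles ?s w) n) = (\<Sum>i<n. w (Suc i) (Suc i))" by (simp only: nat_int)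
    moreover have "p k ^ (row_sum ?s k w + row_sum ?s (?s - k) w) = p k powi (2 * D (2 * n + 1 - 2 * k) (toggles ?s w) -
        D (2 * n + 2 - 2 * k) (toggles ?s w) - D (2 * n - 2 * k) (toggles ?s w))" if k: "k \<in> {1..n}" for k
    proof -
      have 1: "int (row_sum ?s k w) = D (2 * n + 1 - 2 * k) (toggles ?s w) - D (2 * n + 2 - 2 * k) (toggles ?s w)"
      proof -
        have "nat \<bar>int ?s - 2 * int k\<bar> = 2 * n + 1 - 2 * k" "nat \<bar>int ?s - 2 * int k + 1\<bar> = 2 * n + 2 - 2 * k"
          using k by auto
        moreover have "signed_diagonal_sum ?s (int ?s - 2 * int (k)) (toggles ?s w) - signed_diagonal_sum ?s (int ?s - 2 * int (k) + 1) (toggles ?s w) =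
            int (row_sum ?s (k) w)"
          by (rule row_sum_toggles[OF w]) (use k in auto)
        ultimately show ?thesis by (simp only: signed_diagonal_sum_def D_def)
      qed
      have 2: "int (row_sum ?s (?s - k) w) = D (2 * n + 1 - 2 * k) (toggles ?s w) - D (2 * n - 2 * k) (toggles ?s w)"
      proof -
        have "nat \<bar>int ?s - 2 * int (?s - k)\<bar> = 2 * n + 1 - 2 * k" "nat \<bar>int ?s - 2 * int (?s - k) + 1\<bar> = 2 * n - 2 * k"
          using k by auto
        moreover have "signed_diagonal_sum ?s (int ?s - 2 * int (?s - k)) (toggles ?s w) - signed_diagonal_sum ?s (int ?s - 2 * int (?s - k) + 1) (toggles ?s w) =
            int (row_sum ?s (?s - k) w)"
          by (rule row_sum_toggles[OF w]) (use k in auto)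
        ultimately show ?thesis by (simp only: signed_diagonal_sum_def D_def)
      qed
      have "p k ^ (row_sum ?s k w + row_sum ?s (?s - k) w) = p k powi (int (row_sum ?s k w + row_sum ?s (?s - k) w))"
        by (simp only: power_int_of_nat)
      also have "int (row_sum ?s k w + row_sum ?s (?s - k) w) = 2 * D (2 * n + 1 - 2 * k) (toggles ?s w) -
        D (2 * n + 2 - 2 * k) (toggles ?s w) - D (2 * n - 2 * k) (toggles ?s w)"
        unfolding of_nat_add 1 2 by simp
      finally show ?thesis .
    qed
    ultimately show "\<alpha> ^ (\<Sum>i<n. w (Suc i) (Suc i)) *
      (\<Prod>k = 1..n. p k ^ (row_sum ?s k w + row_sum ?s (?s - k) w)) = wt (toggles ?s w)"
      unfolding wt_def by (auto intro!: arg_cong2[of _ _ _ _ "(*)"] prod.cong)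
  qed
  also have "\<dots> = (\<Sum>t\<in>monotone_arrays ?s u. wt t)"
    by (rule sum.reindex_bij_betw[OF bij_betw_toggles])
  also have "\<dots> = (\<Sum>b\<in>Sg. h b)"
  proof (rule sum.reindex_bij_witness[of _ "\<lambda>b. pattern_array n u (snd b)" "\<lambda>t. (diag_par n t, array_pattern n u t)"])
    fix t assume t: "t \<in> monotone_arrays ?s u"
    show "pattern_array n u (snd (diag_par n t, array_pattern n u t)) = t"
      using pattern_array_array_pattern[OF t] by simp
    have z: "array_pattern n u t \<in> symp_fiber u n (diag_par n t)"
      unfolding symp_fiber_def
    proof (intro CollectI conjI ballI)
      fix i assume i: "i \<in> {1..n}"
      then have "(2 * n, i) \<in> pattern_index (2 * n)" by (auto simp: pattern_index_def)
      moreover have "n - i < n" "n - (n - i) = i" using i by auto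
      ultimately show "array_pattern n u t (2 * n) i = u - diag_par n t (n - i)"
        by (simp add: array_pattern_def diag_par_def)
    qed (rule array_pattern_in[OF t])
    then show "(diag_par n t, array_pattern n u t) \<in> Sg"
      using diag_par_in[OF t] by (simp add: Sg_def)
    let ?z = "array_pattern n u t"
    have "alt_diag t n = int (card {i \<in> {..<u}. odd (cnt (diag_par n t) (u - i))})"
      unfolding card_odd_cnt[OF diag_par_in[OF t]] alt_diag_eq_sum
      by (intro sum.cong refl) (simp add: diag_par_def)
    then have 1: "nat (alt_diag t n) = card {i \<in> {..<u}. odd (cnt (diag_par n t) (u - i))}" by (simp only: nat_int)
    have row: "(\<Sum>j = 1..(r + 1) div 2. int (?z r j)) = int ((r + 1) div 2) * int u - D (2 * n - r) t" if "r \<le> 2 * n" for r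
      unfolding D_def
    proof (rule diagonal_sum_cong_row[OF t that])
      fix j assume "1 \<le> j" "j \<le> (r + 1) div 2"
      then have "(r, j) \<in> pattern_index (2 * n)" using that by (auto simp: pattern_index_def)
      then show "?z r j = u - t j (j + (2 * n - r))" by (simp add: array_pattern_def)
    qed
    have ty: "p k powi (2 * D (2 * n + 1 - 2 * k) t - D (2 * n + 2 - 2 * k) t - D (2 * n - 2 * k) t) =
       p k ^ u * (ps ! (k - 1)) powi (pattern_type ?z (2 * k) - pattern_type ?z (2 * k - 1))" if k: "k \<in> {1..n}" for k
    proof -
      have pk: "ps ! (k - 1) = p k"
        using k unfolding ps_def by (subst nth_map) (auto simp del: upt_Suc)
      have a: "(\<Sum>j = 1..k. int (?z (2 * k) j)) = int k * int u - D (2 * n - 2 * k) t"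
        using row[of "2 * k"] k by simp
      have b: "(\<Sum>j = 1..k. int (?z (2 * k - 1) j)) = int k * int u - D (2 * n + 1 - 2 * k) t"
      proof -
        have "(2 * k - 1 + 1) div 2 = k" "2 * n - (2 * k - 1) = 2 * n + 1 - 2 * k" "2 * k - 1 \<le> 2 * n" using k by auto
        then show ?thesis using row[of "2 * k - 1"] by (simp only:)
      qed
      have c: "(\<Sum>j = 1..k - 1. int (?z (2 * k - 2) j)) = int (k - 1) * int u - D (2 * n + 2 - 2 * k) t"
      proof -
        have "(2 * k - 2 + 1) div 2 = k - 1" "2 * n - (2 * k - 2) = 2 * n + 2 - 2 * k" "2 * k - 2 \<le> 2 * n" using k by auto
        then show ?thesis using row[of "2 * k - 2"] by (simp only:)
      qed
      have "(2 * k - 1 + 1) div 2 = k" "(2 * k - 1) div 2 = k - 1" "2 * k - 1 - 1 = 2 * k - 2" "(2 * k + 1) div 2 = k" "2 * k div 2 = k"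
        using k by auto
      then have type: "pattern_type ?z (2 * k) - pattern_type ?z (2 * k - 1) =
        (\<Sum>j = 1..k. int (?z (2 * k) j)) - 2 * (\<Sum>j = 1..k. int (?z (2 * k - 1) j)) + (\<Sum>j = 1..k - 1. int (?z (2 * k - 2) j))"
        unfolding pattern_type_def by simp
      have "2 * D (2 * n + 1 - 2 * k) t - D (2 * n + 2 - 2 * k) t - D (2 * n - 2 * k) t =
        int u + (pattern_type ?z (2 * k) - pattern_type ?z (2 * k - 1))"
        unfolding type a b c using k by (simp add: of_nat_diff algebra_simps)
      moreover have "p k \<noteq> 0" using p[OF k] by simp
      ultimately show ?thesis unfolding pk by (simp add: power_int_add)
    qed
    have "(\<Prod>k = 1..n. p k powi (2 * D (2 * n + 1 - 2 * k) t - D (2 * n + 2 - 2 * k) t - D (2 * n - 2 * k) t)) =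
      (\<Prod>k = 1..n. p k ^ u * (ps ! (k - 1)) powi (pattern_type ?z (2 * k) - pattern_type ?z (2 * k - 1)))"
      by (intro prod.cong refl ty)
    also have "\<dots> = (\<Prod>k = 1..n. p k) ^ u * symp_weight ps ?z"
      by (simp add: prod.distrib prod_power_distrib symp_weight_def ps_def)
    finally show "h (diag_par n t, array_pattern n u t) = wt t"
      by (simp add: h_def wt_def 1)
  next
    fix b assume "b \<in> Sg"
    then obtain f z where b: "b = (f, z)" and f: "f \<in> Par n u" and z: "z \<in> symp_fiber u n f" by (auto simp: Sg_def)
    have zp: "z \<in> symplectic_patterns (2 * n)" using z by (simp add: symp_fiber_def)
    show "pattern_array n u (snd b) \<in> monotone_arrays ?s u"
      using pattern_array_in[OF zp] b by simp
    have "array_pattern n u (pattern_array n u z) = z"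
      by (rule array_pattern_pattern_array[OF zp symp_fiber_le[OF z]])
    moreover have "diag_par n (pattern_array n u z) = f"
    proof
      fix k
      show "diag_par n (pattern_array n u z) k = f k"
      proof (cases "k < n")
        case True
        then have "(n - k, n - k) \<in> half_triangle ?s" "n - k \<in> {1..n}" "n - (n - k) = k"
          by (auto simp: half_triangle_def)
        then show ?thesis using True z Par_le[OF f, of k] by (simp add: diag_par_def pattern_array_def symp_fiber_def)
      next
        case False
        then show ?thesis using f by (simp add: diag_par_def Par_def)
      qed
    qed
    ultimately show "(diag_par n (pattern_array n u (snd b)), array_pattern n u (pattern_array n u (snd b))) = b"
      using b by simp
  qed
  also have "\<dots> = (\<Sum>f\<in>Par n u. \<Sum>z\<in>symp_fiber u n f. h (f, z))"
    unfolding Sg_def by (subst sum.Sigma) (auto simp: finite_Par finite_symp_fiber)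
  finally show ?thesis by (simp add: h_def sum_distrib_left)
qed

section \<open>Symmetric last passage times\<close>

lemma directed_step_iff: "directed_step a b \<longleftrightarrow> b = (Suc (fst a), snd a) \<or> b = (fst a, Suc (snd a))"
  by (simp add: directed_step_def)

definition path_sum :: "(nat \<Rightarrow> nat \<Rightarrow> nat) \<Rightarrow> (nat \<times> nat) list \<Rightarrow> nat" where
  "path_sum W \<pi> = (\<Sum>(i, j) \<leftarrow> \<pi>. W i j)"

lemma path_sum_simps [simp]:
  "path_sum W [] = 0" "path_sum W (a # \<pi>) = W (fst a) (snd a) + path_sum W \<pi>"
  "path_sum W (\<pi> @ \<pi>') = path_sum W \<pi> + path_sum W \<pi>'"
  by (simp_all add: path_sum_def case_prod_unfold)

lemma path_below_end:
  "successively directed_step \<pi> \<Longrightarrow> a \<in> set \<pi> \<Longrightarrow> fst a \<le> fst (last \<pi>) \<and> snd a \<le> snd (last \<pi>)"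
proof (induction \<pi> arbitrary: a rule: induct_list012)
  case (3 x y zs)
  have "fst b \<le> fst (last (x # y # zs)) \<and> snd b \<le> snd (last (x # y # zs))" if "b \<in> set (y # zs)" for b
    using 3(2)[of b] 3(3) that by simp
  moreover from this[of y] have "fst x \<le> fst (last (x # y # zs)) \<and> snd x \<le> snd (last (x # y # zs))"
    using 3(3) by (auto simp: directed_step_iff)
  ultimately show ?case using 3(4) by (metis set_ConsD)
qed auto

lemma path_above_start:
  "successively directed_step \<pi> \<Longrightarrow> a \<in> set \<pi> \<Longrightarrow> fst (hd \<pi>) \<le> fst a \<and> snd (hd \<pi>) \<le> snd a"
proof (induction \<pi> arbitrary: a rule: induct_list012)
  case (3 x y zs)
  have "fst y \<le> fst b \<and> snd y \<le> snd b" if "b \<in> set (y # zs)" for b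
    using 3(2)[of b] 3(3) that by simp
  moreover have "fst x \<le> fst y \<and> snd x \<le> snd y"
    using 3(3) by (auto simp: directed_step_iff)
  ultimately show ?case using 3(4) by (metis set_ConsD list.sel(1) le_trans order_refl)
qed auto

lemma path_length:
  "successively directed_step \<pi> \<Longrightarrow> \<pi> \<noteq> [] \<Longrightarrow>
    length \<pi> + fst (hd \<pi>) + snd (hd \<pi>) = Suc (fst (last \<pi>) + snd (last \<pi>))"
  by (induction \<pi> rule: induct_list012) (auto simp: directed_step_iff)

lemma finite_directed_paths: "finite (directed_paths a b)"
proof (rule finite_subset)
  show "directed_paths a b \<subseteq> {\<pi>. set \<pi> \<subseteq> {..fst b} \<times> {..snd b} \<and> length \<pi> \<le> Suc (fst b + snd b)}"
  proof
    fix \<pi> assume "\<pi> \<in> directed_paths a b"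
    then have \<pi>: "\<pi> \<noteq> []" "hd \<pi> = a" "last \<pi> = b" "successively directed_step \<pi>" by (auto simp: directed_paths_def)
    have "set \<pi> \<subseteq> {..fst b} \<times> {..snd b}"
      using path_below_end[OF \<pi>(4)] \<pi>(3) by (auto simp: mem_Times_iff)
    moreover have "length \<pi> \<le> Suc (fst b + snd b)"
      using path_length[OF \<pi>(4,1)] \<pi>(3) by simp
    ultimately show "\<pi> \<in> {\<pi>. set \<pi> \<subseteq> {..fst b} \<times> {..snd b} \<and> length \<pi> \<le> Suc (fst b + snd b)}" by simp
  qed
  show "finite {\<pi>. set \<pi> \<subseteq> {..fst b} \<times> {..snd b} \<and> length \<pi> \<le> Suc (fst b + snd b)}"
    by (rule finite_lists_length_le) simp
qed

lemma directed_paths_snoc: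
  "\<pi> \<in> directed_paths a b \<Longrightarrow> directed_step b c \<Longrightarrow> \<pi> @ [c] \<in> directed_paths a c"
  by (auto simp: directed_paths_def successively_append_iff)

lemma directed_paths_Cons:
  "\<pi> \<in> directed_paths b c \<Longrightarrow> directed_step a b \<Longrightarrow> a # \<pi> \<in> directed_paths a c"
  by (auto simp: directed_paths_def successively_Cons)

lemma directed_paths_append:
  "\<pi> @ [b] \<in> directed_paths a b \<Longrightarrow> b # \<pi>' \<in> directed_paths b c \<Longrightarrow> \<pi> @ b # \<pi>' \<in> directed_paths a c"
  by (auto simp: directed_paths_def successively_append_iff hd_append split: if_splits)

lemma directed_paths_singleton: "[a] \<in> directed_paths a a"
  by (simp add: directed_paths_def)

lemma max_attained_cases:
  fixes x y :: nat
  assumes "r = max x y + w" "P \<Longrightarrow> x = 0" "Q \<Longrightarrow> y = 0"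
  shows "P \<and> Q \<or> \<not> P \<and> r = x + w \<or> \<not> Q \<and> r = y + w"
  using assms by (cases P; cases Q) (auto simp: max_def)

section \<open>Passage times in a doubly symmetric array\<close>

locale doubly_symmetric =
  fixes n :: nat and W :: "nat \<Rightarrow> nat \<Rightarrow> nat"
  assumes sym: "\<And>i j. i \<in> {1..2*n} \<Longrightarrow> j \<in> {1..2*n} \<Longrightarrow> W i j = W j i"
    and persym: "\<And>i j. i \<in> {1..2*n} \<Longrightarrow> j \<in> {1..2*n} \<Longrightarrow> W i j = W (2*n + 1 - j) (2*n + 1 - i)"
begin

lemma sym_entry_W: "i \<in> {1..2*n} \<Longrightarrow> j \<in> {1..2*n} \<Longrightarrow> sym_entry W i j = W i j"
  using sym by (auto simp: sym_entry_def min_def max_def)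

lemma lpp_W:
  "i \<in> {1..2*n} \<Longrightarrow> j \<in> {1..2*n} \<Longrightarrow> lpp W i j = max (lpp W (i - 1) j) (lpp W i (j - 1)) + W i j"
  by (simp add: lpp_step sym_entry_W)

text \<open>By symmetry this is the passage time from \<open>a\<close> to the corner \<open>(2 n, 2 n)\<close>.\<close>

definition refl_lpp :: "nat \<times> nat \<Rightarrow> nat" where
  "refl_lpp a = lpp W (2*n + 1 - snd a) (2*n + 1 - fst a)"

lemma refl_lpp_step:
  assumes "directed_step a b" "fst a \<in> {1..2*n}" "snd a \<in> {1..2*n}" "fst b \<in> {1..2*n}" "snd b \<in> {1..2*n}"
  shows "W (fst a) (snd a) + refl_lpp b \<le> refl_lpp a"
proof -
  have "2*n + 1 - snd a \<in> {1..2*n}" "2*n + 1 - fst a \<in> {1..2*n}" using assms by auto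
  from lpp_W[OF this] have "refl_lpp a = max (lpp W (2*n + 1 - snd a - 1) (2*n + 1 - fst a))
      (lpp W (2*n + 1 - snd a) (2*n + 1 - fst a - 1)) + W (fst a) (snd a)"
    using persym[OF assms(2,3)] by (simp add: refl_lpp_def)
  moreover have "refl_lpp b = lpp W (2*n + 1 - snd a - 1) (2*n + 1 - fst a) \<or>
     refl_lpp b = lpp W (2*n + 1 - snd a) (2*n + 1 - fst a - 1)"
    using assms(1) by (auto simp: refl_lpp_def directed_step_iff)
  ultimately show ?thesis by auto
qed

lemma path_sum_le_refl_lpp:
  assumes "successively directed_step \<pi>" "\<pi> \<noteq> []" "last \<pi> = (2*n, 2*n)" "\<forall>a\<in>set \<pi>. 1 \<le> fst a \<and> 1 \<le> snd a"
  shows "path_sum W \<pi> \<le> refl_lpp (hd \<pi>)"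
  using assms
proof (induction \<pi> rule: induct_list012)
  case (2 x)
  then have n: "1 \<in> {1..2*n}" by (cases n) auto
  have "refl_lpp x = W 1 1" using 2 lpp_W[OF n n] by (simp add: refl_lpp_def lpp_zero)
  also have "\<dots> = W (2*n) (2*n)" using persym[OF n n] by simp
  finally show ?case using 2 by simp
next
  case (3 x y zs)
  have IH: "path_sum W (y # zs) \<le> refl_lpp y" using 3(2,3,5,6) by simp
  have "fst a \<le> 2*n \<and> snd a \<le> 2*n" if "a \<in> set (x # y # zs)" for a
    using path_below_end[OF 3(3) that] 3(5) by simp
  then have "W (fst x) (snd x) + refl_lpp y \<le> refl_lpp x"
    using 3(3,6) by (intro refl_lpp_step) auto
  then show ?case using IH by simp
qed simp

text \<open>Backwards along the path from the antidiagonal: prepending a cell adds its weight to the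
  path, while \<open>lpp\<close> drops by at least the weight of the cell after it. The start is
  counted in both terms on the left, hence its weight on the right.\<close>

lemma path_sum_bound:
  assumes "successively directed_step \<pi>" "\<pi> \<noteq> []" "last \<pi> = (2*n, 2*n)" "\<forall>a\<in>set \<pi>. 1 \<le> fst a \<and> 1 \<le> snd a"
    "fst (hd \<pi>) + snd (hd \<pi>) \<le> 2*n + 1"
    and bound: "\<And>i j. i \<in> {1..2*n} \<Longrightarrow> j \<in> {1..2*n} \<Longrightarrow> i + j = 2*n + 1 \<Longrightarrow> 2 * lpp W i j \<le> K + W i j"
  shows "path_sum W \<pi> + lpp W (fst (hd \<pi>)) (snd (hd \<pi>)) \<le> K + W (fst (hd \<pi>)) (snd (hd \<pi>))"
  using assms(1-5)
proof (induction \<pi> rule: induct_list012)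
  case (2 x)
  then show ?case by (cases n) auto
next
  case (3 x y zs)
  have in_box: "fst a \<in> {1..2*n} \<and> snd a \<in> {1..2*n}" if "a \<in> set (x # y # zs)" for a
    using path_below_end[OF 3(3) that] 3(5,6) that by auto
  show ?case
  proof (cases "fst x + snd x = 2*n + 1")
    case True
    have "2*n + 1 - snd x = fst x" "2*n + 1 - fst x = snd x" using True by auto
    then have "refl_lpp x = lpp W (fst x) (snd x)" by (simp add: refl_lpp_def)
    moreover have "path_sum W (x # y # zs) \<le> refl_lpp x"
      using path_sum_le_refl_lpp[OF 3(3,4,5,6)] by simp
    moreover have "2 * lpp W (fst x) (snd x) \<le> K + W (fst x) (snd x)"
      using bound in_box[of x] True by simp
    ultimately show ?thesis by simp
  next
    case False
    have IH: "path_sum W (y # zs) + lpp W (fst y) (snd y) \<le> K + W (fst y) (snd y)"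
      using 3(2,3,5,6,7) False by (auto simp: directed_step_iff)
    have "lpp W (fst x) (snd x) + W (fst y) (snd y) \<le> lpp W (fst y) (snd y)"
      using lpp_W[of "fst y" "snd y"] in_box[of y] 3(3) by (auto simp: directed_step_iff)
    then show ?thesis using IH by simp
  qed
qed simp

lemma exists_path_lpp:
  "i \<in> {1..2*n} \<Longrightarrow> j \<in> {1..2*n} \<Longrightarrow> \<exists>\<pi>. \<pi> @ [(i, j)] \<in> directed_paths (1, 1) (i, j) \<and> path_sum W (\<pi> @ [(i, j)]) = lpp W i j"
proof (induction "i + j" arbitrary: i j rule: less_induct)
  case less
  have ij: "lpp W i j = max (lpp W (i - 1) j) (lpp W i (j - 1)) + W i j" by (rule lpp_W[OF less.prems])
  have up: ?case if c: "i \<noteq> 1" "lpp W i j = lpp W (i - 1) j + W i j"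
  proof -
    obtain \<pi> where "\<pi> @ [(i - 1, j)] \<in> directed_paths (1, 1) (i - 1, j)" "path_sum W (\<pi> @ [(i - 1, j)]) = lpp W (i - 1) j"
    proof -
      have "i - 1 + j < i + j" "i - 1 \<in> {1..2*n}" "j \<in> {1..2*n}" using less.prems c(1) by auto
      from less.hyps[OF this] show thesis using that by blast
    qed
    then show ?thesis
      using directed_paths_snoc[of "\<pi> @ [(i - 1, j)]" "(1, 1)" "(i - 1, j)" "(i, j)"] c less.prems
      by (intro exI[of _ "\<pi> @ [(i - 1, j)]"]) (auto simp: directed_step_iff)
  qed
  have left: ?case if c: "j \<noteq> 1" "lpp W i j = lpp W i (j - 1) + W i j"
  proof -
    obtain \<pi> where "\<pi> @ [(i, j - 1)] \<in> directed_paths (1, 1) (i, j - 1)" "path_sum W (\<pi> @ [(i, j - 1)]) = lpp W i (j - 1)"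
    proof -
      have "i + (j - 1) < i + j" "i \<in> {1..2*n}" "j - 1 \<in> {1..2*n}" using less.prems c(1) by auto
      from less.hyps[OF this] show thesis using that by blast
    qed
    then show ?thesis
      using directed_paths_snoc[of "\<pi> @ [(i, j - 1)]" "(1, 1)" "(i, j - 1)" "(i, j)"] c less.prems
      by (intro exI[of _ "\<pi> @ [(i, j - 1)]"]) (auto simp: directed_step_iff)
  qed
  consider "i = 1" "j = 1" | "i \<noteq> 1" "lpp W i j = lpp W (i - 1) j + W i j" | "j \<noteq> 1" "lpp W i j = lpp W i (j - 1) + W i j"
  proof -
    have "i = 1 \<Longrightarrow> lpp W (i - 1) j = 0" "j = 1 \<Longrightarrow> lpp W i (j - 1) = 0" by (simp_all add: lpp_zero)
    from max_attained_cases[OF ij this] that show thesis by blast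
  qed
  then show ?case
  proof cases
    case 1
    then show ?thesis using ij by (intro exI[of _ "[]"]) (simp add: directed_paths_singleton lpp_zero)
  qed (use up left in auto)
qed

lemma exists_path_refl_lpp:
  "i \<in> {1..2*n} \<Longrightarrow> j \<in> {1..2*n} \<Longrightarrow> \<exists>\<pi>. (i, j) # \<pi> \<in> directed_paths (i, j) (2*n, 2*n) \<and> path_sum W ((i, j) # \<pi>) = refl_lpp (i, j)"
proof (induction "4 * n - (i + j)" arbitrary: i j rule: less_induct)
  case less
  let ?i = "2*n + 1 - j" let ?j = "2*n + 1 - i"
  have box: "?i \<in> {1..2*n}" "?j \<in> {1..2*n}" using less.prems by auto
  have ij: "refl_lpp (i, j) = max (lpp W (?i - 1) ?j) (lpp W ?i (?j - 1)) + W i j"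
    using lpp_W[OF box] persym[OF less.prems] by (simp add: refl_lpp_def)
  have right: ?case if c: "j \<noteq> 2*n" "refl_lpp (i, j) = lpp W (?i - 1) ?j + W i j"
  proof -
    obtain \<pi> where "(i, Suc j) # \<pi> \<in> directed_paths (i, Suc j) (2*n, 2*n)" "path_sum W ((i, Suc j) # \<pi>) = refl_lpp (i, Suc j)"
    proof -
      have "4 * n - (i + Suc j) < 4 * n - (i + j)" "i \<in> {1..2*n}" "Suc j \<in> {1..2*n}" using less.prems c(1) by auto
      from less.hyps[OF this] show thesis using that by blast
    qed
    moreover have "refl_lpp (i, Suc j) = lpp W (?i - 1) ?j" by (simp add: refl_lpp_def)
    ultimately show ?thesis
      using directed_paths_Cons[of "(i, Suc j) # \<pi>" "(i, Suc j)" "(2*n, 2*n)" "(i, j)"] c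
      by (intro exI[of _ "(i, Suc j) # \<pi>"]) (auto simp: directed_step_iff)
  qed
  have down: ?case if c: "i \<noteq> 2*n" "refl_lpp (i, j) = lpp W ?i (?j - 1) + W i j"
  proof -
    obtain \<pi> where "(Suc i, j) # \<pi> \<in> directed_paths (Suc i, j) (2*n, 2*n)" "path_sum W ((Suc i, j) # \<pi>) = refl_lpp (Suc i, j)"
    proof -
      have "4 * n - (Suc i + j) < 4 * n - (i + j)" "Suc i \<in> {1..2*n}" "j \<in> {1..2*n}" using less.prems c(1) by auto
      from less.hyps[OF this] show thesis using that by blast
    qed
    moreover have "refl_lpp (Suc i, j) = lpp W ?i (?j - 1)" by (simp add: refl_lpp_def)
    ultimately show ?thesis
      using directed_paths_Cons[of "(Suc i, j) # \<pi>" "(Suc i, j)" "(2*n, 2*n)" "(i, j)"] c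
      by (intro exI[of _ "(Suc i, j) # \<pi>"]) (auto simp: directed_step_iff)
  qed
  consider "i = 2*n" "j = 2*n" | "j \<noteq> 2*n" "refl_lpp (i, j) = lpp W (?i - 1) ?j + W i j" | "i \<noteq> 2*n" "refl_lpp (i, j) = lpp W ?i (?j - 1) + W i j"
  proof -
    have "j = 2*n \<Longrightarrow> lpp W (?i - 1) ?j = 0" "i = 2*n \<Longrightarrow> lpp W ?i (?j - 1) = 0" by (simp_all add: lpp_zero)
    from max_attained_cases[OF ij this] that show thesis by blast
  qed
  then show ?case
  proof cases
    case 1
    then have "(i, j) = (2*n, 2*n)" by simp
    then show ?thesis using ij 1 by (intro exI[of _ "[]"]) (simp add: directed_paths_singleton lpp_zero)
  qed (use right down in auto)
qed

text \<open>Every path between the corners meets the antidiagonal in exactly one cell. The best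
  times to that cell and from it agree by reflection, and their sum counts its weight twice.\<close>

theorem last_passage_time_le_iff:
  assumes n: "1 \<le> n"
  shows "last_passage_time W (2*n) (2*n) \<le> K \<longleftrightarrow>
    (\<forall>i\<in>{1..2*n}. \<forall>j\<in>{1..2*n}. i + j = 2*n + 1 \<longrightarrow> 2 * lpp W i j \<le> K + W i j)"
proof -
  let ?P = "directed_paths (1, 1) (2*n, 2*n)"
  have box: "1 \<in> {1..2*n}" "2*n \<in> {1..2*n}" using n by auto
  have ne: "?P \<noteq> {}" using exists_path_lpp[OF box(2) box(2)] by blast
  have "last_passage_time W (2*n) (2*n) \<le> K \<longleftrightarrow> (\<forall>\<pi>\<in>?P. path_sum W \<pi> \<le> K)"
    using finite_directed_paths ne by (simp add: last_passage_time_def path_sum_def)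
  also have "\<dots> \<longleftrightarrow> (\<forall>i\<in>{1..2*n}. \<forall>j\<in>{1..2*n}. i + j = 2*n + 1 \<longrightarrow> 2 * lpp W i j \<le> K + W i j)"
  proof (intro iffI ballI impI)
    fix i j assume P: "\<forall>\<pi>\<in>?P. path_sum W \<pi> \<le> K" and ij: "i \<in> {1..2*n}" "j \<in> {1..2*n}" "i + j = 2*n + 1"
    obtain \<pi> where \<pi>: "\<pi> @ [(i, j)] \<in> directed_paths (1, 1) (i, j)" "path_sum W (\<pi> @ [(i, j)]) = lpp W i j"
      using exists_path_lpp[OF ij(1,2)] by blast
    obtain \<pi>' where \<pi>': "(i, j) # \<pi>' \<in> directed_paths (i, j) (2*n, 2*n)" "path_sum W ((i, j) # \<pi>') = refl_lpp (i, j)"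
      using exists_path_refl_lpp[OF ij(1,2)] by blast
    have "2*n + 1 - j = i" "2*n + 1 - i = j" using ij(3) by auto
    then have "refl_lpp (i, j) = lpp W i j" by (simp add: refl_lpp_def)
    moreover have "path_sum W (\<pi> @ (i, j) # \<pi>') \<le> K"
      using P directed_paths_append[OF \<pi>(1) \<pi>'(1)] by blast
    ultimately show "2 * lpp W i j \<le> K + W i j" using \<pi>(2) \<pi>'(2) by simp
  next
    fix \<pi> assume *: "\<forall>i\<in>{1..2*n}. \<forall>j\<in>{1..2*n}. i + j = 2*n + 1 \<longrightarrow> 2 * lpp W i j \<le> K + W i j" and "\<pi> \<in> ?P"
    then have \<pi>: "\<pi> \<noteq> []" "hd \<pi> = (1, 1)" "last \<pi> = (2*n, 2*n)" "successively directed_step \<pi>"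
      by (auto simp: directed_paths_def)
    have "\<forall>a\<in>set \<pi>. 1 \<le> fst a \<and> 1 \<le> snd a"
      using path_above_start[OF \<pi>(4)] \<pi>(2) by simp
    moreover have "fst (hd \<pi>) + snd (hd \<pi>) \<le> 2*n + 1"
      using \<pi>(2) n by simp
    ultimately have "path_sum W \<pi> + lpp W (fst (hd \<pi>)) (snd (hd \<pi>)) \<le> K + W (fst (hd \<pi>)) (snd (hd \<pi>))"
      using path_sum_bound[OF \<pi>(4,1,3)] * by blast
    moreover have "lpp W 1 1 = W 1 1" using lpp_W[OF box(1) box(1)] by (simp add: lpp_zero)
    ultimately show "path_sum W \<pi> \<le> K" using \<pi>(2) by simp
  qed
  finally show ?thesis .
qed

end

text \<open>A path and its reflection in the antidiagonal share only the antidiagonal weight, so these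
  weights count one half when the whole path is folded onto the half triangle.\<close>

definition halve :: "nat \<Rightarrow> (nat \<Rightarrow> nat \<Rightarrow> nat) \<Rightarrow> nat \<Rightarrow> nat \<Rightarrow> nat" where
  "halve n W = (\<lambda>i j. if (i, j) \<in> half_triangle (2 * n + 1) then (if i + j = 2 * n + 1 then W i j div 2 else W i j) else 0)"

lemma lpp_mono: "lpp w i j \<le> lpp w i (j + d)"
proof (induction d)
  case (Suc d)
  have "lpp w i (j + d) \<le> lpp w i (Suc (j + d))"
    by (cases "i = 0") (simp_all add: lpp_zero lpp_step[of i "Suc (j + d)"])
  with Suc show ?case by simp
qed simp

context doubly_symmetric
begin

text \<open>With \<open>M\<close> the larger of the two preceding passage times, both inequalities
  say \<open>2 M + W i j \<le> 2 u\<close>; evenness makes the halving exact.\<close>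

lemma lpp_halve:
  assumes "(i, j) \<in> half_triangle (2 * n + 1)" "i + j = 2 * n + 1" "even (W i j)"
  shows "2 * lpp W i j \<le> 2 * u + W i j \<longleftrightarrow> lpp (halve n W) i j \<le> u"
proof -
  have ij: "i \<in> {1..2*n}" "j \<in> {1..2*n}" "i \<le> j" using assms by (auto simp: half_triangle_def)
  have cong: "lpp W a b = lpp (halve n W) a b" if "a + b \<le> 2 * n" for a b
    by (rule lpp_cong[OF _ that]) (auto simp: halve_def half_triangle_def)
  have "lpp W i j = max (lpp W (i - 1) j) (lpp W i (j - 1)) + W i j"
    by (rule lpp_W[OF ij(1,2)])
  moreover have "lpp (halve n W) i j = max (lpp W (i - 1) j) (lpp W i (j - 1)) + W i j div 2"
    using ij assms(1,2) cong[of "i - 1" j] cong[of i "j - 1"] by (simp add: lpp_step sym_entry_def halve_def)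
  ultimately show ?thesis using assms(3) by (auto elim!: evenE)
qed

theorem last_passage_time_halve:
  assumes n: "1 \<le> n" and even: "\<And>i j. (i, j) \<in> half_triangle (2 * n + 1) \<Longrightarrow> i + j = 2 * n + 1 \<Longrightarrow> even (W i j)"
  shows "last_passage_time W (2 * n) (2 * n) \<le> 2 * u \<longleftrightarrow> halve n W \<in> lpp_bounded (2 * n + 1) u"
  unfolding last_passage_time_le_iff[OF n]
proof
  assume L: "\<forall>i\<in>{1..2*n}. \<forall>j\<in>{1..2*n}. i + j = 2*n + 1 \<longrightarrow> 2 * lpp W i j \<le> 2 * u + W i j"
  show "halve n W \<in> lpp_bounded (2 * n + 1) u"
    unfolding lpp_bounded_def
  proof (intro CollectI conjI allI impI)
    fix i j assume "(i, j) \<notin> half_triangle (2 * n + 1)"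
    then show "halve n W i j = 0" by (simp add: halve_def)
  next
    fix i j assume ij: "(i, j) \<in> half_triangle (2 * n + 1)"
    \<comment> \<open>The end of row \<open>i\<close> on the antidiagonal: passage times grow along
      the row, so the bound there suffices.\<close>
    define j' where "j' = 2 * n + 1 - i"
    have j': "(i, j') \<in> half_triangle (2 * n + 1)" "i + j' = 2 * n + 1" "i \<in> {1..2*n}" "j' \<in> {1..2*n}" "j + (j' - j) = j'"
      using ij by (auto simp: half_triangle_def j'_def)
    have "lpp (halve n W) i j \<le> lpp (halve n W) i j'"
      using lpp_mono[of "halve n W" i j "j' - j"] j'(5) by simp
    also have "\<dots> \<le> u"
      using lpp_halve[OF j'(1,2) even[OF j'(1,2)]] L j' by blast
    finally show "lpp (halve n W) i j \<le> u" .
  qed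
next
  assume B: "halve n W \<in> lpp_bounded (2 * n + 1) u"
  show "\<forall>i\<in>{1..2*n}. \<forall>j\<in>{1..2*n}. i + j = 2*n + 1 \<longrightarrow> 2 * lpp W i j \<le> 2 * u + W i j"
  proof (intro ballI impI)
    fix i j assume ij: "i \<in> {1..2*n}" "j \<in> {1..2*n}" "i + j = 2*n + 1"
    have main: "2 * lpp W a b \<le> 2 * u + W a b" if "(a, b) \<in> half_triangle (2 * n + 1)" "a + b = 2 * n + 1" for a b
      using lpp_halve[OF that even[OF that], of u] B that by (simp add: lpp_bounded_def)
    show "2 * lpp W i j \<le> 2 * u + W i j"
    proof (cases "i \<le> j")
      case True
      then show ?thesis using main[of i j] ij by (simp add: half_triangle_def)
    next
      case False
      then show ?thesis using main[of j i] ij sym[OF ij(1,2)] lpp_commute[of W i j] by (simp add: half_triangle_def)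
    qed
  qed
qed

end

lemma finite_half_triangle: "finite (half_triangle s)"
  by (rule finite_subset[of _ "{..s} \<times> {..s}"]) (auto simp: half_triangle_def)

lemma finite_lpp_bounded: "finite (lpp_bounded s u)"
proof -
  let ?F = "{f. \<forall>p. (p \<in> half_triangle s \<longrightarrow> f p \<in> {..u}) \<and> (p \<notin> half_triangle s \<longrightarrow> f p = (0::nat))}"
  have "finite ?F" by (rule finite_set_of_finite_funs) (auto simp: finite_half_triangle)
  moreover have "monotone_arrays s u \<subseteq> curry ` ?F"
  proof
    fix t assume t: "t \<in> monotone_arrays s u"
    have "case_prod t \<in> ?F"
      using monotone_arraysD(1,3)[OF t] by auto
    moreover have "t = curry (case_prod t)" by simp
    ultimately show "t \<in> curry ` ?F" by blast
  qed
  ultimately have "finite (monotone_arrays s u)" using finite_surj by blast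
  then show ?thesis using bij_betw_finite[OF bij_betw_toggles] by blast
qed

section \<open>Products of parameters over the half triangle\<close>

lemma prod_disjoint_Un3:
  assumes "finite A" "finite B" "finite C" "A \<inter> B = {}" "A \<inter> C = {}" "B \<inter> C = {}"
  shows "prod g (A \<union> (B \<union> C)) = prod g A * (prod g B * prod g C)"
proof -
  have "prod g (A \<union> (B \<union> C)) = prod g A * prod g (B \<union> C)"
    using assms by (intro prod.union_disjoint) auto
  also have "prod g (B \<union> C) = prod g B * prod g C"
    using assms by (intro prod.union_disjoint)
  finally show ?thesis .
qed

text \<open>In the symmetric extension a weight off the diagonal lies in the two rows
  \<open>i\<close> and \<open>j\<close>, a diagonal weight in one; collecting the powers of
  \<open>q k\<close> thus gives row sums.\<close>

lemma prod_half_triangle: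
  fixes q :: "nat \<Rightarrow> real"
  shows "(\<Prod>(i, j)\<in>half_triangle s. if i = j then (\<alpha> * q i) ^ v i j else (q i * q j) ^ v i j) =
    \<alpha> ^ (\<Sum>i<s div 2. v (Suc i) (Suc i)) * (\<Prod>k = 1..s - 1. q k ^ row_sum s k v)"
proof -
  let ?T = "{(k, j). 1 \<le> k \<and> 1 \<le> j \<and> k + j \<le> s}"
  let ?D = "{(k, j) \<in> ?T. k = j}" and ?U = "{(k, j) \<in> ?T. k < j}" and ?L = "{(k, j) \<in> ?T. j < k}"
  let ?g = "\<lambda>(k, j). q k ^ sym_entry v k j"
  have fin: "finite ?T" by (rule finite_subset[of _ "{..s} \<times> {..s}"]) auto
  have finD: "finite ?D" "finite ?U" "finite ?L" by (rule finite_subset[OF _ fin]; blast)+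
  have T: "?T = ?D \<union> (?U \<union> ?L)" by auto
  have H: "half_triangle s = ?D \<union> ?U" by (auto simp: half_triangle_def)
  have "(\<Prod>k = 1..s - 1. q k ^ row_sum s k v) = (\<Prod>k = 1..s - 1. \<Prod>j = 1..s - k. q k ^ sym_entry v k j)"
  proof (intro prod.cong refl)
    fix k
    have "row_sum s k v = (\<Sum>j = 1..s - k. sym_entry v k j)"
      unfolding row_sum_def by (rule sum.reindex_bij_witness[of _ "\<lambda>j. j - 1" Suc]) auto
    then show "q k ^ row_sum s k v = (\<Prod>j = 1..s - k. q k ^ sym_entry v k j)" by (simp add: power_sum)
  qed
  also have "\<dots> = prod ?g (Sigma {1..s - 1} (\<lambda>k. {1..s - k}))"
    by (subst prod.Sigma) auto
  also have "Sigma {1..s - 1} (\<lambda>k. {1..s - k}) = ?T" by auto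
  also have "prod ?g ?T = prod ?g ?D * (prod ?g ?U * prod ?g ?L)"
    by (subst (1) T, rule prod_disjoint_Un3[OF finD]) auto
  also have "prod ?g ?L = (\<Prod>(k, j)\<in>?U. q j ^ sym_entry v k j)"
    by (rule prod.reindex_bij_witness[of _ prod.swap prod.swap]) (auto simp: sym_entry_commute)
  also have "prod ?g ?U * (\<Prod>(k, j)\<in>?U. q j ^ sym_entry v k j) = (\<Prod>(k, j)\<in>?U. (q k * q j) ^ v k j)"
    unfolding prod.distrib[symmetric]
    by (intro prod.cong refl) (auto simp: power_mult_distrib sym_entry_def)
  also have "prod ?g ?D = (\<Prod>(k, j)\<in>?D. q k ^ v k j)"
    by (intro prod.cong refl) (auto simp: sym_entry_def)
  finally have 1: "(\<Prod>k = 1..s - 1. q k ^ row_sum s k v) = (\<Prod>(k, j)\<in>?D. q k ^ v k j) * (\<Prod>(k, j)\<in>?U. (q k * q j) ^ v k j)" .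
  have "\<alpha> ^ (\<Sum>i<s div 2. v (Suc i) (Suc i)) = (\<Prod>i<s div 2. \<alpha> ^ v (Suc i) (Suc i))"
    by (simp add: power_sum)
  also have "\<dots> = (\<Prod>(k, j)\<in>?D. \<alpha> ^ v k j)"
    by (rule prod.reindex_bij_witness[of _ "\<lambda>(k, j). k - 1" "\<lambda>i. (Suc i, Suc i)"]) auto
  finally have 2: "\<alpha> ^ (\<Sum>i<s div 2. v (Suc i) (Suc i)) = (\<Prod>(k, j)\<in>?D. \<alpha> ^ v k j)" .
  have "(\<Prod>(i, j)\<in>half_triangle s. if i = j then (\<alpha> * q i) ^ v i j else (q i * q j) ^ v i j) =
    (\<Prod>(i, j)\<in>?D. if i = j then (\<alpha> * q i) ^ v i j else (q i * q j) ^ v i j) *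
    (\<Prod>(i, j)\<in>?U. if i = j then (\<alpha> * q i) ^ v i j else (q i * q j) ^ v i j)"
    unfolding H using finD by (subst prod.union_disjoint) auto
  also have "(\<Prod>(i, j)\<in>?D. if i = j then (\<alpha> * q i) ^ v i j else (q i * q j) ^ v i j) = (\<Prod>(i, j)\<in>?D. \<alpha> ^ v i j) * (\<Prod>(i, j)\<in>?D. q i ^ v i j)"
    unfolding prod.distrib[symmetric] by (intro prod.cong refl) (auto simp: power_mult_distrib)
  also have "(\<Prod>(i, j)\<in>?U. if i = j then (\<alpha> * q i) ^ v i j else (q i * q j) ^ v i j) = (\<Prod>(i, j)\<in>?U. (q i * q j) ^ v i j)"
    by (intro prod.cong refl) auto
  finally show ?thesis unfolding 1 2 by (simp add: mult.assoc)
qed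

text \<open>Reflecting \<open>j\<close> to \<open>2 * n + 1 - j\<close> folds the cells with
  \<open>j > n\<close> onto the pairs \<open>i \<le> j \<le> n\<close>. So each pair
  \<open>i < j\<close> occurs twice, and the antidiagonal yields the factors
  \<open>1 - (p i)\<^sup>2\<close>.\<close>

lemma prod_normalization:
  assumes p: "\<And>i. i \<in> {1..n} \<Longrightarrow> 0 < p i \<and> p i < 1" and a: "\<And>j. j \<in> {1..n} \<Longrightarrow> \<alpha> * p j < 1"
  defines "q \<equiv> reflect_params n p"
  shows "normalization_const n p \<alpha> * (\<Prod>(i, j)\<in>half_triangle (2 * n + 1). if i = j then 1 - \<alpha> * q i else 1 - q i * q j) = 1"
proof -
  let ?P = "{(i, j). 1 \<le> i \<and> i < j \<and> j \<le> n}" and ?D = "{(i, j). 1 \<le> i \<and> i = j \<and> j \<le> n}"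
  let ?R = "{(i, j). 1 \<le> i \<and> i \<le> n \<and> n < j \<and> i + j \<le> 2 * n + 1}"
  let ?Q = "{(i, j). 1 \<le> i \<and> i \<le> j \<and> j \<le> n}"
  let ?f = "\<lambda>(i, j). if i = j then 1 - \<alpha> * q i else 1 - q i * q j"
  have fin: "finite ?P" "finite ?D" "finite ?R" "finite ?Q"
    by (rule finite_subset[of _ "{..2 * n + 1} \<times> {..2 * n + 1}"]; auto)+
  have H: "half_triangle (2 * n + 1) = ?D \<union> (?P \<union> ?R)" by (auto simp: half_triangle_def)
  have Q: "?Q = ?D \<union> ?P" by auto
  have ql: "q i = p i" if "i \<le> n" for i using that by (simp add: q_def reflect_params_def)
  have qr: "q j = p (2 * n + 1 - j)" if "n < j" for j using that by (simp add: q_def reflect_params_def)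
  have D: "(\<Prod>(i, j)\<in>?D. h i j) = (\<Prod>i = 1..n. h i i)" for h :: "nat \<Rightarrow> nat \<Rightarrow> real"
    by (rule prod.reindex_bij_witness[of _ "\<lambda>i. (i, i)" fst]) auto
  have "prod ?f (half_triangle (2 * n + 1)) = prod ?f ?D * (prod ?f ?P * prod ?f ?R)"
    unfolding H by (rule prod_disjoint_Un3[OF fin(2,1,3)]) auto
  also have "prod ?f ?D = (\<Prod>i = 1..n. 1 - \<alpha> * p i)"
    unfolding D by (intro prod.cong refl) (auto simp: ql)
  also have "prod ?f ?P = (\<Prod>(i, j)\<in>?P. 1 - p i * p j)"
    by (intro prod.cong refl) (auto simp: ql)
  also have "prod ?f ?R = (\<Prod>(i, j)\<in>?Q. 1 - p i * p j)"
    by (rule prod.reindex_bij_witness[of _ "\<lambda>(i, j). (i, 2 * n + 1 - j)" "\<lambda>(i, j). (i, 2 * n + 1 - j)"])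
       (auto simp: ql qr)
  also have "(\<Prod>(i, j)\<in>?Q. 1 - p i * p j) = (\<Prod>(i, j)\<in>?D. 1 - p i * p j) * (\<Prod>(i, j)\<in>?P. 1 - p i * p j)"
    unfolding Q using fin by (subst prod.union_disjoint) auto
  also have "(\<Prod>(i, j)\<in>?D. 1 - p i * p j) = (\<Prod>i = 1..n. 1 - (p i)\<^sup>2)"
    unfolding D by (simp add: power2_eq_square)
  finally have prod: "prod ?f (half_triangle (2 * n + 1)) =
    (\<Prod>i = 1..n. 1 - \<alpha> * p i) * ((\<Prod>(i, j)\<in>?P. 1 - p i * p j) * ((\<Prod>i = 1..n. 1 - (p i)\<^sup>2) * (\<Prod>(i, j)\<in>?P. 1 - p i * p j)))" .
  have pp: "p i * p j < 1" if "i \<in> {1..n}" "j \<in> {1..n}" for i j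
    using mult_strict_mono'[of "p i" 1 "p j" 1] p[OF that(1)] p[OF that(2)] by simp
  have nz1: "(\<Prod>(i, j)\<in>?P. 1 - p i * p j) \<noteq> 0"
  proof
    assume "(\<Prod>(i, j)\<in>?P. 1 - p i * p j) = 0"
    then obtain i j where "1 \<le> i" "i < j" "j \<le> n" "p i * p j = 1" unfolding prod_zero_iff[OF fin(1)] by auto
    then show False using pp[of i j] by simp
  qed
  have nz2: "(\<Prod>i = 1..n. 1 - (p i)\<^sup>2) \<noteq> 0"
  proof
    assume "(\<Prod>i = 1..n. 1 - (p i)\<^sup>2) = 0"
    then obtain i where "i \<in> {1..n}" "p i * p i = 1" by (auto simp: prod_zero_iff power2_eq_square)
    then show False using pp[of i i] by simp
  qed
  have nz3: "(\<Prod>i = 1..n. 1 - \<alpha> * p i) \<noteq> 0"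
  proof
    assume "(\<Prod>i = 1..n. 1 - \<alpha> * p i) = 0"
    then obtain i where "i \<in> {1..n}" "\<alpha> * p i = 1" by (auto simp: prod_zero_iff)
    then show False using a[of i] by simp
  qed
  have "normalization_const n p \<alpha> = (1 / (\<Prod>(i, j)\<in>?P. 1 - p i * p j)\<^sup>2) * (1 / (\<Prod>i = 1..n. 1 - (p i)\<^sup>2) * (1 / (\<Prod>i = 1..n. 1 - \<alpha> * p i)))"
    unfolding normalization_const_def prod.distrib
    by (simp add: case_prod_unfold prod_dividef prod_power_distrib)
  then show ?thesis unfolding prod using nz1 nz2 nz3 by (simp add: field_simps power2_eq_square)
qed

section \<open>Geometric weights\<close>

lemma measurable_count_space_binop:
  fixes f :: "'a \<Rightarrow> 'b::countable" and g :: "'a \<Rightarrow> 'c::countable"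
  assumes f: "f \<in> M \<rightarrow>\<^sub>M count_space UNIV" and g: "g \<in> M \<rightarrow>\<^sub>M count_space UNIV"
  shows "(\<lambda>x. h (f x) (g x)) \<in> M \<rightarrow>\<^sub>M count_space UNIV"
  by (rule measurable_compose_countable[OF _ f, of "\<lambda>a x. h a (g x)"])
     (rule measurable_compose_countable[OF _ g], simp)

lemma measurable_lpp:
  assumes "\<And>i j. w i j \<in> M \<rightarrow>\<^sub>M count_space UNIV"
  shows "(\<lambda>\<omega>. lpp (\<lambda>i j. w i j \<omega>) i j) \<in> M \<rightarrow>\<^sub>M count_space UNIV"
proof (induction "i + j" arbitrary: i j rule: less_induct)
  case less
  show ?case
  proof (cases "i = 0 \<or> j = 0")
    case True
    then show ?thesis by (auto simp: lpp_zero)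
  next
    case False
    have "(\<lambda>\<omega>. lpp (\<lambda>i j. w i j \<omega>) (i - 1) j) \<in> M \<rightarrow>\<^sub>M count_space UNIV" "(\<lambda>\<omega>. lpp (\<lambda>i j. w i j \<omega>) i (j - 1)) \<in> M \<rightarrow>\<^sub>M count_space UNIV"
      using False by (auto intro!: less)
    from measurable_count_space_binop[OF measurable_count_space_binop[OF this, of max] assms, of "(+)" "min i j" "max i j"]
    show ?thesis using False by (simp add: lpp_step sym_entry_def min_def max_def if_distrib cong: if_cong)
  qed
qed

locale doubly_symmetric_model =
  fixes M :: "'a measure" and n :: nat and p :: "nat \<Rightarrow> real" and \<alpha> :: real and W :: "nat \<Rightarrow> nat \<Rightarrow> 'a \<Rightarrow> nat"
  assumes n: "1 \<le> n" and weights: "doubly_symmetric_weights M n p \<alpha> W"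
begin

abbreviation "q \<equiv> reflect_params n p"
abbreviation "T \<equiv> half_triangle (2 * n + 1)"

sublocale prob_space M
  using weights by (simp add: doubly_symmetric_weights_def Let_def)

lemma doubly_symmetric: "\<omega> \<in> space M \<Longrightarrow> doubly_symmetric n (\<lambda>i j. W i j \<omega>)"
  using weights unfolding doubly_symmetric_weights_def Let_def doubly_symmetric_def by blast

lemma indep: "indep_vars (\<lambda>_. count_space UNIV) (\<lambda>(i, j). W i j) T"
  using weights unfolding doubly_symmetric_weights_def Let_def half_triangle_def by blast

lemma measurable_W: "(i, j) \<in> T \<Longrightarrow> W i j \<in> M \<rightarrow>\<^sub>M count_space UNIV"
  using indep unfolding indep_vars_def by fastforce

lemma events_W: "(i, j) \<in> T \<Longrightarrow> {\<omega> \<in> space M. W i j \<omega> = k} \<in> events"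
  using measurable_sets[OF measurable_W, of i j "{k}"] by (simp add: vimage_def Int_def conj_commute)

lemma last_passage_event: "{\<omega> \<in> space M. last_passage_time (\<lambda>i j. W i j \<omega>) (2 * n) (2 * n) \<le> K} \<in> events"
proof -
  \<comment> \<open>Measurability is drawn from independence, which concerns the half triangle; zero
    is put elsewhere, and \<open>lpp\<close> does not see the difference.\<close>
  define w where "w i j = (if (i, j) \<in> T then W i j else (\<lambda>_. 0))" for i j
  have w: "w i j \<in> M \<rightarrow>\<^sub>M count_space UNIV" for i j by (simp add: w_def measurable_W)
  have lpp: "lpp (\<lambda>i j. W i j \<omega>) i j = lpp (\<lambda>i j. w i j \<omega>) i j" if "i + j \<le> 2 * n + 1" for i j \<omega>
    by (rule lpp_cong[OF _ that]) (simp add: w_def)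
  have "last_passage_time (\<lambda>i j. W i j \<omega>) (2 * n) (2 * n) \<le> K \<longleftrightarrow> (\<forall>i\<in>{1..2*n}. \<forall>j\<in>{1..2*n}. i + j = 2*n + 1 \<longrightarrow>
      2 * lpp (\<lambda>i j. w i j \<omega>) i j \<le> K + w (min i j) (max i j) \<omega>)" (is "_ = ?R \<omega>") if "\<omega> \<in> space M" for \<omega>
  proof -
    interpret doubly_symmetric n "\<lambda>i j. W i j \<omega>" by (rule doubly_symmetric[OF that])
    have "w (min i j) (max i j) \<omega> = W i j \<omega>" if "i \<in> {1..2*n}" "j \<in> {1..2*n}" "i + j = 2*n + 1" for i j
      using that sym[OF that(1,2)] by (auto simp: w_def half_triangle_def min_def max_def)
    then show ?thesis unfolding last_passage_time_le_iff[OF n] using lpp by auto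
  qed
  then have "{\<omega> \<in> space M. last_passage_time (\<lambda>i j. W i j \<omega>) (2 * n) (2 * n) \<le> K} = {\<omega> \<in> space M. ?R \<omega>}" by blast
  also have "\<dots> \<in> events"
  proof (intro sets.sets_Collect_finite_All' finite_atLeastAtMost)
    fix i j
    have "(\<lambda>\<omega>. 2 * lpp (\<lambda>i j. w i j \<omega>) i j \<le> K + w (min i j) (max i j) \<omega>) \<in> M \<rightarrow>\<^sub>M count_space UNIV"
      by (rule measurable_count_space_binop[OF measurable_lpp[OF w] w, of "\<lambda>a b. 2 * a \<le> K + b"])
    then show "{\<omega> \<in> space M. i + j = 2*n + 1 \<longrightarrow> 2 * lpp (\<lambda>i j. w i j \<omega>) i j \<le> K + w (min i j) (max i j) \<omega>} \<in> events"
      by (cases "i + j = 2 * n + 1") (simp_all add: pred_def)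
  qed (use n in auto)
  finally show ?thesis .
qed

text \<open>After halving on the antidiagonal, where \<open>q i = q j\<close>, all laws are
  geometric: with parameter \<open>\<alpha> * q i\<close> on the diagonal and
  \<open>q i * q j\<close> off it.\<close>

lemma prob_W:
  assumes "(i, j) \<in> T"
  shows "\<P>(\<omega> in M. W i j \<omega> = (if i + j = 2 * n + 1 then 2 * k else k)) =
    (if i = j then (1 - \<alpha> * q i) * (\<alpha> * q i) ^ k else (1 - q i * q j) * (q i * q j) ^ k)"
proof -
  have ij: "1 \<le> i" "i \<le> j" "i + j \<le> 2 * n + 1" using assms by (auto simp: half_triangle_def)
  show ?thesis
  proof (cases "i = j")
    case True
    then have "j \<le> n" "i + j \<noteq> 2 * n + 1" using ij by presburger+
    then show ?thesis using True weights ij by (simp add: doubly_symmetric_weights_def Let_def)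
  next
    case False
    then have less: "i < j" using ij by simp
    show ?thesis
    proof (cases "i + j = 2 * n + 1")
      case True
      then have "2 * n + 1 - j = i" by linarith
      with less True have "q i = q j" by (simp add: reflect_params_def)
      moreover have "\<P>(\<omega> in M. W i j \<omega> = 2 * k) = (1 - (q j)\<^sup>2) * q j ^ (2 * k)"
        using weights ij(1) less True by (simp add: doubly_symmetric_weights_def Let_def)
      ultimately show ?thesis using less True by (simp add: power_mult power2_eq_square)
    next
      case False
      then show ?thesis using weights ij less by (simp add: doubly_symmetric_weights_def Let_def)
    qed
  qed
qed

lemma AE_antidiagonal_even:
  "AE \<omega> in M. \<forall>(i, j)\<in>T. i + j = 2 * n + 1 \<longrightarrow> even (W i j \<omega>)"
proof -
  have "AE \<omega> in M. \<forall>a\<in>T. \<forall>k. fst a + snd a = 2 * n + 1 \<and> odd k \<longrightarrow> W (fst a) (snd a) \<omega> \<noteq> k"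
    unfolding AE_finite_all[OF finite_half_triangle] AE_all_countable
  proof (intro ballI allI)
    fix a :: "nat \<times> nat" and k :: nat assume a: "a \<in> T"
    show "AE \<omega> in M. fst a + snd a = 2 * n + 1 \<and> odd k \<longrightarrow> W (fst a) (snd a) \<omega> \<noteq> k"
    proof (cases "fst a + snd a = 2 * n + 1 \<and> odd k")
      case True
      then have lt: "1 \<le> fst a" "fst a < snd a" using a by (auto simp: half_triangle_def split: prod.splits) presburger?
      have "\<P>(\<omega> in M. W (fst a) (snd a) \<omega> = k) = 0"
        using weights lt True unfolding doubly_symmetric_weights_def Let_def by presburger
      then show ?thesis using True events_W[of "fst a" "snd a" k] a prob_Collect_eq_0[of "\<lambda>\<omega>. W (fst a) (snd a) \<omega> = k"] by simp
    qed auto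
  qed
  then show ?thesis by eventually_elim fastforce
qed

text \<open>\<open>E v\<close> is the event that the folded, halved weights equal \<open>v\<close>.
  As antidiagonal weights are even almost surely, the event in question is the disjoint union of the
  \<open>E v\<close> up to a null set, and independence evaluates each of them.\<close>

theorem prob_last_passage_time:
  "\<P>(\<omega> in M. last_passage_time (\<lambda>i j. W i j \<omega>) (2 * n) (2 * n) \<le> 2 * u) =
    (\<Sum>v\<in>lpp_bounded (2 * n + 1) u. \<Prod>(i, j)\<in>T.
       if i = j then (1 - \<alpha> * q i) * (\<alpha> * q i) ^ v i j else (1 - q i * q j) * (q i * q j) ^ v i j)"
proof -
  define val :: "nat \<times> nat \<Rightarrow> (nat \<Rightarrow> nat \<Rightarrow> nat) \<Rightarrow> nat"
    where "val a v = (case a of (i, j) \<Rightarrow> if i + j = 2 * n + 1 then 2 * v i j else v i j)" for a v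
  define E where "E v = (\<Inter>a\<in>T. (case_prod W) a -` {val a v} \<inter> space M)" for v
  have ne: "T \<noteq> {}" using n by (auto simp: half_triangle_def intro!: exI[of _ "1::nat"])
  have E_iff: "\<omega> \<in> E v \<longleftrightarrow> \<omega> \<in> space M \<and> (\<forall>i j. (i, j) \<in> T \<longrightarrow> W i j \<omega> = val (i, j) v)" for \<omega> v
    unfolding E_def using ne by auto
  have E: "E v \<in> events" for v
    unfolding E_def
  proof (rule sets.finite_INT[OF finite_half_triangle ne])
    fix a assume "a \<in> T"
    then show "case_prod W a -` {val a v} \<inter> space M \<in> events"
      using measurable_sets[OF measurable_W, of "fst a" "snd a" "{val a v}"] by (simp add: case_prod_unfold)
  qed
  have prob_E: "prob (E v) = (\<Prod>(i, j)\<in>T. if i = j then (1 - \<alpha> * q i) * (\<alpha> * q i) ^ v i j else (1 - q i * q j) * (q i * q j) ^ v i j)" for v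
    unfolding E_def
  proof (subst indep_varsD_finite[OF indep ne finite_half_triangle])
    show "(\<Prod>a\<in>T. prob (case_prod W a -` {val a v} \<inter> space M)) =
      (\<Prod>(i, j)\<in>T. if i = j then (1 - \<alpha> * q i) * (\<alpha> * q i) ^ v i j else (1 - q i * q j) * (q i * q j) ^ v i j)"
    proof (intro prod.cong refl)
      fix a assume a: "a \<in> T"
      obtain i j where ij: "a = (i, j)" by fastforce
      have "case_prod W a -` {val a v} \<inter> space M = {\<omega> \<in> space M. W i j \<omega> = (if i + j = 2 * n + 1 then 2 * v i j else v i j)}"
        by (auto simp: ij val_def)
      then show "prob (case_prod W a -` {val a v} \<inter> space M) =
        (case a of (i, j) \<Rightarrow> if i = j then (1 - \<alpha> * q i) * (\<alpha> * q i) ^ v i j else (1 - q i * q j) * (q i * q j) ^ v i j)"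
        using prob_W[of i j "v i j"] a ij by simp
    qed
  qed simp
  have halve: "halve n (\<lambda>i j. W i j \<omega>) = v" if "\<omega> \<in> E v" "v \<in> lpp_bounded (2 * n + 1) u" for \<omega> v
    using that unfolding E_iff by (intro ext) (auto simp: halve_def val_def lpp_bounded_def)
  have "AE \<omega> in M. \<omega> \<in> {\<omega> \<in> space M. last_passage_time (\<lambda>i j. W i j \<omega>) (2 * n) (2 * n) \<le> 2 * u} \<longleftrightarrow>
      \<omega> \<in> (\<Union>v\<in>lpp_bounded (2 * n + 1) u. E v)"
    using AE_antidiagonal_even AE_space
  proof eventually_elim
    case (elim \<omega>)
    interpret doubly_symmetric n "\<lambda>i j. W i j \<omega>" by (rule doubly_symmetric[OF elim(2)])
    have "even (W i j \<omega>)" if "(i, j) \<in> T" "i + j = 2 * n + 1" for i j using elim(1) that by blast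
    note ev = this
    have "last_passage_time (\<lambda>i j. W i j \<omega>) (2 * n) (2 * n) \<le> 2 * u \<longleftrightarrow> halve n (\<lambda>i j. W i j \<omega>) \<in> lpp_bounded (2 * n + 1) u"
      by (rule last_passage_time_halve[OF n ev])
    moreover have "\<omega> \<in> E (halve n (\<lambda>i j. W i j \<omega>))"
      unfolding E_iff using elim(2) ev by (auto simp: val_def halve_def)
    ultimately show ?case using halve elim(2) by auto
  qed
  then have "\<P>(\<omega> in M. last_passage_time (\<lambda>i j. W i j \<omega>) (2 * n) (2 * n) \<le> 2 * u) = prob (\<Union>v\<in>lpp_bounded (2 * n + 1) u. E v)"
    using last_passage_event finite_lpp_bounded E by (intro finite_measure_eq_AE) auto
  also have "\<dots> = (\<Sum>v\<in>lpp_bounded (2 * n + 1) u. prob (E v))"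
  proof (intro finite_measure_finite_Union finite_lpp_bounded)
    show "disjoint_family_on E (lpp_bounded (2 * n + 1) u)"
      unfolding disjoint_family_on_def using halve by (metis disjoint_iff)
  qed (use E in blast)
  finally show ?thesis unfolding prob_E .
qed

theorem normalized_prob:
  assumes p: "\<And>i. i \<in> {1..n} \<Longrightarrow> 0 < p i \<and> p i < 1" and a: "\<And>j. j \<in> {1..n} \<Longrightarrow> \<alpha> * p j < 1"
  shows "normalization_const n p \<alpha> * \<P>(\<omega> in M. last_passage_time (\<lambda>i j. W i j \<omega>) (2 * n) (2 * n) \<le> 2 * u) =
    (\<Sum>w\<in>lpp_bounded (2 * n + 1) u. \<alpha> ^ (\<Sum>i<n. w (Suc i) (Suc i)) *
      (\<Prod>k = 1..n. p k ^ (row_sum (2 * n + 1) k w + row_sum (2 * n + 1) (2 * n + 1 - k) w)))"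
proof -
  define Z where "Z = (\<Prod>(i, j)\<in>T. if i = j then 1 - \<alpha> * q i else 1 - q i * q j)"
  have weight: "(\<Prod>(i, j)\<in>T. if i = j then (1 - \<alpha> * q i) * (\<alpha> * q i) ^ v i j else (1 - q i * q j) * (q i * q j) ^ v i j) =
    Z * (\<alpha> ^ (\<Sum>i<n. v (Suc i) (Suc i)) * (\<Prod>k = 1..2 * n. q k ^ row_sum (2 * n + 1) k v))" for v
    using prod_half_triangle[where s = "2 * n + 1" and q = q and v = v and \<alpha> = \<alpha>]
    unfolding Z_def by (subst (asm) eq_commute) (simp add: prod.distrib[symmetric] case_prod_unfold, intro prod.cong refl, simp)
  have split: "(\<Prod>k = 1..2 * n. q k ^ row_sum (2 * n + 1) k v) =
    (\<Prod>k = 1..n. p k ^ (row_sum (2 * n + 1) k v + row_sum (2 * n + 1) (2 * n + 1 - k) v))" for v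
  proof -
    have "{1..2 * n} = {1..n} \<union> {n + 1..2 * n}" by auto
    then have "(\<Prod>k = 1..2 * n. q k ^ row_sum (2 * n + 1) k v) =
      (\<Prod>k = 1..n. q k ^ row_sum (2 * n + 1) k v) * (\<Prod>k = n + 1..2 * n. q k ^ row_sum (2 * n + 1) k v)"
      by (simp add: prod.union_disjoint)
    also have "(\<Prod>k = 1..n. q k ^ row_sum (2 * n + 1) k v) = (\<Prod>k = 1..n. p k ^ row_sum (2 * n + 1) k v)"
      by (intro prod.cong refl) (simp add: reflect_params_def)
    also have "(\<Prod>k = n + 1..2 * n. q k ^ row_sum (2 * n + 1) k v) = (\<Prod>k = 1..n. p k ^ row_sum (2 * n + 1) (2 * n + 1 - k) v)"
      by (rule prod.reindex_bij_witness[of _ "\<lambda>k. 2 * n + 1 - k" "\<lambda>k. 2 * n + 1 - k"]) (auto simp: reflect_params_def)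
    finally show ?thesis by (simp add: power_add prod.distrib)
  qed
  have "normalization_const n p \<alpha> * Z = 1"
    unfolding Z_def by (rule prod_normalization[OF p a])
  then have Z: "normalization_const n p \<alpha> * (Z * x) = x" for x by (simp add: mult.assoc[symmetric])
  show ?thesis
    unfolding prob_last_passage_time weight split sum_distrib_left Z ..
qed

end

section \<open>Partitions as lists\<close>

lemma partitions_in_box_eq: "partitions_in_box n u = (\<lambda>f. map f [0..<n]) ` Par n u"
proof (intro equalityI subsetI)
  fix \<nu> assume \<nu>: "\<nu> \<in> partitions_in_box n u"
  define f where "f k = (if k < n then \<nu> ! k else 0)" for k
  have len: "length \<nu> = n" using \<nu> by (simp add: partitions_in_box_def)
  have "\<nu> ! j \<le> \<nu> ! i" if "i \<le> j" "j < n" for i j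
    using that \<nu> len by (cases "i = j") (auto simp: partitions_in_box_def sorted_wrt_iff_nth_less)
  then have "antimono f" by (auto simp: f_def antimono_def)
  moreover have "f 0 \<le> u" using \<nu> len by (auto simp: f_def partitions_in_box_def)
  ultimately have "f \<in> Par n u" by (simp add: Par_def f_def)
  moreover have "\<nu> = map f [0..<n]" using len by (intro nth_equalityI) (auto simp: f_def)
  ultimately show "\<nu> \<in> (\<lambda>f. map f [0..<n]) ` Par n u" by blast
next
  fix \<nu> assume "\<nu> \<in> (\<lambda>f. map f [0..<n]) ` Par n u"
  then obtain f where f: "f \<in> Par n u" "\<nu> = map f [0..<n]" by blast
  then have am: "antimono f" "f 0 \<le> u" by (auto simp: Par_def)
  have "f k \<le> u" for k using antimonoD[OF am(1), of 0 k] am(2) by simp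
  then show "\<nu> \<in> partitions_in_box n u"
    using f(2) am(1) by (auto simp: partitions_in_box_def sorted_wrt_map sorted_wrt_iff_nth_less intro: antimonoD)
qed

lemma inj_on_Par: "inj_on (\<lambda>f. map f [0..<n]) (Par n u)"
proof (intro inj_onI ext)
  fix f g k assume fg: "f \<in> Par n u" "g \<in> Par n u" "map f [0..<n] = map g [0..<n]"
  then show "f k = g k" by (cases "k < n") (auto simp: Par_def)
qed

lemma sum_partitions_in_box: "(\<Sum>\<nu>\<in>partitions_in_box n u. h \<nu>) = (\<Sum>f\<in>Par n u. h (map f [0..<n]))"
  unfolding partitions_in_box_eq by (subst sum.reindex[OF inj_on_Par]) simp

lemma box_complement_box_complement:
  "\<nu> \<in> partitions_in_box n u \<Longrightarrow> box_complement u (box_complement u \<nu>) = \<nu>"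
  by (auto simp: partitions_in_box_def box_complement_def rev_map intro!: map_idI)

lemma sum_box_complement:
  "(\<Sum>\<nu>\<in>partitions_in_box n u. h \<nu>) = (\<Sum>\<nu>\<in>partitions_in_box n u. h (box_complement u \<nu>))"
proof -
  have "box_complement u \<nu> \<in> partitions_in_box n u" if "\<nu> \<in> partitions_in_box n u" for \<nu>
    using that by (auto simp: partitions_in_box_def box_complement_def sorted_wrt_map sorted_wrt_rev elim!: sorted_wrt_mono_rel[rotated])
  then show ?thesis
    by (intro sum.reindex_bij_witness[of _ "box_complement u" "box_complement u"]) (simp_all add: box_complement_box_complement)
qed

lemma symplectic_schur_box_complement:
  "symplectic_schur (box_complement u (map f [0..<length xs])) xs = (\<Sum>z\<in>symp_fiber u (length xs) f. symp_weight xs z)"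
proof -
  have "pattern_shape (2 * n) z = box_complement u (map f [0..<n]) \<longleftrightarrow> (\<forall>i\<in>{1..n}. z (2 * n) i = u - f (n - i))" for n and z :: "nat \<Rightarrow> nat \<Rightarrow> nat"
  proof -
    have "pattern_shape (2 * n) z = box_complement u (map f [0..<n]) \<longleftrightarrow> (\<forall>j<n. z (2 * n) (Suc j) = u - f (n - Suc j))"
      by (simp add: list_eq_iff_nth_eq pattern_shape_def box_complement_def rev_nth del: upt_Suc)
    also have "\<dots> \<longleftrightarrow> (\<forall>i\<in>{1..n}. z (2 * n) i = u - f (n - i))"
      by (metis atLeastAtMost_iff Suc_le_eq Suc_le_D le_numeral_extra(4) One_nat_def Suc_le_mono zero_le)
    finally show ?thesis .
  qed
  then show ?thesis by (simp add: symplectic_schur_def symp_fiber_def symp_weight_def)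
qed

lemma length_filter_eq_cnt:
  assumes "f \<in> Par n u" "0 < j"
  shows "length (filter (\<lambda>x. j \<le> x) (map f [0..<n])) = cnt f j"
proof -
  have "{k. j \<le> f k} = {k. k < n \<and> j \<le> f k}"
    using assms by (auto simp: Par_def) (metis leD leI)
  then show ?thesis by (simp add: cnt_def length_filter_conv_card cong: conj_cong)
qed

text \<open>\<open>conjugate\<close> stops at the largest part, while the columns on the right run
  up to \<open>u\<close>; the additional ones have length 0, which is even.\<close>

lemma oddrows_conjugate:
  assumes f: "f \<in> Par n u"
  shows "oddrows (conjugate (map f [0..<n])) = card {i \<in> {..<u}. odd (cnt f (u - i))}"
proof -
  define m where "m = Max (insert 0 (set (map f [0..<n])))"
  have le: "f k \<le> m" for k
  proof (cases "k < n")
    case True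
    then show ?thesis unfolding m_def by (intro Max_ge) auto
  qed (use f in \<open>simp add: Par_def\<close>)
  have "f k \<le> u" for k using f antimonoD[of f 0 k] by (auto simp: Par_def)
  then have mu: "m \<le> u" unfolding m_def by (subst Max_le_iff) auto
  have z: "cnt f j = 0" if "m < j" for j
  proof -
    have "{k. j \<le> f k} = {}" using le that by (auto simp: not_le intro: le_less_trans)
    then show ?thesis by (simp add: cnt_def)
  qed
  have "conjugate (map f [0..<n]) = map (cnt f) [1..<Suc m]"
    unfolding conjugate_def m_def[symmetric]
    by (intro map_cong refl length_filter_eq_cnt[OF f]) auto
  then have "oddrows (conjugate (map f [0..<n])) = length (filter (\<lambda>j. odd (cnt f j)) [1..<Suc m])"
    by (simp add: oddrows_def filter_map o_def del: upt_Suc)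
  also have "\<dots> = card {j. 1 \<le> j \<and> j \<le> m \<and> odd (cnt f j)}"
    by (subst distinct_length_filter) (auto intro!: arg_cong[where f = card])
  also have "\<dots> = card {i \<in> {..<u}. odd (cnt f (u - i))}"
    by (rule bij_betw_same_card[of "\<lambda>j. u - j"], rule bij_betw_byWitness[where f' = "\<lambda>i. u - i"])
       (use mu z in \<open>auto intro: ccontr simp: not_le[symmetric]\<close>)
  finally show ?thesis .
qed

section \<open>The algebraic quantities as one coefficient\<close>

context
  fixes n u :: nat and p :: "nat \<Rightarrow> real" and \<alpha> :: real and ps :: "real list"
  assumes pos: "\<And>i. i \<in> {1..n} \<Longrightarrow> 0 < p i"
  defines "ps \<equiv> map p [1..<Suc n]"
begin

lemma length_ps: "length ps = n"
  by (simp add: ps_def)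

lemma prod_list_ps: "prod_list ps = (\<Prod>i = 1..n. p i)"
  by (simp add: ps_def prod.distinct_set_conv_list[symmetric] atLeastLessThanSuc_atLeastAtMost del: upt_Suc)

lemma ps_nonzero: "x \<in> set ps \<Longrightarrow> x \<noteq> 0"
  using pos by (fastforce simp: ps_def)

lemma symplectic_sum_eq:
  "(\<Prod>i = 1..n. p i) ^ u *
      (\<Sum>\<nu>\<in>partitions_in_box n u. \<alpha> ^ oddrows (conjugate (box_complement u \<nu>)) * symplectic_schur \<nu> ps) =
    (\<Sum>f\<in>Par n u. \<alpha> ^ card {i \<in> {..<u}. odd (cnt f (u - i))} *
       ((\<Prod>i = 1..n. p i) ^ u * (\<Sum>z\<in>symp_fiber u n f. symp_weight ps z)))"
proof -
  have "(\<Sum>\<nu>\<in>partitions_in_box n u. \<alpha> ^ oddrows (conjugate (box_complement u \<nu>)) * symplectic_schur \<nu> ps) =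
    (\<Sum>\<nu>\<in>partitions_in_box n u. \<alpha> ^ oddrows (conjugate \<nu>) * symplectic_schur (box_complement u \<nu>) ps)"
    by (subst sum_box_complement) (simp add: box_complement_box_complement)
  also have "\<dots> = (\<Sum>f\<in>Par n u. \<alpha> ^ card {i \<in> {..<u}. odd (cnt f (u - i))} * (\<Sum>z\<in>symp_fiber u n f. symp_weight ps z))"
    unfolding sum_partitions_in_box
    using symplectic_schur_box_complement[of u _ ps] by (intro sum.cong refl) (simp add: oddrows_conjugate length_ps)
  finally show ?thesis by (simp add: sum_distrib_left mult.left_commute)
qed

lemma symplectic_sum_eq_coef:
  "(\<Sum>f\<in>Par n u. \<alpha> ^ card {i \<in> {..<u}. odd (cnt f (u - i))} *
       ((\<Prod>i = 1..n. p i) ^ u * (\<Sum>z\<in>symp_fiber u n f. symp_weight ps z))) =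
    coef (up u \<alpha> * (dns u ps * ups u ps * vandermonde u)) (pos u (\<lambda>_. 0))"
proof -
  have "(\<Prod>i = 1..n. p i) ^ u * (\<Sum>z\<in>symp_fiber u n f. symp_weight ps z) = col_symp u ps f" if "f \<in> Par n u" for f
    using symp_fiber_eq_col_symp[of f ps u] that ps_nonzero by (simp add: length_ps prod_list_ps)
  then show ?thesis unfolding sum_col_symp[OF length_ps, symmetric] by (intro sum.cong refl) simp
qed

lemma schur_rect_eq_coef:
  "(\<Prod>i = 1..n. p i) ^ u * schur (replicate n u @ replicate (n + 1) 0) (map inverse ps @ ps @ [\<alpha>]) =
    coef (up u \<alpha> * (dns u ps * ups u ps * vandermonde u)) (pos u (\<lambda>_. 0))"
proof -
  have "rect n u \<in> Par (2 * n + 1) u" by (auto simp: Par_def rect_def antimono_def)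
  moreover have "replicate n u @ replicate (n + 1) 0 = map (rect n u) [0..<2 * n + 1]"
    by (rule nth_equalityI) (auto simp: rect_def nth_append simp del: replicate_Suc upt_Suc)
  ultimately have "schur (replicate n u @ replicate (n + 1) 0) (map inverse ps @ ps @ [\<alpha>]) =
    col_schur u (map inverse ps @ ps @ [\<alpha>]) (rect n u)"
    by (simp only: schur_eq_col_schur)
  then show ?thesis using col_schur_rect[OF length_ps ps_nonzero, of u \<alpha>] by (simp only: prod_list_ps)
qed

lemma schur_sum_eq_coef:
  "(\<Sum>\<mu>\<in>partitions_in_box n u. schur \<mu> ps * schur (\<mu> @ [0]) (ps @ [\<alpha>])) =
    coef (up u \<alpha> * (dns u ps * ups u ps * vandermonde u)) (pos u (\<lambda>_. 0))"
  unfolding sum_partitions_in_box sum_col_schur[OF length_ps, symmetric]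
proof (intro sum.cong refl)
  fix f assume f: "f \<in> Par n u"
  then have "f \<in> Par (Suc n) u" "map f [0..<n] @ [0] = map f [0..<Suc n]" by (auto simp: Par_def)
  then show "schur (map f [0..<n]) ps * schur (map f [0..<n] @ [0]) (ps @ [\<alpha>]) = col_schur u ps f * col_schur u (ps @ [\<alpha>]) f"
    using f by (simp only: schur_eq_col_schur)
qed

end

theorem theorem4p10:
  fixes M :: "'a measure" and n u :: nat and p :: "nat \<Rightarrow> real" and \<alpha> :: real
    and W :: "nat \<Rightarrow> nat \<Rightarrow> 'a \<Rightarrow> nat"
  assumes "n \<ge> 1"
    and "\<And>i. i \<in> {1..n} \<Longrightarrow> 0 < p i \<and> p i < 1"
    and "\<alpha> \<ge> 0"
    and "\<And>j. j \<in> {1..n} \<Longrightarrow> \<alpha> * p j < 1"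
    and "doubly_symmetric_weights M n p \<alpha> W"
  defines "ps \<equiv> map p [1..<Suc n]"
  defines "A \<equiv> normalization_const n p \<alpha> *
      \<P>(\<omega> in M. last_passage_time (\<lambda>i j. W i j \<omega>) (2 * n) (2 * n) \<le> 2 * u)"
    and "B \<equiv> (\<Prod>i = 1..n. p i) ^ u *
      (\<Sum>\<nu> \<in> partitions_in_box n u.
         \<alpha> ^ oddrows (conjugate (box_complement u \<nu>)) * symplectic_schur \<nu> ps)"
    and "C \<equiv> (\<Prod>i = 1..n. p i) ^ u *
      schur (replicate n u @ replicate (n + 1) 0) (map inverse ps @ ps @ [\<alpha>])"
    and "D \<equiv> (\<Sum>\<mu> \<in> partitions_in_box n u. schur \<mu> ps * schur (\<mu> @ [0]) (ps @ [\<alpha>]))"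
  shows "A = B \<and> B = C \<and> C = D"
proof -
  interpret doubly_symmetric_model M n p \<alpha> W
    using assms(1,5) by unfold_locales
  have p_pos: "0 < p i" if "i \<in> {1..n}" for i using assms(2)[OF that] by blast
  \<comment> \<open>The percolation side and the symplectic side meet in this sum, indexed by
    complements of shapes; the Schur sides are reached through its value as a coefficient.\<close>
  define S where "S = (\<Sum>f\<in>Par n u. \<alpha> ^ card {i \<in> {..<u}. odd (cnt f (u - i))} *
       ((\<Prod>i = 1..n. p i) ^ u * (\<Sum>z\<in>symp_fiber u n f. symp_weight ps z)))"
  have "A = S"
    unfolding A_def S_def ps_def by (rule trans[OF normalized_prob[OF assms(2,4)] sum_lpp_eq_symp[OF p_pos]])
  moreover have "B = S"
    unfolding B_def S_def ps_def by (rule symplectic_sum_eq[OF p_pos])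
  moreover have "S = coef (up u \<alpha> * (dns u ps * ups u ps * vandermonde u)) (pos u (\<lambda>_. 0))"
    unfolding S_def ps_def by (rule symplectic_sum_eq_coef[OF p_pos])
  moreover have "C = coef (up u \<alpha> * (dns u ps * ups u ps * vandermonde u)) (pos u (\<lambda>_. 0))"
    unfolding C_def ps_def by (rule schur_rect_eq_coef[OF p_pos])
  moreover have "D = coef (up u \<alpha> * (dns u ps * ups u ps * vandermonde u)) (pos u (\<lambda>_. 0))"
    unfolding D_def ps_def by (rule schur_sum_eq_coef[OF p_pos])
  ultimately show ?thesis by simp
qed

end
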